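(* Let $\mu>0$, $R\ge1$. Assume $\lambda_i\le C_A i^{-p}$ for $i=1,\dots,D$ with some $p>1/2$ and $0<C_A<\infty$, and $\xi=\delta Z$ with $Z\sim\mathcal N(0,I_D)$, $\delta\in(0,1)$. Write $$\mathcal R^{\mathrm{rec}}=R^{(4p+2)/(4\mu p+2p+1)}\delta^{8\mu p/(4\mu p+2p+1)}.$$ If $\|f\|_\mu\le R$, then the reconstruction error at the balanced oracle $\tau_{\mathfrak b}$ satisfies $$\mathbb{E}\big[\|\widehat f_{\tau_{\mathfrak b}}-f^\dagger\|^2\big]\le C_{\mu,p,C_A}\,\mathcal R^{\mathrm{rec}}$$ with a constant $C_{\mu,p,C_A}>0$ depending only on $\mu,p,C_A$. In particular, if also $\lambda_i\ge c_Ai^{-p}$ for $i=1,\dots,D$ with some $c_A>0$, the balanced oracle is simultaneously minimax adaptive for prediction and reconstruction error for all $\mu>0$ with $(R^2\delta^{-2})^{1/(4\mu p+2p+1)}\lesssim_{\mu,p,c_A}D$.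
   Context: Model: $D\ge 3$ and $P\ge D$ are integers, $A\in\mathbb{R}^{D\times P}$ has rank $D$, $f\in\mathbb{R}^P$, $g=Af$, $\xi\in\mathbb{R}^D$ is an error vector, and $Y=g+\xi$ is observed. $\|\cdot\|$ is the Euclidean norm, $A^\dagger=A^\top(AA^\top)^{-1}$, $f^\dagger=A^\dagger g$ is the minimum-norm solution of $g=Af$. Let $\lambda_1\ge\dots\ge\lambda_D>0$ be the nonzero singular values of $A$ (with multiplicity), $u_i$, $v_i$ the left and right singular vectors, $\tilde\lambda_1>\dots>\tilde\lambda_d>0$ the distinct singular values. Put $Y_i=\langle Y,u_i\rangle$, $f_i=\langle f,v_i\rangle$. For a function $h$ on $[0,\infty)$ and $w\in\mathbb{R}^D$, $h(AA^\top)w=\sum_{i=1}^D h(\lambda_i^2)\langle w,u_i\rangle u_i$. Standing assumption: $\sum_{j:\lambda_j=\lambda_i}Y_j^2>0$ for all $i=1,\dots,D$ (this holds almost surely under Gaussian noise). Source condition: $\|f\|_\mu=\big(\sum_{i=1}^D\lambda_i^{-4\mu}f_i^2\big)^{1/2}$. Interpolated conjugate gradients: for $k=0,\dots,d$, $r_k$ is the unique minimiser of $\|p(AA^\top)Y\|^2$ over real polynomials $p$ of degree at most $k$ with $p(0)=1$. For $t=k+\alpha$, $k\in\{0,\dots,d-1\}$, $\alpha\in(0,1]$, $r_t=(1-\alpha)r_k+\alpha r_{k+1}$. For $t\in[0,d]$: $\widehat f_t=A^\dagger(I_D-r_t(AA^\top))Y$ and $R_t^2=\|A\widehat f_t-Y\|^2=\|r_t(AA^\top)Y\|^2$.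 For $t\in(0,d]$, $x_{1,t}$ is the smallest zero of $r_t$ on $[0,\infty)$ and $r_{t,<}(x)=r_t(x)\mathbf 1(x<x_{1,t})$; $r_{0,<}\equiv1$. Error terms: $S_{t,\lambda}=\|(1-r_{t,<})^{1/2}(AA^\top)\xi\|^2$ and $A_{t,\lambda}=\|r_{t,<}^{1/2}(AA^\top)g\|^2+R_t^2-\|r_{t,<}^{1/2}(AA^\top)Y\|^2$. Balanced oracle: $\tau_{\mathfrak b}=\inf\{t\in[0,d]: A_{t,\lambda}\le S_{t,\lambda}\}$. Notation: $\lesssim_{\mu,p,c_A}$ denotes an inequality up to a constant that may depend on $\mu,p,c_A$. The prediction error of an estimator $\widehat f$ is $\|A(\widehat f-f)\|^2$, the reconstruction error is $\|\widehat f-f^\dagger\|^2$. For either error, the minimax rate is the order of the infimum over all $\mathbb{R}^P$-valued estimators of the supremum over $\{f:\|f\|_\mu\le R\}$ of the expected error; "minimax adaptive" for a range of $\mu$ means that the minimax rate is attained for every $\mu$ in this range. For the prediction error the rate in question is $R^{2/(4\mu p+2p+1)}\delta^{(8\mu p+4p)/(4\mu p+2p+1)}$, for the reconstruction error it is $\mathcal R^{\mathrm{rec}}$. *)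

theory Defs
  imports
    "HOL-Probability.Probability"
    "HOL-Computational_Algebra.Polynomial"
    "Jordan_Normal_Form.Gauss_Jordan_Elimination"
    "Jordan_Normal_Form.DL_Rank"
begin

text \<open>
  The constants of the result are uniform in the dimensions \<open>D\<close> and \<open>P\<close>, so these have to be
  quantified inside the statement; hence vectors and matrices with explicit carriers.
  From here on, \<open>vec\<close> and \<open>$\<close> refer to such vectors.
\<close>

unbundle no vec_syntax
no_notation inner (infix "\<bullet>" 70)
hide_type (open) Finite_Cartesian_Product.vec
hide_const (open) Finite_Cartesian_Product.vec Finite_Cartesian_Product.mat

definition vnorm :: "real vec \<Rightarrow> real" where
  "vnorm x = sqrt (x \<bullet> x)"


section \<open>The linear model\<close>

definition model :: "nat \<Rightarrow> nat \<Rightarrow> real mat \<Rightarrow> bool" where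
  "model D P A \<longleftrightarrow> 3 \<le> D \<and> D \<le> P \<and> A \<in> carrier_mat D P \<and> vec_space.rank D A = D"

text \<open>
  \<open>l\<close>, \<open>u\<close>, \<open>v\<close> (indexed from 1) are the nonzero singular values in decreasing order, repeated
  according to multiplicity, with orthonormal left and right singular vectors. Since \<open>A\<close> has rank
  \<open>D\<close>, there are exactly \<open>D\<close> of them.
\<close>
definition singular_system ::
  "real mat \<Rightarrow> (nat \<Rightarrow> real) \<Rightarrow> (nat \<Rightarrow> real vec) \<Rightarrow> (nat \<Rightarrow> real vec) \<Rightarrow> bool" where
  "singular_system A l u v \<longleftrightarrow>
     (\<forall>i\<in>{1..dim_row A}. 0 < l i) \<and>
     (\<forall>i\<in>{1..dim_row A}. \<forall>j\<in>{1..dim_row A}. i \<le> j \<longrightarrow> l j \<le> l i) \<and>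
     (\<forall>i\<in>{1..dim_row A}. u i \<in> carrier_vec (dim_row A) \<and> v i \<in> carrier_vec (dim_col A)) \<and>
     (\<forall>i\<in>{1..dim_row A}. \<forall>j\<in>{1..dim_row A}. u i \<bullet> u j = (if i = j then 1 else 0)) \<and>
     (\<forall>i\<in>{1..dim_row A}. \<forall>j\<in>{1..dim_row A}. v i \<bullet> v j = (if i = j then 1 else 0)) \<and>
     (\<forall>i\<in>{1..dim_row A}. A *\<^sub>v v i = l i \<cdot>\<^sub>v u i \<and> A\<^sup>T *\<^sub>v u i = l i \<cdot>\<^sub>v v i)"

definition num_distinct :: "real mat \<Rightarrow> (nat \<Rightarrow> real) \<Rightarrow> nat" where
  "num_distinct A l = card (l ` {1..dim_row A})"

text \<open>Under full row rank \<open>A * A\<^sup>T\<close> is invertible, so \<open>mat_inverse\<close> is never \<open>None\<close> here.\<close>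
definition pinv :: "real mat \<Rightarrow> real mat" where
  "pinv A = A\<^sup>T * the (mat_inverse (A * A\<^sup>T))"

definition min_norm_sol :: "real mat \<Rightarrow> real vec \<Rightarrow> real vec" where
  "min_norm_sol A f = pinv A *\<^sub>v (A *\<^sub>v f)"

text \<open>\<open>apply_AAT A l u h w\<close> is \<open>h(A A\<^sup>T) w\<close>, by functional calculus.\<close>
definition apply_AAT ::
  "real mat \<Rightarrow> (nat \<Rightarrow> real) \<Rightarrow> (nat \<Rightarrow> real vec) \<Rightarrow> (real \<Rightarrow> real) \<Rightarrow> real vec \<Rightarrow> real vec" where
  "apply_AAT A l u h w =
     vec (dim_row A) (\<lambda>j. \<Sum>i = 1..dim_row A. h ((l i)\<^sup>2) * (w \<bullet> u i) * (u i $ j))"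

definition source_norm ::
  "real mat \<Rightarrow> (nat \<Rightarrow> real) \<Rightarrow> (nat \<Rightarrow> real vec) \<Rightarrow> real \<Rightarrow> real vec \<Rightarrow> real" where
  "source_norm A l v \<mu> f = sqrt (\<Sum>i = 1..dim_row A. (l i) powr (-4 * \<mu>) * (f \<bullet> v i)\<^sup>2)"

definition source_ball ::
  "real mat \<Rightarrow> (nat \<Rightarrow> real) \<Rightarrow> (nat \<Rightarrow> real vec) \<Rightarrow> real \<Rightarrow> real \<Rightarrow> real vec set" where
  "source_ball A l v \<mu> R = {f \<in> carrier_vec (dim_col A). source_norm A l v \<mu> f \<le> R}"


section \<open>Interpolated conjugate gradients\<close>

text \<open>
  For \<open>k \<le> num_distinct A l\<close> the minimiser exists and is unique whenever every singular value
  \<open>s\<close> satisfies \<open>(\<Sum>j | l j = s. (Y \<bullet> u j)\<^sup>2) > 0\<close>. Under Gaussian noise this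
  holds almost surely; on the exceptional null set the value is arbitrary.
\<close>
definition cg_poly ::
  "real mat \<Rightarrow> (nat \<Rightarrow> real) \<Rightarrow> (nat \<Rightarrow> real vec) \<Rightarrow> real vec \<Rightarrow> nat \<Rightarrow> real poly" where
  "cg_poly A l u Y k =
     (THE p. is_arg_min (\<lambda>p. (vnorm (apply_AAT A l u (poly p) Y))\<^sup>2)
                        (\<lambda>p. degree p \<le> k \<and> poly p 0 = 1) p)"

text \<open>\<open>t > 0\<close> is written as \<open>t = k + \<alpha>\<close> with \<open>\<alpha> \<in> (0,1]\<close>, i.e. \<open>k = \<lceil>t\<rceil> - 1\<close>.\<close>
definition cg_interp ::
  "real mat \<Rightarrow> (nat \<Rightarrow> real) \<Rightarrow> (nat \<Rightarrow> real vec) \<Rightarrow> real vec \<Rightarrow> real \<Rightarrow> real poly" where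
  "cg_interp A l u Y t =
     (if t \<le> 0 then cg_poly A l u Y 0
      else let k = nat (\<lceil>t\<rceil> - 1); \<alpha> = t - real k
           in Polynomial.smult (1 - \<alpha>) (cg_poly A l u Y k) + Polynomial.smult \<alpha> (cg_poly A l u Y (Suc k)))"

definition cg_est ::
  "real mat \<Rightarrow> (nat \<Rightarrow> real) \<Rightarrow> (nat \<Rightarrow> real vec) \<Rightarrow> real vec \<Rightarrow> real \<Rightarrow> real vec" where
  "cg_est A l u Y t = pinv A *\<^sub>v (Y - apply_AAT A l u (poly (cg_interp A l u Y t)) Y)"

definition residual_sq ::
  "real mat \<Rightarrow> (nat \<Rightarrow> real) \<Rightarrow> (nat \<Rightarrow> real vec) \<Rightarrow> real vec \<Rightarrow> real \<Rightarrow> real" where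
  "residual_sq A l u Y t = (vnorm (A *\<^sub>v cg_est A l u Y t - Y))\<^sup>2"

definition first_zero ::
  "real mat \<Rightarrow> (nat \<Rightarrow> real) \<Rightarrow> (nat \<Rightarrow> real vec) \<Rightarrow> real vec \<Rightarrow> real \<Rightarrow> real" where
  "first_zero A l u Y t = (LEAST x. 0 \<le> x \<and> poly (cg_interp A l u Y t) x = 0)"

definition cg_trunc ::
  "real mat \<Rightarrow> (nat \<Rightarrow> real) \<Rightarrow> (nat \<Rightarrow> real vec) \<Rightarrow> real vec \<Rightarrow> real \<Rightarrow> real \<Rightarrow> real" where
  "cg_trunc A l u Y t x =
     (if t \<le> 0 then 1
      else if x < first_zero A l u Y t then poly (cg_interp A l u Y t) x else 0)"


section \<open>Balanced oracle\<close>

definition stoch_err ::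
  "real mat \<Rightarrow> (nat \<Rightarrow> real) \<Rightarrow> (nat \<Rightarrow> real vec) \<Rightarrow> real vec \<Rightarrow> real vec \<Rightarrow> real \<Rightarrow> real" where
  "stoch_err A l u f \<xi> t =
     (let Y = A *\<^sub>v f + \<xi> in
      (vnorm (apply_AAT A l u (\<lambda>x. sqrt (1 - cg_trunc A l u Y t x)) \<xi>))\<^sup>2)"

definition approx_err ::
  "real mat \<Rightarrow> (nat \<Rightarrow> real) \<Rightarrow> (nat \<Rightarrow> real vec) \<Rightarrow> real vec \<Rightarrow> real vec \<Rightarrow> real \<Rightarrow> real" where
  "approx_err A l u f \<xi> t =
     (let g = A *\<^sub>v f; Y = g + \<xi>; h = (\<lambda>x. sqrt (cg_trunc A l u Y t x)) in
      (vnorm (apply_AAT A l u h g))\<^sup>2 + residual_sq A l u Y t - (vnorm (apply_AAT A l u h Y))\<^sup>2)"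

definition balanced_oracle ::
  "real mat \<Rightarrow> (nat \<Rightarrow> real) \<Rightarrow> (nat \<Rightarrow> real vec) \<Rightarrow> real vec \<Rightarrow> real vec \<Rightarrow> real" where
  "balanced_oracle A l u f \<xi> =
     Inf {t \<in> {0..real (num_distinct A l)}. approx_err A l u f \<xi> t \<le> stoch_err A l u f \<xi> t}"


section \<open>Losses and risks\<close>

definition prediction_loss :: "real mat \<Rightarrow> real vec \<Rightarrow> real vec \<Rightarrow> real" where
  "prediction_loss A f fh = (vnorm (A *\<^sub>v (fh - f)))\<^sup>2"

definition reconstruction_loss :: "real mat \<Rightarrow> real vec \<Rightarrow> real vec \<Rightarrow> real" where
  "reconstruction_loss A f fh = (vnorm (fh - min_norm_sol A f))\<^sup>2"

text \<open>If \<open>z\<close> has law \<open>std_gauss D\<close>, then \<open>noise D \<delta> z\<close> has law \<open>N(0, \<delta>\<^sup>2 I)\<close> on \<open>carrier_vec D\<close>.\<close>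
definition std_gauss :: "nat \<Rightarrow> (nat \<Rightarrow> real) measure" where
  "std_gauss D = (\<Pi>\<^sub>M i\<in>{..<D}. density lborel (\<lambda>x. ennreal (std_normal_density x)))"

definition noise :: "nat \<Rightarrow> real \<Rightarrow> (nat \<Rightarrow> real) \<Rightarrow> real vec" where
  "noise D \<delta> z = \<delta> \<cdot>\<^sub>v vec D z"

definition oracle_risk ::
  "(real mat \<Rightarrow> real vec \<Rightarrow> real vec \<Rightarrow> real) \<Rightarrow> real mat \<Rightarrow> (nat \<Rightarrow> real) \<Rightarrow> (nat \<Rightarrow> real vec)
     \<Rightarrow> real \<Rightarrow> real vec \<Rightarrow> ennreal" where
  "oracle_risk loss A l u \<delta> f =
     (\<integral>\<^sup>+ z. (let \<xi> = noise (dim_row A) \<delta> z in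
            ennreal (loss A f (cg_est A l u (A *\<^sub>v f + \<xi>) (balanced_oracle A l u f \<xi>))))
        \<partial>std_gauss (dim_row A))"

text \<open>Borel measurable maps from data in \<open>carrier_vec D\<close> to \<open>carrier_vec P\<close>.\<close>
definition estimators :: "nat \<Rightarrow> nat \<Rightarrow> (real vec \<Rightarrow> real vec) set" where
  "estimators D P =
     {T. (\<forall>y\<in>carrier_vec D. T y \<in> carrier_vec P) \<and>
         (\<forall>j<P. (\<lambda>y. T (vec D y) $ j) \<in> borel_measurable (\<Pi>\<^sub>M i\<in>{..<D}. borel))}"

definition minimax_risk ::
  "(real mat \<Rightarrow> real vec \<Rightarrow> real vec \<Rightarrow> real) \<Rightarrow> real mat \<Rightarrow> real \<Rightarrow> real vec set \<Rightarrow> ennreal" where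
  "minimax_risk loss A \<delta> F =
     (INF T \<in> estimators (dim_row A) (dim_col A). SUP f \<in> F.
        \<integral>\<^sup>+ z. ennreal (loss A f (T (A *\<^sub>v f + noise (dim_row A) \<delta> z))) \<partial>std_gauss (dim_row A))"

text \<open>
  \<open>rate\<close> is the minimax rate over the source ball (two-sided) and is attained by the balanced
  oracle, both up to the constants \<open>c\<close> and \<open>C\<close>. The oracle does not depend on \<open>\<mu>\<close> and \<open>R\<close>.
\<close>
definition oracle_attains_minimax_rate ::
  "real \<Rightarrow> real \<Rightarrow> (real mat \<Rightarrow> real vec \<Rightarrow> real vec \<Rightarrow> real) \<Rightarrow> real mat \<Rightarrow> (nat \<Rightarrow> real)
     \<Rightarrow> (nat \<Rightarrow> real vec) \<Rightarrow> (nat \<Rightarrow> real vec) \<Rightarrow> real \<Rightarrow> real \<Rightarrow> real \<Rightarrow> real \<Rightarrow> bool" where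
  "oracle_attains_minimax_rate c C loss A l u v \<mu> R \<delta> rate \<longleftrightarrow>
     ennreal (c * rate) \<le> minimax_risk loss A \<delta> (source_ball A l v \<mu> R) \<and>
     minimax_risk loss A \<delta> (source_ball A l v \<mu> R) \<le> ennreal (C * rate) \<and>
     (SUP f \<in> source_ball A l v \<mu> R. oracle_risk loss A l u \<delta> f) \<le> ennreal (C * rate)"

definition prediction_rate :: "real \<Rightarrow> real \<Rightarrow> real \<Rightarrow> real \<Rightarrow> real" where
  "prediction_rate \<mu> p R \<delta> =
     R powr (2 / (4 * \<mu> * p + 2 * p + 1)) *
     \<delta> powr ((8 * \<mu> * p + 4 * p) / (4 * \<mu> * p + 2 * p + 1))"

definition reconstruction_rate :: "real \<Rightarrow> real \<Rightarrow> real \<Rightarrow> real \<Rightarrow> real" where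
  "reconstruction_rate \<mu> p R \<delta> =
     R powr ((4 * p + 2) / (4 * \<mu> * p + 2 * p + 1)) *
     \<delta> powr (8 * \<mu> * p / (4 * \<mu> * p + 2 * p + 1))"

end

theory Submission
  imports Defs
begin

text \<open>
  In the coordinates of the singular system, the residual polynomial \<open>r\<close> of the interpolated
  conjugate gradient iteration is a product of factors \<open>1 - b * x\<close> with \<open>b > 0\<close>. With
  \<open>\<rho> = |r'(0)| = \<Sum> b\<close>, its truncation at the first zero lies between \<open>1 - \<rho> * x\<close> and
  \<open>exp (- \<rho> * x)\<close>. Hence the stochastic error is at most \<open>\<Sum> min 1 (\<rho> * x) * \<xi>\<^sup>2\<close>, and, because
  orthogonality bounds the residual by the truncated one, the approximation error is at most
  \<open>\<Sum> exp (- \<rho> * x) * g\<^sup>2\<close>. Both errors are continuous in \<open>t\<close>, so they coincide at the balanced oracle,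
  and their common value is bounded by the sum of the two bounds evaluated at any deterministic
  \<open>s\<close> in place of the random \<open>\<rho>\<close>. The prediction error is at most four times the common value. For
  the reconstruction error, the components with \<open>x \<ge> 1 / max \<rho> s\<close> are controlled by the prediction
  error and the others by the stochastic error and the source condition. Taking expectations, only
  second moments of the noise are needed.

  The minimax upper bound is attained by spectral cut-off; the lower bound is Assouad's, on a
  hypercube whose sides have length of order \<open>\<delta> / l i\<close>.
\<close>

subsection \<open>Positive zeros and residual polynomials\<close>

text \<open>The obstacle is that conjugate gradients are not linear in the data: \<open>r\<close>,
  \<open>\<rho>\<close> and the oracle all depend on the noise, so no expectation can be taken at a
  fixed filter. Hence the error bounds are proved for one realisation, and the noise is averaged
  only after \<open>\<rho>\<close> has disappeared. It disappears because one bound on the common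
  error increases in \<open>\<rho>\<close> and the other decreases: on whichever side of
  \<open>s\<close> the random \<open>\<rho>\<close> falls, one of the two may be evaluated at
  \<open>s\<close> instead.

  The structure of \<open>r\<close> comes from reading the minimisation as least squares for the
  measure with mass \<open>Y_i^2\<close> at \<open>l_i^2\<close>. Its normal equations make
  \<open>r\<close> orthogonal to \<open>x\<close> times all polynomials of lower degree, so the
  classical argument for zeros of orthogonal polynomials applies. An interpolated \<open>r\<close>
  has one relation less than its degree; the alternating sign of the leading coefficients replaces
  it. The choice \<open>s = N powr (2 * p)\<close> equates the variance
  \<open>\<delta>^2 * N\<close> with the squared bias
  \<open>R^2 * s powr (- (1 + 2 * \<mu>))\<close>.\<close>

definition prod_lin :: "real list \<Rightarrow> real poly" where
  "prod_lin bs = prod_list (map (\<lambda>b. [:1, -b:]) bs)"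

lemma poly_prod_lin: "poly (prod_lin bs) x = (\<Prod>b\<leftarrow>bs. 1 - b * x)"
  by (induction bs) (auto simp: prod_lin_def algebra_simps)

lemma prod_lin_Cons: "prod_lin (b # bs) = [:1, -b:] * prod_lin bs"
  by (simp add: prod_lin_def)

text \<open>Each factor contributes \<open>- b\<close> to the leading coefficient, whose sign
  therefore records the parity of the number of positive zeros. This later rules out that exactly
  one zero is missing.\<close>

lemma degree_coeff_prod_lin:
  assumes "\<forall>b\<in>set bs. 0 < b"
  shows "degree (prod_lin bs) = length bs \<and> 0 < (-1) ^ length bs * coeff (prod_lin bs) (length bs)"
  using assms
proof (induction bs)
  case Nil
  then show ?case by (simp add: prod_lin_def)
next
  case (Cons b bs)
  have IH: "degree (prod_lin bs) = length bs" "0 < (-1) ^ length bs * coeff (prod_lin bs) (length bs)"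
    using Cons by auto
  have nz: "prod_lin bs \<noteq> 0"
    using IH(2) by auto
  have b: "b > 0"
    using Cons.prems by simp
  have deg: "degree (prod_lin (b # bs)) = Suc (length bs)"
    using b nz IH(1) by (simp add: prod_lin_Cons degree_mult_eq del: mult_pCons_left)
  have "coeff (prod_lin (b # bs)) (Suc (length bs)) = - b * coeff (prod_lin bs) (length bs)"
    using IH(1) by (simp add: prod_lin_Cons coeff_eq_0)
  then have "(-1) ^ length (b # bs) * coeff (prod_lin (b # bs)) (length (b # bs)) =
    b * ((-1) ^ length bs * coeff (prod_lin bs) (length bs))"
    by simp
  with deg IH(2) b show ?case
    by simp
qed

lemma prod_list_nonneg_le_1:
  fixes f :: "'a \<Rightarrow> real"
  assumes "\<forall>b\<in>set bs. 0 \<le> f b \<and> f b \<le> 1"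
  shows "0 \<le> (\<Prod>b\<leftarrow>bs. f b) \<and> (\<Prod>b\<leftarrow>bs. f b) \<le> 1"
  using assms by (induction bs) (auto simp: mult_le_one)

text \<open>Weierstrass' product inequality. With \<open>prod_list_le_exp\<close> it confines the
  product in terms of \<open>sum_list bs\<close> alone, so that the individual zeros drop out of all
  error bounds.\<close>

lemma prod_list_ge_1_minus_sum:
  assumes "\<forall>b\<in>set bs. 0 \<le> b * x \<and> b * x \<le> (1::real)"
  shows "1 - sum_list bs * x \<le> (\<Prod>b\<leftarrow>bs. 1 - b * x)"
  using assms
proof (induction bs)
  case (Cons b bs)
  have IH: "1 - sum_list bs * x \<le> (\<Prod>b\<leftarrow>bs. 1 - b * x)"
    using Cons by simp
  have le1: "(\<Prod>b\<leftarrow>bs. 1 - b * x) \<le> 1"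
    using prod_list_nonneg_le_1[of bs "\<lambda>b. 1 - b * x"] Cons.prems by auto
  have "b * x * (\<Prod>b\<leftarrow>bs. 1 - b * x) \<le> b * x * 1"
    using le1 Cons.prems by (intro mult_left_mono) auto
  with IH show ?case
    by (simp add: algebra_simps)
qed simp

lemma prod_list_le_exp:
  assumes "\<forall>b\<in>set bs. b * x \<le> (1::real)"
  shows "(\<Prod>b\<leftarrow>bs. 1 - b * x) \<le> exp (- (sum_list bs * x))"
  using assms
proof (induction bs)
  case (Cons b bs)
  have "(1 - b * x) * (\<Prod>b\<leftarrow>bs. 1 - b * x) \<le> exp (- (b * x)) * exp (- (sum_list bs * x))"
    using Cons exp_ge_add_one_self[of "- (b * x)"]
    by (intro mult_mono) (auto intro!: prod_list_nonneg)
  then show ?case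
    by (simp add: algebra_simps flip: exp_add)
qed simp

lemma prod_list_antimono:
  assumes "\<forall>b\<in>set bs. 0 \<le> b \<and> b * x \<le> (1::real)" "y \<le> x"
  shows "(\<Prod>b\<leftarrow>bs. 1 - b * x) \<le> (\<Prod>b\<leftarrow>bs. 1 - b * y)"
  using assms
proof (induction bs)
  case (Cons b bs)
  have "b * y \<le> b * x" using Cons.prems by (intro mult_left_mono) auto
  then show ?case
    using Cons by (auto intro!: mult_mono prod_list_nonneg)
qed simp

text \<open>The factors of the product need not be distinct; all that matters below is their number.\<close>
lemma sign_change_factorization:
  fixes p :: "real poly"
  assumes "poly p 0 = 1"
  shows "\<exists>bs s. (\<forall>b\<in>set bs. 0 < b) \<and> p = prod_lin bs * s \<and> (\<forall>x\<ge>0. 0 \<le> poly s x)"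
  using assms
proof (induction "degree p" arbitrary: p rule: less_induct)
  case less
  show ?case
  proof (cases "\<forall>x\<ge>0. 0 \<le> poly p x")
    case True
    then show ?thesis
      by (intro exI[of _ "[]"] exI[of _ p]) (simp add: prod_lin_def)
  next
    case False
    then obtain y where y: "y \<ge> 0" "poly p y < 0"
      by force
    with less.prems have "y > 0"
      by (cases "y = 0") auto
    \<comment> \<open>\<open>p\<close> is 1 at the origin and negative at \<open>y\<close>, so it
      has a zero in between; dividing it out lowers the degree.\<close>
    then obtain z where z: "0 < z" "poly p z = 0"
      using poly_IVT_neg[of 0 y p] less.prems y by auto
    then obtain p1 where p1: "p = [:-z, 1:] * p1"
      by (metis dvdE poly_eq_0_iff_dvd)
    \<comment> \<open>The factor \<open>-z\<close> turns the divisor \<open>x - z\<close> into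
      \<open>1 - x / z\<close> and so restores the value 1 at the origin.\<close>
    define p2 where "p2 = Polynomial.smult (-z) p1"
    have eq: "p = [:1, -(1 / z):] * p2"
    proof -
      have "[:1, -(1 / z):] * p2 = Polynomial.smult (-z) [:1, -(1/z):] * p1"
        unfolding p2_def by (simp only: mult_smult_left mult_smult_right)
      also have "Polynomial.smult (-z) [:1, -(1/z):] = [:-z, 1:]"
        using z by simp
      finally show ?thesis using p1 by simp
    qed
    have "p1 \<noteq> 0"
      using less.prems p1 by auto
    then have deg: "degree p2 < degree p"
      unfolding p1 p2_def using z by (simp add: degree_mult_eq del: mult_pCons_left)
    have "poly p2 0 = 1"
      using less.prems eq by simp
    from less.hyps[OF deg this] obtain bs s where
      *: "\<forall>b\<in>set bs. 0 < b" "p2 = prod_lin bs * s" "\<forall>x\<ge>0. 0 \<le> poly s x"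
      by blast
    show ?thesis
    proof (intro exI conjI)
      show "\<forall>b\<in>set ((1 / z) # bs). 0 < b" using * z by simp
      show "p = prod_lin ((1 / z) # bs) * s"
        using eq *(2) by (simp only: prod_lin_Cons mult.assoc)
      show "\<forall>x\<ge>0. 0 \<le> poly s x" by fact
    qed
  qed
qed

section \<open>Orthogonality with respect to the spectral measure of the data\<close>

locale cg_weights =
  fixes I :: "'i set" and x w :: "'i \<Rightarrow> real"
  assumes finite_I: "finite I" and x_pos: "i \<in> I \<Longrightarrow> 0 < x i" and w_pos: "i \<in> I \<Longrightarrow> 0 < w i"
begin

text \<open>The inner product of the discrete measure with mass \<open>w i\<close> at
  \<open>x i\<close>. In the application \<open>x i\<close> is an eigenvalue of
  \<open>A * A\<^sup>T\<close> and \<open>w i\<close> the squared coefficient of the data. Nodes may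
  coincide, and the form is degenerate: it only sees values at the nodes.\<close>

definition B :: "real poly \<Rightarrow> real poly \<Rightarrow> real" where
  "B p q = (\<Sum>i\<in>I. w i * poly p (x i) * poly q (x i))"

text \<open>For \<open>n = k\<close> these are the normal equations of the minimisation. Degree and
  number of relations are separate because a proper interpolation between steps \<open>k\<close> and
  \<open>k + 1\<close> has degree \<open>k + 1\<close> but inherits only the \<open>k\<close>
  relations that both ends share. The condition on the coefficients says degree below
  \<open>k\<close> and still admits \<open>q = 0\<close> for \<open>k = 0\<close>.\<close>

definition is_cg :: "nat \<Rightarrow> nat \<Rightarrow> real poly \<Rightarrow> bool" where
  "is_cg n k p \<longleftrightarrow> degree p \<le> n \<and> poly p 0 = 1 \<and> (\<forall>q. (\<forall>i\<ge>k. coeff q i = 0) \<longrightarrow> B p (pCons 0 q) = 0)"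

lemma B_linear:
  "B (p + p') q = B p q + B p' q" "B p (q + q') = B p q + B p q'"
  "B (p - p') q = B p q - B p' q" "B p (q - q') = B p q - B p q'"
  "B (Polynomial.smult c p) q = c * B p q" "B p (Polynomial.smult c q) = c * B p q"
  by (simp_all add: B_def algebra_simps sum.distrib sum_subtractf sum_distrib_left)

lemma B_nonneg: "0 \<le> B p p"
  unfolding B_def mult.assoc
  by (intro sum_nonneg mult_nonneg_nonneg[OF less_imp_le[OF w_pos] zero_le_square])

lemma B_eq_0:
  assumes "B p p \<le> 0" "i \<in> I"
  shows "poly p (x i) = 0"
proof -
  have "(\<Sum>i\<in>I. w i * poly p (x i) * poly p (x i)) = 0"
    using B_nonneg[of p] assms(1) by (simp add: B_def)
  then have "w i * poly p (x i) * poly p (x i) = 0"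
    using finite_I assms(2) mult_nonneg_nonneg[OF less_imp_le[OF w_pos] zero_le_square]
    by (subst (asm) sum_nonneg_eq_0_iff) (auto simp: mult.assoc)
  then show ?thesis using w_pos[OF assms(2)] by auto
qed

text \<open>Gram-Schmidt: the new direction \<open>x ^ (k + 1)\<close> is first made orthogonal to
  the earlier ones. It is done by hand because \<open>B\<close> may be degenerate, so that a new
  direction can have norm zero.\<close>

lemma projection_exists:
  "\<exists>q. (\<forall>i\<ge>k. coeff q i = 0) \<and> (\<forall>q'. (\<forall>i\<ge>k. coeff q' i = 0) \<longrightarrow> B (p - pCons 0 q) (pCons 0 q') = 0)"
proof (induction k arbitrary: p)
  case 0
  have "q' = 0" if "\<forall>i. coeff q' i = 0" for q' :: "real poly"
    using that by (simp add: poly_eq_iff)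
  then show ?case
    by (intro exI[of _ 0]) (force simp: B_def)
next
  case (Suc k)
  obtain e0 where e0: "\<forall>i\<ge>k. coeff e0 i = 0"
    "\<And>q'. \<forall>i\<ge>k. coeff q' i = 0 \<Longrightarrow> B (pCons 0 (monom 1 k) - pCons 0 e0) (pCons 0 q') = 0"
    using Suc[of "pCons 0 (monom 1 k)"] by blast
  obtain q0 where q0: "\<forall>i\<ge>k. coeff q0 i = 0"
    "\<And>q'. \<forall>i\<ge>k. coeff q' i = 0 \<Longrightarrow> B (p - pCons 0 q0) (pCons 0 q') = 0"
    using Suc[of p] by blast
  define e where "e = monom 1 k - e0"
  have pe: "pCons 0 e = pCons 0 (monom 1 k) - pCons 0 e0"
    by (simp add: e_def)
  \<comment> \<open>If \<open>pCons 0 e\<close> has norm zero, then \<open>\<beta>\<close> is 0 by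
    division by zero, and \<open>key\<close> survives because this direction vanishes at every
    node.\<close>
  define \<beta> where "\<beta> = B (p - pCons 0 q0) (pCons 0 e) / B (pCons 0 e) (pCons 0 e)"
  have key: "B (p - pCons 0 q0) (pCons 0 e) = \<beta> * B (pCons 0 e) (pCons 0 e)"
  proof (cases "B (pCons 0 e) (pCons 0 e) = 0")
    case True
    then have "poly (pCons 0 e) (x i) = 0" if "i \<in> I" for i
      using B_eq_0[OF _ that, of "pCons 0 e"] by simp
    then show ?thesis
      unfolding True by (auto simp: B_def intro!: sum.neutral)
  qed (simp add: \<beta>_def)
  show ?case
  proof (intro exI[of _ "q0 + Polynomial.smult \<beta> e"] conjI allI impI)
    fix i assume "i \<ge> Suc k"
    then show "coeff (q0 + Polynomial.smult \<beta> e) i = 0"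
      using q0(1) e0(1) by (simp add: e_def)
  next
    fix q' :: "real poly" assume q': "\<forall>i\<ge>Suc k. coeff q' i = 0"
    define c q'' where "c = coeff q' k" and "q'' = q' - Polynomial.smult c e"
    have "\<forall>i\<ge>k. coeff q'' i = 0"
    proof safe
      fix i assume "i \<ge> k"
      then show "coeff q'' i = 0"
        using q' e0(1) by (cases "i = k") (auto simp: q''_def c_def e_def)
    qed
    then have 1: "B (p - pCons 0 q0) (pCons 0 q'') = 0" "B (pCons 0 e) (pCons 0 q'') = 0"
      using q0(2) e0(2) by (auto simp: pe)
    have "pCons 0 q' = pCons 0 q'' + Polynomial.smult c (pCons 0 e)"
      by (simp add: q''_def)
    moreover have "p - pCons 0 (q0 + Polynomial.smult \<beta> e) = (p - pCons 0 q0) - Polynomial.smult \<beta> (pCons 0 e)"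
      by (simp add: poly_eq_iff coeff_pCons split: nat.split)
    ultimately show "B (p - pCons 0 (q0 + Polynomial.smult \<beta> e)) (pCons 0 q') = 0"
      using 1 key by (simp only: B_linear) (simp add: algebra_simps)
  qed
qed

lemma is_cg_exists: "\<exists>p. is_cg k k p"
proof -
  obtain q where q: "\<forall>i\<ge>k. coeff q i = 0" "\<And>q'. \<forall>i\<ge>k. coeff q' i = 0 \<Longrightarrow> B (1 - pCons 0 q) (pCons 0 q') = 0"
    using projection_exists[of k 1] by blast
  have "degree (1 - pCons 0 q) \<le> k"
    by (rule degree_le) (use q(1) in \<open>auto simp: coeff_pCons split: nat.split\<close>)
  then have "is_cg k k (1 - pCons 0 q)"
    using q(2) by (simp add: is_cg_def)
  then show ?thesis ..
qed

lemma pCons_diff: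
  fixes p r :: "real poly"
  assumes "poly p 0 = poly r 0" "degree p \<le> k" "degree r \<le> k"
  shows "\<exists>q. p - r = pCons 0 q \<and> (\<forall>i\<ge>k. coeff q i = 0)"
proof -
  obtain c q where pr: "p - r = pCons c q"
    by (cases "p - r")
  moreover have "c = 0"
  proof -
    have "poly (pCons c q) 0 = 0"
      unfolding pr[symmetric] using assms(1) by simp
    then show ?thesis by simp
  qed
  moreover have "coeff q i = 0" if "i \<ge> k" for i
  proof -
    have "coeff q i = coeff (p - r) (Suc i)"
      by (simp add: pr)
    also have "\<dots> = 0"
      using assms that by (simp add: coeff_eq_0)
    finally show ?thesis .
  qed
  ultimately show ?thesis by blast
qed

text \<open>The origin is one zero more than the nodes supply. Hence \<open>B\<close> is definite on
  differences of normalised polynomials up to a degree equal to the number of distinct nodes, which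
  is what makes even the last iterate unique.\<close>

lemma vanish_imp_0:
  assumes "degree p \<le> card (x ` I)" "poly p 0 = 0" "\<And>i. i \<in> I \<Longrightarrow> poly p (x i) = 0"
  shows "p = 0"
proof (rule ccontr)
  assume "p \<noteq> 0"
  have sub: "insert 0 (x ` I) \<subseteq> {y. poly p y = 0}"
    using assms by auto
  have "0 \<notin> x ` I"
    using x_pos by force
  then have "Suc (card (x ` I)) = card (insert 0 (x ` I))"
    using finite_I by simp
  also have "\<dots> \<le> card {y. poly p y = 0}"
    using sub poly_roots_finite[OF \<open>p \<noteq> 0\<close>] by (intro card_mono)
  also have "\<dots> \<le> degree p"
    by (rule card_poly_roots_bound) fact
  finally show False
    using assms(1) by simp
qed

text \<open>\<open>p - r\<close> vanishes at the origin, so it is \<open>x\<close> times a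
  polynomial of degree below \<open>k\<close>, which is exactly the space orthogonal to
  \<open>r\<close>.\<close>

lemma cg_pythagoras:
  assumes "is_cg k k r" "degree p \<le> k" "poly p 0 = 1"
  shows "B p p = B r r + B (p - r) (p - r)"
proof -
  obtain q where q: "p - r = pCons 0 q" "\<forall>i\<ge>k. coeff q i = 0"
    using pCons_diff[of p r k] assms by (auto simp: is_cg_def)
  then have "B r (p - r) = 0"
    using assms(1) by (simp add: is_cg_def)
  moreover have "B (p - r) r = B r (p - r)"
    by (simp add: B_def mult_ac)
  moreover have "B p p = B (r + (p - r)) (r + (p - r))"
    by simp
  ultimately show ?thesis
    by (simp only: B_linear)
qed

text \<open>This evaluates the \<open>THE\<close> in \<open>cg_poly\<close>: minimality comes from
  Pythagoras, uniqueness from \<open>vanish_imp_0\<close>, whence the bound on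
  \<open>k\<close>.\<close>

lemma is_arg_min_cg:
  assumes "is_cg k k r" "k \<le> card (x ` I)"
  shows "is_arg_min (\<lambda>p. B p p) (\<lambda>p. degree p \<le> k \<and> poly p 0 = 1) p \<longleftrightarrow> p = r"
proof
  assume *: "is_arg_min (\<lambda>p. B p p) (\<lambda>p. degree p \<le> k \<and> poly p 0 = 1) p"
  then have p: "degree p \<le> k" "poly p 0 = 1"
    by (auto simp: is_arg_min_def)
  have "B p p \<le> B r r"
    using * assms(1) by (force simp: is_arg_min_def is_cg_def)
  with cg_pythagoras[OF assms(1) p] have "B (p - r) (p - r) \<le> 0"
    by simp
  then have "poly (p - r) (x i) = 0" if "i \<in> I" for i
    using B_eq_0 that by blast
  moreover have "degree (p - r) \<le> card (x ` I)"
    using assms p by (intro degree_diff_le) (auto simp: is_cg_def)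
  moreover have "poly (p - r) 0 = 0"
    using assms p by (simp add: is_cg_def)
  ultimately have "p - r = 0"
    using vanish_imp_0 by blast
  then show "p = r" by simp
next
  assume "p = r"
  have "B r r \<le> B q q" if "degree q \<le> k" "poly q 0 = 1" for q
    using cg_pythagoras[OF assms(1) that] B_nonneg[of "q - r"] by simp
  then show "is_arg_min (\<lambda>p. B p p) (\<lambda>p. degree p \<le> k \<and> poly p 0 = 1) p"
    using assms(1) unfolding \<open>p = r\<close> by (force simp: is_arg_min_def is_cg_def)
qed

text \<open>The residual polynomial of the last step. It has one factor per distinct node, so that
  its degree is exactly the number of iterations.\<close>

lemma vanishing_prod_lin:
  "\<exists>cs. (\<forall>b\<in>set cs. 0 < b) \<and> length cs = card (x ` I) \<and> (\<forall>i\<in>I. poly (prod_lin cs) (x i) = 0)"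
proof -
  define X where "X = sorted_list_of_set (x ` I)"
  have X: "set X = x ` I" "length X = card (x ` I)"
    using finite_I by (auto simp: X_def)
  define cs where "cs = map (\<lambda>y. 1 / y) X"
  have "poly (prod_lin cs) (x i) = 0" if "i \<in> I" for i
  proof -
    have "0 \<in> set (map (\<lambda>b. 1 - b * x i) cs)"
      using X(1) that x_pos[OF that] unfolding cs_def list.set_map
      by (intro image_eqI[of _ _ "1 / x i"] image_eqI[of _ _ "x i"]) auto
    then show ?thesis
      unfolding poly_prod_lin by (simp add: prod_list_zero_iff)
  qed
  moreover have "\<forall>b\<in>set cs. 0 < b" "length cs = card (x ` I)"
    using X x_pos by (auto simp: cs_def)
  ultimately show ?thesis by blast
qed

text \<open>
  A polynomial of degree at most \<open>m + 1\<close> satisfying \<open>m\<close> orthogonality relations has at least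
  \<open>m\<close> positive zeros; the sign of the leading coefficient makes the last one positive, too.
\<close>
lemma prod_lin_of_orthogonal:
  assumes cg: "is_cg n m p" and n: "n \<le> card (x ` I)"
    and lead: "n \<le> m \<or> (n = Suc m \<and> 0 < (-1) ^ n * coeff p n)"
  shows "\<exists>bs. (\<forall>b\<in>set bs. 0 < b) \<and> p = prod_lin bs \<and> length bs = n"
proof -
  have p: "degree p \<le> n" "poly p 0 = 1"
    using cg by (auto simp: is_cg_def)
  obtain bs s where bs: "\<forall>b\<in>set bs. 0 < b" "p = prod_lin bs * s" "\<forall>y\<ge>0. 0 \<le> poly s y"
    using sign_change_factorization[OF p(2)] by blast
  have s0: "poly s 0 = 1"
  proof -
    have "poly (prod_lin bs) 0 = 1"
      by (simp add: poly_prod_lin map_replicate_const)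
    then show ?thesis
      using p(2) bs(2) by simp
  qed
  then have "s \<noteq> 0" by auto
  have deg_bs: "degree (prod_lin bs) = length bs" and nz: "prod_lin bs \<noteq> 0"
    and lead_bs: "0 < (-1) ^ length bs * coeff (prod_lin bs) (length bs)"
    using degree_coeff_prod_lin[OF bs(1)] by auto
  have deg: "degree p = length bs + degree s"
    using bs(2) nz \<open>s \<noteq> 0\<close> deg_bs by (simp add: degree_mult_eq)
  show ?thesis
  proof (cases "length bs < m")
    case True
    \<comment> \<open>The classical argument: with fewer than \<open>m\<close> factors,
      \<open>x * prod_lin bs\<close> is an admissible test polynomial. Its product with
      \<open>p\<close> is \<open>x * s * (prod_lin bs)^2\<close>, nonnegative at all nodes, so each
      summand of the vanishing sum is zero.\<close>
    then have "B p (pCons 0 (prod_lin bs)) = 0"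
      using cg deg_bs by (auto simp: is_cg_def coeff_eq_0)
    moreover have nonneg: "0 \<le> w i * poly p (x i) * poly (pCons 0 (prod_lin bs)) (x i)" if "i \<in> I" for i
    proof -
      have "w i * poly p (x i) * poly (pCons 0 (prod_lin bs)) (x i) =
        w i * (x i * (poly s (x i) * (poly (prod_lin bs) (x i))\<^sup>2))"
        by (simp add: bs(2) power2_eq_square)
      also have "\<dots> \<ge> 0"
        using x_pos[OF that] w_pos[OF that] bs(3) by (simp add: less_imp_le)
      finally show ?thesis .
    qed
    ultimately have *: "w i * poly p (x i) * poly (pCons 0 (prod_lin bs)) (x i) = 0" if "i \<in> I" for i
      using that finite_I unfolding B_def by (subst (asm) sum_nonneg_eq_0_iff) auto
    have van: "poly p (x i) = 0" if "i \<in> I" for i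
      using *[OF that] x_pos[OF that] w_pos[OF that] by (auto simp: bs(2))
    \<comment> \<open>Only one normalised polynomial of this degree vanishes at all nodes, and it is
      already known to be a product with positive \<open>b\<close>.\<close>
    obtain cs where cs: "\<forall>b\<in>set cs. 0 < b" "length cs = card (x ` I)"
      "\<forall>i\<in>I. poly (prod_lin cs) (x i) = 0"
      using vanishing_prod_lin by blast
    have "p - prod_lin cs = 0"
    proof (rule vanish_imp_0)
      show "degree (p - prod_lin cs) \<le> card (x ` I)"
        using p(1) n degree_coeff_prod_lin[OF cs(1)] cs(2) by (intro degree_diff_le) auto
      show "poly (p - prod_lin cs) 0 = 0"
        using p(2) by (simp add: poly_prod_lin map_replicate_const)
      fix i assume i: "i \<in> I"
      then show "poly (p - prod_lin cs) (x i) = 0"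
        using van[OF i] cs(3) by simp
    qed
    then have pcs: "p = prod_lin cs" by simp
    then have "card (x ` I) \<le> n"
      using degree_coeff_prod_lin[OF cs(1)] cs(2) p(1) by simp
    with n cs pcs show ?thesis by (intro exI[of _ cs]) auto
  next
    case False
    show ?thesis
    proof (cases "degree s = 0")
      case True
      then have "s = 1"
        using s0 by (metis degree_0_id one_pCons poly_0_coeff_0)
      with bs have pbs: "p = prod_lin bs" by simp
      moreover have "length bs = n"
      proof (cases "n \<le> m")
        case True
        then show ?thesis using False deg p(1) by simp
      next
        case 2: False
        then have "coeff p n \<noteq> 0"
          using lead by auto
        then have "n \<le> degree p" by (rule le_degree)
        then show ?thesis using p(1) pbs deg_bs by simp
      qed
      ultimately show ?thesis
        using bs(1) by blast
    next
      case 2: False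
      then have n': "n = Suc m" "length bs = m" "degree s = 1" "0 < (-1) ^ n * coeff p n"
        using False deg p(1) lead by auto
      \<comment> \<open>The remaining \<open>s\<close> is linear with value 1 at the origin. A
        negative slope would give the value -1 at \<open>2 / - coeff s 1\<close>; a nonnegative one
        contradicts the sign of the leading coefficient of \<open>p\<close>.\<close>
      have "coeff s 1 \<ge> 0"
      proof (rule ccontr)
        assume neg: "\<not> coeff s 1 \<ge> 0"
        have "poly s y = 1 + y * coeff s 1" for y
          using s0 n'(3) by (simp add: poly_altdef poly_0_coeff_0)
        from this[of "2 / - coeff s 1"] neg have "poly s (2 / - coeff s 1) = -1"
          by (simp add: field_simps)
        with bs(3) neg show False
          by (smt (verit) divide_nonneg_nonneg)
      qed
      moreover have "coeff p n = coeff (prod_lin bs) m * coeff s 1"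
        using coeff_degree_mult[of "prod_lin bs" s] deg bs(2) n' deg_bs by simp
      then have "(-1) ^ n * coeff p n = - (((-1) ^ m * coeff (prod_lin bs) m) * coeff s 1)"
        using n' by simp
      ultimately have "(-1) ^ n * coeff p n \<le> 0"
        using lead_bs n'(2) by simp
      with n'(4) show ?thesis by simp
    qed
  qed
qed

end

section \<open>Truncation at the first zero\<close>

lemma prod_lin_remove1:
  "b \<in> set bs \<Longrightarrow> prod_lin bs = [:1, -b:] * prod_lin (remove1 b bs)"
proof (induction bs)
  case (Cons a bs)
  then show ?case
    by (cases "a = b") (simp_all add: prod_lin_Cons mult.left_commute del: mult_pCons_left)
qed simp

text \<open>For \<open>y \<ge> 0\<close> and positive \<open>b\<close> the condition says that
  \<open>y\<close> lies before the smallest zero, the reciprocal of the largest \<open>b\<close>. No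
  zero has to be named, and the empty list yields the constant 1 required at
  \<open>t = 0\<close>.\<close>

definition trunc :: "real list \<Rightarrow> real \<Rightarrow> real" where
  "trunc bs y = (if \<forall>b\<in>set bs. b * y < 1 then poly (prod_lin bs) y else 0)"

lemma trunc_bounds:
  assumes bs: "\<forall>b\<in>set bs. 0 < b" and y: "0 \<le> y"
  shows "0 \<le> trunc bs y" "trunc bs y \<le> 1" "1 - sum_list bs * y \<le> trunc bs y"
    "trunc bs y \<le> exp (- (sum_list bs * y))"
proof -
  have nn: "0 \<le> b * y" if "b \<in> set bs" for b
    using bs y that by (simp add: less_imp_le)
  show "0 \<le> trunc bs y" "trunc bs y \<le> 1"
    using prod_list_nonneg_le_1[of bs "\<lambda>b. 1 - b * y"] nn
    by (auto simp: trunc_def poly_prod_lin less_imp_le)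
  show "trunc bs y \<le> exp (- (sum_list bs * y))"
    using prod_list_le_exp[of bs y] by (auto simp: trunc_def poly_prod_lin less_imp_le)
  show "1 - sum_list bs * y \<le> trunc bs y"
  proof (cases "\<forall>b\<in>set bs. b * y < 1")
    case True
    then show ?thesis
      using prod_list_ge_1_minus_sum[of bs y] nn by (auto simp: trunc_def poly_prod_lin less_imp_le)
  next
    \<comment> \<open>At or past the first zero some \<open>b * y\<close> is at least 1, so the
      lower bound is at most 0 there.\<close>
    case False
    then obtain b where b: "b \<in> set bs" "1 \<le> b * y" by force
    have "b \<le> sum_list bs"
      using b(1) bs by (intro member_le_sum_list) (auto simp: less_imp_le)
    then have "b * y \<le> sum_list bs * y"
      using y by (intro mult_right_mono)
    with b False show ?thesis by (auto simp: trunc_def)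
  qed
qed

text \<open>No zero lies below the reciprocal of the sum of the \<open>b\<close>. In the
  reconstruction error this decides where the estimator itself may be read as the truncated
  filter.\<close>

lemma trunc_eq_poly:
  assumes bs: "\<forall>b\<in>set bs. 0 < b" and y: "0 \<le> y" "sum_list bs * y < 1"
  shows "trunc bs y = poly (prod_lin bs) y"
proof -
  have "b * y < 1" if "b \<in> set bs" for b
  proof -
    have "b \<le> sum_list bs"
      using that bs by (intro member_le_sum_list) (auto simp: less_imp_le)
    then have "b * y \<le> sum_list bs * y"
      using y by (intro mult_right_mono)
    with y show ?thesis by simp
  qed
  then show ?thesis by (simp add: trunc_def)
qed

text \<open>
  On \<open>[0, y]\<close> the truncation is the positive part of the running minimum of the polynomial,
  which is 1-Lipschitz for the supremum norm.
\<close>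
lemma trunc_close:
  assumes bs: "\<forall>b\<in>set bs. 0 < b" and cs: "\<forall>b\<in>set cs. 0 < b" and y: "0 \<le> y"
    and close: "\<And>z. 0 \<le> z \<Longrightarrow> z \<le> y \<Longrightarrow> \<bar>poly (prod_lin bs) z - poly (prod_lin cs) z\<bar> \<le> e"
  shows "trunc bs y \<le> trunc cs y + e"
proof (rule ccontr)
  assume neg: "\<not> trunc bs y \<le> trunc cs y + e"
  have e: "0 \<le> e"
    using close[of 0] y by simp
  with neg trunc_bounds(1)[OF cs y] have pos: "trunc bs y > e"
    by simp
  then have lt: "\<forall>b\<in>set bs. b * y < 1"
    using e by (auto simp: trunc_def split: if_splits)
  then have tb: "trunc bs y = poly (prod_lin bs) y"
    by (simp add: trunc_def)
  have "b * y < 1" if b: "b \<in> set cs" for b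
  proof (rule ccontr)
    assume ge: "\<not> b * y < 1"
    \<comment> \<open>A zero \<open>z \<le> y\<close> of the second polynomial is impossible: up to
      \<open>y\<close> the first one decreases, so at \<open>z\<close> it still exceeds
      \<open>e\<close>, while the two differ by at most \<open>e\<close>.\<close>
    have b0: "b > 0" using b cs by simp
    define z where "z = 1 / b"
    have z: "0 \<le> z" "z \<le> y"
      using b0 ge by (auto simp: z_def field_simps)
    have "poly (prod_lin cs) z = 0"
      using prod_lin_remove1[OF b] b0 by (simp add: z_def)
    moreover have "poly (prod_lin bs) y \<le> poly (prod_lin bs) z"
      unfolding poly_prod_lin using bs lt z by (intro prod_list_antimono) (auto simp: less_imp_le)
    ultimately show False
      using close[OF z] pos tb by simp
  qed
  then have "trunc cs y = poly (prod_lin cs) y"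
    by (simp add: trunc_def)
  then show False
    using neg tb close[OF y order_refl] by simp
qed

section \<open>Interpolated residual polynomials\<close>

context cg_weights
begin

text \<open>Beyond the number of distinct nodes the normal equations have many solutions;
  \<open>SOME\<close> keeps the sequence total, and facts about zeros carry a bound on
  \<open>k\<close>.\<close>

definition cg :: "nat \<Rightarrow> real poly" where
  "cg k = (SOME p. is_cg k k p)"

lemma is_cg_cg: "is_cg k k (cg k)"
  unfolding cg_def using is_cg_exists by (rule someI_ex)

definition interp :: "real \<Rightarrow> real poly" where
  "interp t = (if t \<le> 0 then cg 0
     else let k = nat (\<lceil>t\<rceil> - 1); \<alpha> = t - real k
          in Polynomial.smult (1 - \<alpha>) (cg k) + Polynomial.smult \<alpha> (cg (Suc k)))"

lemma interpE:
  assumes "0 < t" "t \<le> real n"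
  obtains k \<alpha> where "Suc k \<le> n" "0 < \<alpha>" "\<alpha> \<le> 1" "t = real k + \<alpha>"
    "interp t = Polynomial.smult (1 - \<alpha>) (cg k) + Polynomial.smult \<alpha> (cg (Suc k))"
proof -
  define k where "k = nat (\<lceil>t\<rceil> - 1)"
  have "1 \<le> \<lceil>t\<rceil>"
    using assms by linarith
  then have k: "of_int \<lceil>t\<rceil> = real k + 1"
    unfolding k_def by simp
  have "t \<le> real k + 1" "real k < t"
    using k ceiling_correct[of t] by linarith+
  moreover have "Suc k \<le> n"
    using assms \<open>real k < t\<close> by linarith
  moreover have "interp t = Polynomial.smult (1 - (t - real k)) (cg k) + Polynomial.smult (t - real k) (cg (Suc k))"
    using assms by (simp add: interp_def Let_def k_def)
  ultimately show ?thesis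
    using that[of k "t - real k"] by simp
qed

text \<open>Clamping \<open>t - k\<close> to the unit interval gives one formula for all
  \<open>t\<close>, in which every coefficient is 1-Lipschitz. Continuity at integer
  \<open>t\<close> then needs no case distinction.\<close>

lemma interp_telescope:
  assumes "0 \<le> t" "t \<le> real n"
  shows "interp t = cg 0 + (\<Sum>k<n. Polynomial.smult (max 0 (min 1 (t - real k))) (cg (Suc k) - cg k))"
proof (cases "t = 0")
  case True
  then show ?thesis by (auto simp: interp_def intro!: sum.neutral)
next
  case False
  then obtain k \<alpha> where k: "Suc k \<le> n" "0 < \<alpha>" "\<alpha> \<le> 1" "t = real k + \<alpha>"
    and it: "interp t = Polynomial.smult (1 - \<alpha>) (cg k) + Polynomial.smult \<alpha> (cg (Suc k))"
    using interpE[of t n] assms by auto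
  let ?f = "\<lambda>j. Polynomial.smult (max 0 (min 1 (t - real j))) (cg (Suc j) - cg j)"
  have "(\<Sum>j<n. ?f j) = (\<Sum>j<Suc k. ?f j)"
    using k by (intro sum.mono_neutral_right) (auto simp: max_def)
  also have "\<dots> = (\<Sum>j<k. ?f j) + ?f k"
    by simp
  also have "?f k = Polynomial.smult \<alpha> (cg (Suc k) - cg k)"
    using k by simp
  also have "(\<Sum>j<k. ?f j) = (\<Sum>j<k. cg (Suc j) - cg j)"
  proof (intro sum.cong refl)
    fix j assume "j \<in> {..<k}"
    then have "real j + 1 \<le> real k" by simp
    then have "max 0 (min 1 (t - real j)) = 1"
      using k by linarith
    then show "?f j = cg (Suc j) - cg j" by simp
  qed
  also have "\<dots> = cg k - cg 0"
    by (rule sum_lessThan_telescope)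
  finally show ?thesis
    unfolding it by (simp add: smult_diff_left smult_diff_right)
qed

lemma coeff_cg_sign:
  assumes "k \<le> card (x ` I)"
  shows "degree (cg k) = k" "0 < (-1) ^ k * coeff (cg k) k"
proof -
  obtain bs where "\<forall>b\<in>set bs. 0 < b" "cg k = prod_lin bs" "length bs = k"
    using prod_lin_of_orthogonal[OF is_cg_cg assms] by auto
  then show "degree (cg k) = k" "0 < (-1) ^ k * coeff (cg k) k"
    using degree_coeff_prod_lin[of bs] by auto
qed

lemma degree_interp:
  assumes k: "Suc k \<le> card (x ` I)" and \<alpha>: "0 < \<alpha>"
  shows "degree (Polynomial.smult (1 - \<alpha>) (cg k) + Polynomial.smult \<alpha> (cg (Suc k))) = Suc k" (is "degree ?p = _")
proof (rule antisym)
  have "coeff (cg k) (Suc k) = 0"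
    using coeff_cg_sign(1)[of k] k by (intro coeff_eq_0) simp
  then have "coeff ?p (Suc k) \<noteq> 0"
    using coeff_cg_sign(2)[OF k] \<alpha> by auto
  then show "Suc k \<le> degree ?p"
    by (rule le_degree)
  show "degree ?p \<le> Suc k"
    using is_cg_cg[of k] is_cg_cg[of "Suc k"] unfolding is_cg_def
    by (auto intro!: degree_add_le order_trans[OF degree_smult_le])
qed

lemma interp_prod_lin:
  assumes "0 \<le> t" "t \<le> real (card (x ` I))"
  shows "\<exists>bs. (\<forall>b\<in>set bs. 0 < b) \<and> interp t = prod_lin bs"
proof (cases "t = 0")
  case True
  then show ?thesis
    using prod_lin_of_orthogonal[OF is_cg_cg, of 0] by (intro exI[of _ "[]"]) (auto simp: interp_def)
next
  case False
  then obtain k \<alpha> where k: "Suc k \<le> card (x ` I)" "0 < \<alpha>" "\<alpha> \<le> 1"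
    and it: "interp t = Polynomial.smult (1 - \<alpha>) (cg k) + Polynomial.smult \<alpha> (cg (Suc k))"
    using interpE[of t "card (x ` I)"] assms by (metis less_eq_real_def)
  \<comment> \<open>Both ends satisfy the first \<open>k\<close> relations. The missing one is made
    up for by the leading coefficient, which comes from \<open>cg (Suc k)\<close> alone since
    \<open>\<alpha> > 0\<close>.\<close>
  have 1: "is_cg (Suc k) k (interp t)"
    using is_cg_cg[of k] is_cg_cg[of "Suc k"] unfolding it is_cg_def
    by (auto intro!: degree_add_le order_trans[OF degree_smult_le] simp: B_linear)
  have "coeff (cg k) (Suc k) = 0"
    using coeff_cg_sign(1)[of k] k(1) by (intro coeff_eq_0) simp
  then have "0 < (-1) ^ Suc k * coeff (interp t) (Suc k)"
    using coeff_cg_sign(2)[of "Suc k"] k by (simp add: it mult.left_commute[of _ \<alpha>] mult_pos_neg)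
  then show ?thesis
    using prod_lin_of_orthogonal[OF 1 k(1)] by auto
qed

definition factors :: "real \<Rightarrow> real list" where
  "factors t = (SOME bs. (\<forall>b\<in>set bs. 0 < b) \<and> interp t = prod_lin bs)"

lemma factors:
  assumes "0 \<le> t" "t \<le> real (card (x ` I))"
  shows "\<forall>b\<in>set (factors t). 0 < b" "interp t = prod_lin (factors t)"
  using someI_ex[OF interp_prod_lin[OF assms]] by (auto simp: factors_def)

lemma length_factors:
  assumes "0 \<le> t" "t \<le> real (card (x ` I))"
  shows "length (factors t) = degree (interp t)"
  using factors[OF assms] degree_coeff_prod_lin by auto

lemma factors_0: "factors 0 = []"
  using length_factors[of 0] coeff_cg_sign(1)[of 0] by (simp add: interp_def)

text \<open>Guarantees that a zero exists for \<open>t > 0\<close>, so that the \<open>LEAST\<close>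
  in \<open>first_zero\<close> is meaningful.\<close>

lemma factors_nonempty:
  assumes "0 < t" "t \<le> real (card (x ` I))"
  shows "factors t \<noteq> []"
proof -
  obtain k \<alpha> where "Suc k \<le> card (x ` I)" "0 < \<alpha>"
    "interp t = Polynomial.smult (1 - \<alpha>) (cg k) + Polynomial.smult \<alpha> (cg (Suc k))"
    using interpE[OF assms] by metis
  then have "degree (interp t) = Suc k"
    using degree_interp by simp
  then show ?thesis
    using length_factors[of t] assms by auto
qed

text \<open>Let \<open>1 / b\<close> be the first zero and \<open>r = (1 - b * x) * q\<close>. Since
  \<open>B r (x * q) \<ge> 0\<close> and \<open>r + b * x * q = q\<close>, the residual is at most
  \<open>B r q\<close>, the weighted sum of \<open>(1 - b * x) * q^2\<close>. Before the first zero
  \<open>q\<close> lies between 0 and 1, so each summand is at most \<open>r\<close>; past it the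
  summand is nonpositive.\<close>

lemma residual_le:
  assumes t: "0 \<le> t" "t \<le> real (card (x ` I))"
  shows "B (interp t) (interp t) \<le> (\<Sum>i\<in>I. w i * trunc (factors t) (x i))"
proof (cases "t = 0")
  case True
  then have "interp t = 1" "factors t = []"
    using factors[OF t] factors_0 by (auto simp: prod_lin_def)
  then show ?thesis
    by (simp add: B_def trunc_def prod_lin_def)
next
  case False
  then obtain k \<alpha> where k: "Suc k \<le> card (x ` I)" "0 < \<alpha>" "\<alpha> \<le> 1"
    and it: "interp t = Polynomial.smult (1 - \<alpha>) (cg k) + Polynomial.smult \<alpha> (cg (Suc k))"
    using interpE[of t "card (x ` I)"] assms by (metis less_eq_real_def)
  define bs where "bs = factors t"
  have bs: "\<forall>b\<in>set bs. 0 < b" "interp t = prod_lin bs"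
    using factors[OF t] by (auto simp: bs_def)
  have "degree (interp t) = Suc k"
    unfolding it by (rule degree_interp[OF k(1,2)])
  then have len: "length bs = Suc k"
    using length_factors[OF t] by (simp add: bs_def)
  then have ne: "set bs \<noteq> {}" by auto
  define b where "b = Max (set bs)"
  define cs where "cs = remove1 b bs"
  have b: "b \<in> set bs" "\<And>c. c \<in> set bs \<Longrightarrow> c \<le> b"
    using ne by (auto simp: b_def)
  have b0: "b > 0" using b bs by auto
  define q where "q = prod_lin cs"
  have cs: "\<forall>c\<in>set cs. 0 < c" "set cs \<subseteq> set bs"
    using bs(1) set_remove1_subset[of b bs] by (auto simp: cs_def)
  have len_cs: "length cs = k"
    using len b(1) by (simp add: cs_def length_remove1)
  have pq: "interp t = [:1, -b:] * q"
    using prod_lin_remove1[OF b(1)] bs(2) by (simp add: q_def cs_def del: mult_pCons_left)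
  have q: "degree q = k" "0 < (-1) ^ k * coeff q k"
    using degree_coeff_prod_lin[OF cs(1)] len_cs by (auto simp: q_def)
  have 0: "B (interp t) (pCons 0 q) \<ge> 0"
  proof -
    \<comment> \<open>\<open>cg (Suc k)\<close> is orthogonal to \<open>x * q\<close>. Against
      \<open>cg k\<close> only the leading term of \<open>q\<close> counts, so \<open>q\<close> may
      be replaced by \<open>c * cg k\<close>; \<open>c\<close> is positive because both leading
      coefficients have sign \<open>(-1) ^ k\<close>.\<close>
    define c where "c = coeff q k / coeff (cg k) k"
    have sg: "0 < (-1) ^ k * coeff (cg k) k" "degree (cg k) = k"
      using coeff_cg_sign[of k] k(1) by auto
    have "c = ((-1) ^ k * coeff q k) / ((-1) ^ k * coeff (cg k) k)"
      by (simp add: c_def)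
    then have "c > 0"
      using sg(1) q(2) by (simp only: divide_pos_pos)
    have "coeff (q - Polynomial.smult c (cg k)) i = 0" if "i \<ge> k" for i
      using that sg q(1) by (cases "i = k") (auto simp: c_def coeff_eq_0)
    then have "B (cg k) (pCons 0 (q - Polynomial.smult c (cg k))) = 0"
      using is_cg_cg[of k] by (auto simp: is_cg_def)
    moreover have "pCons 0 (q - Polynomial.smult c (cg k)) = pCons 0 q - Polynomial.smult c (pCons 0 (cg k))"
      by simp
    ultimately have 1: "B (cg k) (pCons 0 q) = c * B (cg k) (pCons 0 (cg k))"
      by (simp only: B_linear)
    have "0 \<le> w i * poly (cg k) (x i) * poly (pCons 0 (cg k)) (x i)" if "i \<in> I" for i
    proof -
      have "w i * poly (cg k) (x i) * poly (pCons 0 (cg k)) (x i) = w i * x i * (poly (cg k) (x i))\<^sup>2"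
        by (simp add: power2_eq_square)
      also have "\<dots> \<ge> 0"
        using w_pos[OF that] x_pos[OF that] by simp
      finally show ?thesis .
    qed
    then have "0 \<le> B (cg k) (pCons 0 (cg k))"
      unfolding B_def by (intro sum_nonneg)
    moreover have "B (cg (Suc k)) (pCons 0 q) = 0"
      using is_cg_cg[of "Suc k"] q(1) by (auto simp: is_cg_def coeff_eq_0)
    ultimately show ?thesis
      unfolding it B_linear 1 using k \<open>c > 0\<close> by simp
  qed
  have "B (interp t) (interp t) \<le> B (interp t) (interp t) + b * B (interp t) (pCons 0 q)"
    using 0 b0 by simp
  also have "\<dots> = (\<Sum>i\<in>I. w i * (poly (interp t) (x i) * poly q (x i)))"
    unfolding B_def sum_distrib_left sum.distrib[symmetric]
  proof (intro sum.cong refl)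
    fix i
    show "w i * poly (interp t) (x i) * poly (interp t) (x i) +
        b * (w i * poly (interp t) (x i) * poly (pCons 0 q) (x i)) =
        w i * (poly (interp t) (x i) * poly q (x i))"
      unfolding pq poly_mult by (simp add: algebra_simps)
  qed
  also have "\<dots> \<le> (\<Sum>i\<in>I. w i * trunc bs (x i))"
  proof (intro sum_mono mult_left_mono)
    fix i assume i: "i \<in> I"
    have xi: "x i > 0" using x_pos[OF i] .
    have *: "poly (interp t) (x i) * poly q (x i) = (1 - b * x i) * (poly q (x i))\<^sup>2"
      unfolding pq poly_mult by (simp add: power2_eq_square algebra_simps)
    show "poly (interp t) (x i) * poly q (x i) \<le> trunc bs (x i)"
    proof (cases "b * x i < 1")
      case True
      have lt: "c * x i < 1" if "c \<in> set bs" for c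
        using mult_right_mono[OF b(2)[OF that], of "x i"] xi True by linarith
      then have tr: "trunc bs (x i) = poly (interp t) (x i)"
        by (simp add: trunc_def bs(2))
      have "0 \<le> poly q (x i) \<and> poly q (x i) \<le> 1"
        unfolding q_def poly_prod_lin using cs lt xi
        by (intro prod_list_nonneg_le_1) (auto simp: less_imp_le subset_iff)
      moreover have "0 \<le> poly (interp t) (x i)"
        using trunc_bounds(1)[OF bs(1), of "x i"] xi tr by simp
      ultimately show ?thesis
        unfolding tr by (simp add: mult_left_le)
    next
      case False
      then have "poly (interp t) (x i) * poly q (x i) \<le> 0"
        unfolding * by (intro mult_nonpos_nonneg) auto
      also have "0 \<le> trunc bs (x i)"
        using trunc_bounds(1)[OF bs(1)] xi by simp
      finally show ?thesis .
    qed
  qed (use w_pos in \<open>auto simp: less_imp_le\<close>)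
  finally show ?thesis by (simp add: bs_def)
qed

text \<open>The product vanishing at all nodes competes in the last minimisation with residual zero.
  So the iteration ends with zero residual, which makes the set defining the oracle
  nonempty.\<close>

lemma interp_end:
  assumes "i \<in> I"
  shows "poly (interp (real (card (x ` I)))) (x i) = 0"
proof -
  let ?d = "card (x ` I)"
  have "?d > 0"
    using assms finite_I by (auto simp: card_gt_0_iff)
  then obtain k \<alpha> where k: "Suc k \<le> ?d" "\<alpha> \<le> 1" "real ?d = real k + \<alpha>"
    "interp (real ?d) = Polynomial.smult (1 - \<alpha>) (cg k) + Polynomial.smult \<alpha> (cg (Suc k))"
    using interpE[of "real ?d" ?d] by (metis of_nat_0_less_iff order_refl)
  then have "\<alpha> = 1" "Suc k = ?d" by linarith+
  with k have id: "interp (real ?d) = cg ?d" by simp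
  obtain cs where cs: "\<forall>b\<in>set cs. 0 < b" "length cs = ?d" "\<forall>i\<in>I. poly (prod_lin cs) (x i) = 0"
    using vanishing_prod_lin by blast
  have "B (prod_lin cs) (prod_lin cs) = 0"
    using cs(3) by (simp add: B_def)
  moreover have "B (prod_lin cs) (prod_lin cs) =
      B (cg ?d) (cg ?d) + B (prod_lin cs - cg ?d) (prod_lin cs - cg ?d)"
    using degree_coeff_prod_lin[OF cs(1)] cs(2)
    by (intro cg_pythagoras[OF is_cg_cg]) (auto simp: poly_prod_lin map_replicate_const)
  ultimately have "B (cg ?d) (cg ?d) \<le> 0"
    using B_nonneg[of "prod_lin cs - cg ?d"] by linarith
  then show ?thesis
    unfolding id using B_eq_0 assms by blast
qed

text \<open>Uniformity over \<open>z\<close> in the whole interval is essential: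
  \<open>trunc_close\<close> compares the polynomials up to \<open>y\<close>, not only at
  \<open>y\<close>.\<close>

lemma interp_lipschitz:
  "\<exists>M\<ge>0. \<forall>s\<in>{0..real n}. \<forall>t\<in>{0..real n}. \<forall>z\<in>{0..y}.
     \<bar>poly (interp s) z - poly (interp t) z\<bar> \<le> M * \<bar>s - t\<bar>"
proof -
  have "\<exists>C. \<forall>z\<in>{0..y}. \<bar>poly (cg (Suc k) - cg k) z\<bar> \<le> C" for k
  proof -
    have "compact ((\<lambda>z. poly (cg (Suc k) - cg k) z) ` {0..y})"
      by (intro compact_continuous_image continuous_intros) simp
    then have "bounded ((\<lambda>z. poly (cg (Suc k) - cg k) z) ` {0..y})"
      by (rule compact_imp_bounded)
    then show ?thesis
      by (auto simp: bounded_iff)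
  qed
  then obtain C where C: "\<And>k z. z \<in> {0..y} \<Longrightarrow> \<bar>poly (cg (Suc k) - cg k) z\<bar> \<le> C k"
    by metis
  define M where "M = (\<Sum>k<n. \<bar>C k\<bar>)"
  have "M \<ge> 0" by (simp add: M_def sum_nonneg)
  moreover have "\<bar>poly (interp s) z - poly (interp t) z\<bar> \<le> M * \<bar>s - t\<bar>"
    if st: "s \<in> {0..real n}" "t \<in> {0..real n}" and z: "z \<in> {0..y}" for s t z
  proof -
    let ?c = "\<lambda>t k. max 0 (min 1 (t - real k))"
    have "poly (interp s) z - poly (interp t) z =
        (\<Sum>k<n. (?c s k - ?c t k) * poly (cg (Suc k) - cg k) z)"
      using st interp_telescope[of s n] interp_telescope[of t n]
      by (simp add: poly_sum algebra_simps sum_subtractf sum.distrib)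
    also have "\<bar>\<dots>\<bar> \<le> (\<Sum>k<n. \<bar>s - t\<bar> * \<bar>C k\<bar>)"
    proof (rule order_trans[OF sum_abs], intro sum_mono)
      fix k
      have "\<bar>?c s k - ?c t k\<bar> \<le> \<bar>s - t\<bar>"
        by (auto simp: max_def min_def abs_if)
      moreover have "\<bar>poly (cg (Suc k) - cg k) z\<bar> \<le> \<bar>C k\<bar>"
        using C[OF z, of k] by linarith
      ultimately show "\<bar>(?c s k - ?c t k) * poly (cg (Suc k) - cg k) z\<bar> \<le> \<bar>s - t\<bar> * \<bar>C k\<bar>"
        unfolding abs_mult by (intro mult_mono) auto
    qed
    finally show ?thesis
      by (simp add: M_def sum_distrib_right mult.commute[of "\<bar>s - t\<bar>"])
  qed
  ultimately show ?thesis by blast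
qed

lemma continuous_on_poly_interp: "continuous_on {0..real n} (\<lambda>t. poly (interp t) z)"
proof -
  have "continuous_on {0..real n} (\<lambda>t. poly (cg 0 + (\<Sum>k<n. Polynomial.smult (max 0 (min 1 (t - real k))) (cg (Suc k) - cg k))) z)"
    unfolding poly_add poly_sum poly_smult by (intro continuous_intros)
  then show ?thesis
    by (rule continuous_on_eq) (auto simp: interp_telescope[symmetric])
qed

text \<open>The first zero escapes to infinity as \<open>t\<close> tends to 0, so continuity is not
  derived from that of the zero but from comparing the truncated functions directly.\<close>

lemma continuous_on_trunc:
  assumes "0 \<le> y"
  shows "continuous_on {0..real (card (x ` I))} (\<lambda>t. trunc (factors t) y)"
proof -
  let ?d = "card (x ` I)"
  obtain M where M: "M \<ge> 0" "\<And>s t z. s \<in> {0..real ?d} \<Longrightarrow> t \<in> {0..real ?d} \<Longrightarrow> z \<in> {0..y} \<Longrightarrow>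
     \<bar>poly (interp s) z - poly (interp t) z\<bar> \<le> M * \<bar>s - t\<bar>"
    using interp_lipschitz[of ?d y] by blast
  have *: "trunc (factors s) y \<le> trunc (factors t) y + M * \<bar>s - t\<bar>"
    if "s \<in> {0..real ?d}" "t \<in> {0..real ?d}" for s t
    using that M(2)[OF that] assms by (intro trunc_close) (auto simp: factors)
  have "M-lipschitz_on {0..real ?d} (\<lambda>t. trunc (factors t) y)"
  proof (rule lipschitz_onI)
    fix s t assume st: "s \<in> {0..real ?d}" "t \<in> {0..real ?d}"
    show "dist (trunc (factors s) y) (trunc (factors t) y) \<le> M * dist s t"
      using *[OF st] *[OF st(2,1)] by (simp add: dist_real_def abs_minus_commute)
  qed fact
  then show ?thesis
    by (rule lipschitz_on_continuous_on)
qed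

end

subsection \<open>Coordinates in the singular basis\<close>

lemma vnorm_sq: "(vnorm w)\<^sup>2 = w \<bullet> w"
proof -
  have "0 \<le> w \<bullet> w"
    by (auto simp: scalar_prod_def intro!: sum_nonneg)
  then show ?thesis by (simp add: vnorm_def)
qed

lemma vnorm_uminus: "w \<in> carrier_vec n \<Longrightarrow> vnorm (- w) = vnorm w"
  by (simp add: vnorm_def)

definition lincomb_fam :: "nat \<Rightarrow> 'i set \<Rightarrow> ('i \<Rightarrow> real) \<Rightarrow> ('i \<Rightarrow> real vec) \<Rightarrow> real vec" where
  "lincomb_fam n I c e = vec n (\<lambda>j. \<Sum>i\<in>I. c i * e i $ j)"

lemma lincomb_fam_carrier [simp]: "lincomb_fam n I c e \<in> carrier_vec n"
  by (simp add: lincomb_fam_def)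

lemma scalar_prod_lincomb_fam:
  assumes "w \<in> carrier_vec n" "\<And>i. i \<in> I \<Longrightarrow> e i \<in> carrier_vec n"
  shows "lincomb_fam n I c e \<bullet> w = (\<Sum>i\<in>I. c i * (e i \<bullet> w))"
proof -
  have "lincomb_fam n I c e \<bullet> w = (\<Sum>j<n. (\<Sum>i\<in>I. c i * e i $ j) * w $ j)"
    using assms(1) by (simp add: scalar_prod_def lincomb_fam_def lessThan_atLeast0)
  also have "\<dots> = (\<Sum>i\<in>I. \<Sum>j<n. c i * e i $ j * w $ j)"
    unfolding sum_distrib_right by (rule sum.swap)
  also have "\<dots> = (\<Sum>i\<in>I. c i * (e i \<bullet> w))"
    using assms by (simp add: scalar_prod_def lessThan_atLeast0 sum_distrib_left mult.assoc)
  finally show ?thesis .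
qed

lemma scalar_prod_lincomb_fam_orthonormal:
  assumes "finite I" "\<And>i. i \<in> I \<Longrightarrow> e i \<in> carrier_vec n"
    "\<And>i j. i \<in> I \<Longrightarrow> j \<in> I \<Longrightarrow> e i \<bullet> e j = (if i = j then 1 else 0)" "k \<in> I"
  shows "lincomb_fam n I c e \<bullet> e k = c k"
proof -
  have "lincomb_fam n I c e \<bullet> e k = (\<Sum>i\<in>I. c i * (e i \<bullet> e k))"
    using assms by (intro scalar_prod_lincomb_fam) auto
  also have "\<dots> = (\<Sum>i\<in>I. if i = k then c k else 0)"
    using assms by (intro sum.cong) auto
  finally show ?thesis using assms by simp
qed

text \<open>Meant for the \<open>v i\<close>, which in general span only a
  \<open>D\<close>-dimensional part of the larger space; the \<open>u i\<close> satisfy the equality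
  \<open>parseval\<close>.\<close>

lemma bessel:
  assumes "finite I" "\<And>i. i \<in> I \<Longrightarrow> e i \<in> carrier_vec n"
    "\<And>i j. i \<in> I \<Longrightarrow> j \<in> I \<Longrightarrow> e i \<bullet> e j = (if i = j then 1 else 0)"
    and w: "(w :: real vec) \<in> carrier_vec n"
  shows "(\<Sum>i\<in>I. (w \<bullet> e i)\<^sup>2) \<le> w \<bullet> w"
proof -
  define y where "y = lincomb_fam n I (\<lambda>i. w \<bullet> e i) e"
  have y: "y \<in> carrier_vec n" by (simp add: y_def)
  have "y \<bullet> w = (\<Sum>i\<in>I. (w \<bullet> e i) * (e i \<bullet> w))"
    unfolding y_def using assms by (intro scalar_prod_lincomb_fam) auto
  also have "\<dots> = (\<Sum>i\<in>I. (w \<bullet> e i)\<^sup>2)"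
    using assms w by (intro sum.cong refl) (simp add: power2_eq_square comm_scalar_prod[of _ n])
  finally have 1: "y \<bullet> w = (\<Sum>i\<in>I. (w \<bullet> e i)\<^sup>2)" .
  have "y \<bullet> y = (\<Sum>i\<in>I. (w \<bullet> e i) * (e i \<bullet> y))"
    unfolding y_def using assms by (intro scalar_prod_lincomb_fam) auto
  also have "\<dots> = (\<Sum>i\<in>I. (w \<bullet> e i)\<^sup>2)"
  proof (intro sum.cong refl)
    fix i assume i: "i \<in> I"
    have "e i \<bullet> y = y \<bullet> e i"
      using assms i y by (intro comm_scalar_prod[of _ n]) auto
    also have "\<dots> = w \<bullet> e i"
      unfolding y_def using assms i by (intro scalar_prod_lincomb_fam_orthonormal) auto
    finally show "(w \<bullet> e i) * (e i \<bullet> y) = (w \<bullet> e i)\<^sup>2"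
      by (simp add: power2_eq_square)
  qed
  finally have 2: "y \<bullet> y = (\<Sum>i\<in>I. (w \<bullet> e i)\<^sup>2)" .
  have "0 \<le> (w - y) \<bullet> (w - y)"
    unfolding vnorm_sq[symmetric] by simp
  also have "(w - y) \<bullet> (w - y) = w \<bullet> w - y \<bullet> w - (w \<bullet> y - y \<bullet> y)"
    using w y by (simp add: scalar_prod_minus_distrib[of _ n] minus_scalar_prod_distrib[of _ n])
  also have "w \<bullet> y = y \<bullet> w"
    using w y by (intro comm_scalar_prod[of _ n]) auto
  finally show ?thesis
    using 1 2 by simp
qed

lemma mat_inverse_of_injective:
  fixes M :: "real mat"
  assumes M: "M \<in> carrier_mat n n" and inj: "\<And>w. w \<in> carrier_vec n \<Longrightarrow> M *\<^sub>v w = 0\<^sub>v n \<Longrightarrow> w = 0\<^sub>v n"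
  shows "the (mat_inverse M) \<in> carrier_mat n n" "M * the (mat_inverse M) = 1\<^sub>m n"
proof -
  have "det M \<noteq> 0"
    using inj det_0_iff_vec_prod_zero[OF M] by blast
  then have "M \<in> Units (ring_mat TYPE(real) n ())"
    by (rule det_non_zero_imp_unit[OF M])
  then have "mat_inverse M \<noteq> None"
    using mat_inverse(1)[OF M, where b = "()"] by blast
  then obtain N where "mat_inverse M = Some N" by auto
  with mat_inverse(2)[OF M this]
  show "the (mat_inverse M) \<in> carrier_mat n n" "M * the (mat_inverse M) = 1\<^sub>m n"
    by auto
qed

locale svd =
  fixes D P :: nat and A :: "real mat" and l :: "nat \<Rightarrow> real" and u v :: "nat \<Rightarrow> real vec"
  assumes A: "A \<in> carrier_mat D P" and sys: "singular_system A l u v"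
begin

lemma dims [simp]: "dim_row A = D" "dim_col A = P"
  using A by auto

lemma l_pos: "i \<in> {1..D} \<Longrightarrow> 0 < l i"
  and u_carrier: "i \<in> {1..D} \<Longrightarrow> u i \<in> carrier_vec D"
  and v_carrier: "i \<in> {1..D} \<Longrightarrow> v i \<in> carrier_vec P"
  and u_orth: "i \<in> {1..D} \<Longrightarrow> j \<in> {1..D} \<Longrightarrow> u i \<bullet> u j = (if i = j then 1 else 0)"
  and v_orth: "i \<in> {1..D} \<Longrightarrow> j \<in> {1..D} \<Longrightarrow> v i \<bullet> v j = (if i = j then 1 else 0)"
  and A_v: "i \<in> {1..D} \<Longrightarrow> A *\<^sub>v v i = l i \<cdot>\<^sub>v u i"
  and At_u: "i \<in> {1..D} \<Longrightarrow> A\<^sup>T *\<^sub>v u i = l i \<cdot>\<^sub>v v i"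
  using sys by (auto simp: singular_system_def)

text \<open>The matrix with columns \<open>u i\<close> is square, so its transpose, being a left
  inverse, is also a right inverse. Matrix columns count from 0 and the \<open>u i\<close> from
  1.\<close>

lemma u_complete:
  assumes "j < D" "k < D"
  shows "(\<Sum>i=1..D. u i $ j * u i $ k) = (if j = k then 1 else 0)"
proof -
  define U where "U = mat D D (\<lambda>(r, c). u (Suc c) $ r)"
  have U: "U \<in> carrier_mat D D" by (simp add: U_def)
  have col: "col U c = u (Suc c)" if "c < D" for c
    using that u_carrier[of "Suc c"] by (intro eq_vecI) (auto simp: U_def)
  have "U\<^sup>T * U = 1\<^sub>m D"
  proof (rule eq_matI)
    fix r c assume "r < dim_row (1\<^sub>m D)" "c < dim_col (1\<^sub>m D)"
    then show "(U\<^sup>T * U) $$ (r, c) = 1\<^sub>m D $$ (r, c)"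
      using U u_orth[of "Suc r" "Suc c"] by (simp add: col)
  qed (use U in auto)
  then have "U * U\<^sup>T = 1\<^sub>m D"
    using mat_mult_left_right_inverse[of "U\<^sup>T" D U] U by simp
  then have "(U * U\<^sup>T) $$ (j, k) = (if j = k then 1 else 0)"
    using assms by simp
  also have "(U * U\<^sup>T) $$ (j, k) = (\<Sum>c<D. u (Suc c) $ j * u (Suc c) $ k)"
    using assms U by (simp add: scalar_prod_def U_def lessThan_atLeast0)
  also have "\<dots> = (\<Sum>i=1..D. u i $ j * u i $ k)"
    by (rule sum.reindex_bij_witness[of _ "\<lambda>i. i - 1" Suc]) auto
  finally show ?thesis .
qed

lemma parseval:
  assumes w: "w \<in> carrier_vec D" and w': "w' \<in> carrier_vec D"
  shows "w \<bullet> w' = (\<Sum>i=1..D. (w \<bullet> u i) * (w' \<bullet> u i))"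
proof -
  have "(\<Sum>i=1..D. (w \<bullet> u i) * (w' \<bullet> u i)) =
      (\<Sum>i=1..D. (\<Sum>j<D. w $ j * u i $ j) * (\<Sum>k<D. w' $ k * u i $ k))"
    using carrier_vecD[OF u_carrier] by (intro sum.cong refl) (simp add: scalar_prod_def lessThan_atLeast0)
  also have "\<dots> = (\<Sum>i=1..D. \<Sum>j<D. \<Sum>k<D. w $ j * w' $ k * (u i $ j * u i $ k))"
    unfolding sum_product by (intro sum.cong refl) (simp add: algebra_simps)
  also have "\<dots> = (\<Sum>j<D. \<Sum>i=1..D. \<Sum>k<D. w $ j * w' $ k * (u i $ j * u i $ k))"
    by (rule sum.swap)
  also have "\<dots> = (\<Sum>j<D. \<Sum>k<D. \<Sum>i=1..D. w $ j * w' $ k * (u i $ j * u i $ k))"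
    by (intro sum.cong refl sum.swap)
  also have "\<dots> = (\<Sum>j<D. \<Sum>k<D. if j = k then w $ j * w' $ k else 0)"
    unfolding sum_distrib_left[symmetric]
    by (intro sum.cong refl) (simp only: u_complete lessThan_iff, simp)
  also have "\<dots> = w \<bullet> w'"
    using w w' by (simp add: scalar_prod_def lessThan_atLeast0)
  finally show ?thesis ..
qed

lemma vnorm_sq_coords: "w \<in> carrier_vec D \<Longrightarrow> (vnorm w)\<^sup>2 = (\<Sum>i=1..D. (w \<bullet> u i)\<^sup>2)"
  unfolding vnorm_sq using parseval[of w w] by (simp add: power2_eq_square)

lemma eq_0_of_coords:
  assumes "w \<in> carrier_vec D" "\<And>i. i \<in> {1..D} \<Longrightarrow> w \<bullet> u i = 0"
  shows "w = 0\<^sub>v D"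
proof -
  have "w \<bullet> w = 0"
    using parseval[OF assms(1,1)] assms(2) by simp
  then have "(\<Sum>j<D. w $ j * w $ j) = 0"
    using assms(1) by (simp add: scalar_prod_def lessThan_atLeast0)
  then have "\<forall>j<D. w $ j = 0"
    by (subst (asm) sum_nonneg_eq_0_iff) auto
  then show ?thesis
    using assms(1) by (intro eq_vecI) auto
qed

lemma apply_AAT_eq: "apply_AAT A l u h w = lincomb_fam D {1..D} (\<lambda>i. h ((l i)\<^sup>2) * (w \<bullet> u i)) u"
  by (simp add: apply_AAT_def lincomb_fam_def)

lemma apply_AAT_carrier [simp]: "apply_AAT A l u h w \<in> carrier_vec D"
  by (simp add: apply_AAT_eq)

lemma apply_AAT_coord: "i \<in> {1..D} \<Longrightarrow> apply_AAT A l u h w \<bullet> u i = h ((l i)\<^sup>2) * (w \<bullet> u i)"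
  unfolding apply_AAT_eq by (intro scalar_prod_lincomb_fam_orthonormal) (auto simp: u_carrier u_orth)

lemma vnorm_apply_AAT:
  "(vnorm (apply_AAT A l u h w))\<^sup>2 = (\<Sum>i=1..D. (h ((l i)\<^sup>2))\<^sup>2 * (w \<bullet> u i)\<^sup>2)"
  unfolding vnorm_sq_coords[OF apply_AAT_carrier]
  by (intro sum.cong refl) (simp only: apply_AAT_coord power_mult_distrib)

lemma A_coord:
  assumes "f \<in> carrier_vec P" "i \<in> {1..D}"
  shows "(A *\<^sub>v f) \<bullet> u i = l i * (f \<bullet> v i)"
proof -
  have "(A *\<^sub>v f) \<bullet> u i = u i \<bullet> (A *\<^sub>v f)"
    using assms A u_carrier by (intro comm_scalar_prod[of _ D]) auto
  also have "\<dots> = (A\<^sup>T *\<^sub>v u i) \<bullet> f"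
    using assms A u_carrier by (intro transpose_vec_mult_scalar[symmetric, of _ D P]) auto
  also have "\<dots> = l i * (f \<bullet> v i)"
    using assms v_carrier[of i] by (simp add: At_u comm_scalar_prod[of _ P])
  finally show ?thesis .
qed

lemma diff_A_coord:
  assumes "f \<in> carrier_vec P" "w \<in> carrier_vec D" "i \<in> {1..D}"
  shows "(w - A *\<^sub>v f) \<bullet> u i = w \<bullet> u i - l i * (f \<bullet> v i)"
proof -
  have "(w - A *\<^sub>v f) \<bullet> u i = w \<bullet> u i - (A *\<^sub>v f) \<bullet> u i"
    using assms A u_carrier[of i] by (intro minus_scalar_prod_distrib) auto
  with assms show ?thesis by (simp only: A_coord)
qed

lemma At_coord:
  assumes "w \<in> carrier_vec D" "i \<in> {1..D}"
  shows "(A\<^sup>T *\<^sub>v w) \<bullet> v i = l i * (w \<bullet> u i)"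
proof -
  have "(A\<^sup>T *\<^sub>v w) \<bullet> v i = w \<bullet> (A *\<^sub>v v i)"
    using assms A v_carrier by (intro transpose_vec_mult_scalar[of _ D P]) auto
  then show ?thesis
    using assms u_carrier[of i] by (simp add: A_v)
qed

definition gram_inv :: "real mat" where
  "gram_inv = the (mat_inverse (A * A\<^sup>T))"

lemma gram_coord:
  assumes "w \<in> carrier_vec D" "i \<in> {1..D}"
  shows "(A * A\<^sup>T *\<^sub>v w) \<bullet> u i = (l i)\<^sup>2 * (w \<bullet> u i)"
proof -
  have "A * A\<^sup>T *\<^sub>v w = A *\<^sub>v (A\<^sup>T *\<^sub>v w)"
    by (rule assoc_mult_mat_vec[of _ D P _ D]) (use assms A in auto)
  moreover have "A\<^sup>T *\<^sub>v w \<in> carrier_vec P"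
    using assms A by auto
  ultimately show ?thesis
    using assms by (simp only: A_coord At_coord power2_eq_square mult.assoc)
qed

lemma gram_inv: "gram_inv \<in> carrier_mat D D" "A * A\<^sup>T * gram_inv = 1\<^sub>m D"
proof -
  have G: "A * A\<^sup>T \<in> carrier_mat D D"
    using A by simp
  have "w = 0\<^sub>v D" if w: "w \<in> carrier_vec D" "A * A\<^sup>T *\<^sub>v w = 0\<^sub>v D" for w
  proof (rule eq_0_of_coords[OF w(1)])
    fix i assume i: "i \<in> {1..D}"
    show "w \<bullet> u i = 0"
      using gram_coord[OF w(1) i] u_carrier[OF i] l_pos[OF i] by (simp add: w(2))
  qed
  from mat_inverse_of_injective[OF G this]
  show "gram_inv \<in> carrier_mat D D" "A * A\<^sup>T * gram_inv = 1\<^sub>m D"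
    by (auto simp: gram_inv_def)
qed

lemma pinv_carrier: "pinv A \<in> carrier_mat P D"
  unfolding pinv_def gram_inv_def[symmetric] by (rule mult_carrier_mat[OF _ gram_inv(1)]) (use A in auto)

context
  fixes w :: "real vec"
  assumes w: "w \<in> carrier_vec D"
begin

lemma gram_inv_vec: "gram_inv *\<^sub>v w \<in> carrier_vec D"
  using gram_inv(1) w by (rule mult_mat_vec_carrier)

lemma pinv_eq: "pinv A *\<^sub>v w = A\<^sup>T *\<^sub>v (gram_inv *\<^sub>v w)"
  unfolding pinv_def gram_inv_def[symmetric] by (rule assoc_mult_mat_vec[of _ P D _ D]) (use A gram_inv(1) w in auto)

lemma pinv_vec: "pinv A *\<^sub>v w \<in> carrier_vec P"
  using pinv_carrier w by (rule mult_mat_vec_carrier)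

lemma gram_gram_inv: "A * A\<^sup>T *\<^sub>v (gram_inv *\<^sub>v w) = w"
proof -
  have "A * A\<^sup>T *\<^sub>v (gram_inv *\<^sub>v w) = A * A\<^sup>T * gram_inv *\<^sub>v w"
    by (rule assoc_mult_mat_vec[of _ D D _ D, symmetric]) (use A gram_inv(1) w in auto)
  also have "\<dots> = w"
    unfolding gram_inv(2) using w by simp
  finally show ?thesis .
qed

lemma A_pinv: "A *\<^sub>v (pinv A *\<^sub>v w) = w"
proof -
  have "A *\<^sub>v (pinv A *\<^sub>v w) = A * A\<^sup>T *\<^sub>v (gram_inv *\<^sub>v w)"
    unfolding pinv_eq by (rule assoc_mult_mat_vec[of _ D P _ D, symmetric]) (use A gram_inv_vec in auto)
  then show ?thesis unfolding gram_gram_inv .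
qed

lemma gram_inv_coord:
  assumes i: "i \<in> {1..D}"
  shows "(gram_inv *\<^sub>v w) \<bullet> u i = (w \<bullet> u i) / (l i)\<^sup>2"
proof -
  have "w \<bullet> u i = (l i)\<^sup>2 * ((gram_inv *\<^sub>v w) \<bullet> u i)"
    using gram_coord[OF gram_inv_vec i] unfolding gram_gram_inv .
  then show ?thesis
    using l_pos[OF i] by simp
qed

lemma pinv_coord:
  assumes i: "i \<in> {1..D}"
  shows "(pinv A *\<^sub>v w) \<bullet> v i = (w \<bullet> u i) / l i"
  unfolding pinv_eq At_coord[OF gram_inv_vec i] gram_inv_coord[OF i]
  using l_pos[OF i] by (simp add: power2_eq_square)

text \<open>Moving the transpose to the other factor and cancelling \<open>A\<close> against its
  pseudoinverse leaves a scalar product of dimension \<open>D\<close>, where Parseval is available.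
  No basis of the source space is needed.\<close>

lemma vnorm_pinv: "(vnorm (pinv A *\<^sub>v w))\<^sup>2 = (\<Sum>i=1..D. (w \<bullet> u i)\<^sup>2 / (l i)\<^sup>2)"
proof -
  have "(vnorm (pinv A *\<^sub>v w))\<^sup>2 = (A\<^sup>T *\<^sub>v (gram_inv *\<^sub>v w)) \<bullet> (pinv A *\<^sub>v w)"
    unfolding vnorm_sq pinv_eq ..
  also have "\<dots> = (gram_inv *\<^sub>v w) \<bullet> (A *\<^sub>v (pinv A *\<^sub>v w))"
    using A gram_inv_vec pinv_vec by (intro transpose_vec_mult_scalar[of _ D P]) auto
  also have "\<dots> = (\<Sum>i=1..D. ((gram_inv *\<^sub>v w) \<bullet> u i) * (w \<bullet> u i))"
    unfolding A_pinv using gram_inv_vec w by (rule parseval)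
  also have "\<dots> = (\<Sum>i=1..D. (w \<bullet> u i)\<^sup>2 / (l i)\<^sup>2)"
    by (intro sum.cong refl) (simp only: gram_inv_coord, simp add: power2_eq_square)
  finally show ?thesis .
qed

end

lemma pinv_diff:
  assumes "w \<in> carrier_vec D" "w' \<in> carrier_vec D"
  shows "pinv A *\<^sub>v w - pinv A *\<^sub>v w' = pinv A *\<^sub>v (w - w')"
  using assms pinv_carrier by (intro mult_minus_distrib_mat_vec[symmetric]) auto

lemma prediction_loss_pinv:
  assumes "f \<in> carrier_vec P" "w \<in> carrier_vec D"
  shows "prediction_loss A f (pinv A *\<^sub>v w) = (\<Sum>i=1..D. (w \<bullet> u i - l i * (f \<bullet> v i))\<^sup>2)"
proof -
  have "A *\<^sub>v (pinv A *\<^sub>v w - f) = w - A *\<^sub>v f"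
    using assms A pinv_vec[OF assms(2)] mult_minus_distrib_mat_vec[of A D P "pinv A *\<^sub>v w" f]
    by (simp only: A_pinv)
  then have "prediction_loss A f (pinv A *\<^sub>v w) = (\<Sum>i=1..D. ((w - A *\<^sub>v f) \<bullet> u i)\<^sup>2)"
    unfolding prediction_loss_def using assms A by (simp only:) (intro vnorm_sq_coords, auto)
  also have "\<dots> = (\<Sum>i=1..D. (w \<bullet> u i - l i * (f \<bullet> v i))\<^sup>2)"
    using assms by (intro sum.cong refl) (simp only: diff_A_coord)
  finally show ?thesis .
qed

lemma reconstruction_loss_pinv:
  assumes "f \<in> carrier_vec P" "w \<in> carrier_vec D"
  shows "reconstruction_loss A f (pinv A *\<^sub>v w) = (\<Sum>i=1..D. (w \<bullet> u i - l i * (f \<bullet> v i))\<^sup>2 / (l i)\<^sup>2)"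
proof -
  have "pinv A *\<^sub>v w - pinv A *\<^sub>v (A *\<^sub>v f) = pinv A *\<^sub>v (w - A *\<^sub>v f)"
    using assms A by (intro pinv_diff) auto
  then have "reconstruction_loss A f (pinv A *\<^sub>v w) = (\<Sum>i=1..D. ((w - A *\<^sub>v f) \<bullet> u i)\<^sup>2 / (l i)\<^sup>2)"
    unfolding reconstruction_loss_def min_norm_sol_def using assms A by (simp only:) (intro vnorm_pinv, auto)
  also have "\<dots> = (\<Sum>i=1..D. (w \<bullet> u i - l i * (f \<bullet> v i))\<^sup>2 / (l i)\<^sup>2)"
    using assms by (intro sum.cong refl) (simp only: diff_A_coord)
  finally show ?thesis .
qed

lemma prediction_loss_eq:
  assumes "f \<in> carrier_vec P" "h \<in> carrier_vec P"
  shows "prediction_loss A f h = (\<Sum>i=1..D. (l i)\<^sup>2 * (h \<bullet> v i - f \<bullet> v i)\<^sup>2)"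
proof -
  have "prediction_loss A f h = (\<Sum>i=1..D. ((A *\<^sub>v (h - f)) \<bullet> u i)\<^sup>2)"
    unfolding prediction_loss_def using assms A by (intro vnorm_sq_coords) auto
  also have "\<dots> = (\<Sum>i=1..D. (l i)\<^sup>2 * (h \<bullet> v i - f \<bullet> v i)\<^sup>2)"
  proof (intro sum.cong refl)
    fix i assume i: "i \<in> {1..D}"
    have "(A *\<^sub>v (h - f)) \<bullet> u i = l i * ((h - f) \<bullet> v i)"
      using assms i by (intro A_coord) auto
    also have "(h - f) \<bullet> v i = h \<bullet> v i - f \<bullet> v i"
      using assms v_carrier[OF i] by (intro minus_scalar_prod_distrib) auto
    finally show "((A *\<^sub>v (h - f)) \<bullet> u i)\<^sup>2 = (l i)\<^sup>2 * (h \<bullet> v i - f \<bullet> v i)\<^sup>2"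
      by (simp only: power_mult_distrib)
  qed
  finally show ?thesis .
qed

text \<open>An arbitrary estimator may leave the span of the \<open>v i\<close>; Bessel discards
  that part. Inside the span the minimum-norm solution has the same coefficients as
  \<open>f\<close>.\<close>

lemma reconstruction_loss_ge:
  assumes f: "f \<in> carrier_vec P" and h: "h \<in> carrier_vec P"
  shows "(\<Sum>i=1..D. (h \<bullet> v i - f \<bullet> v i)\<^sup>2) \<le> reconstruction_loss A f h"
proof -
  let ?m = "min_norm_sol A f"
  have m: "?m \<in> carrier_vec P"
    using f A by (simp add: min_norm_sol_def pinv_vec)
  have mv: "?m \<bullet> v i = f \<bullet> v i" if "i \<in> {1..D}" for i
  proof -
    have "?m \<bullet> v i = (A *\<^sub>v f) \<bullet> u i / l i"
      unfolding min_norm_sol_def using f A that by (intro pinv_coord) auto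
    with l_pos[OF that] show ?thesis
      by (simp only: A_coord[OF f that]) simp
  qed
  have "(\<Sum>i=1..D. ((h - ?m) \<bullet> v i)\<^sup>2) \<le> (h - ?m) \<bullet> (h - ?m)"
    using f h m by (intro bessel[of _ _ P]) (auto simp: v_carrier v_orth)
  also have "(\<Sum>i=1..D. ((h - ?m) \<bullet> v i)\<^sup>2) = (\<Sum>i=1..D. (h \<bullet> v i - f \<bullet> v i)\<^sup>2)"
    using h m v_carrier by (intro sum.cong refl) (simp only: minus_scalar_prod_distrib[of _ P] mv)
  finally show ?thesis
    by (simp add: reconstruction_loss_def vnorm_sq)
qed

end

subsection \<open>The balanced oracle\<close>

text \<open>The left-hand side is maximal at \<open>x = a / \<rho>\<close>, with an additional
  factor \<open>exp (- a)\<close>. Without that factor, \<open>y \<le> exp y\<close> at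
  \<open>y = \<rho> * x / a\<close> suffices.\<close>

lemma powr_mult_exp_le:
  fixes a \<rho> x :: real
  assumes "0 < a" "0 < \<rho>" "0 < x"
  shows "x powr a * exp (- (\<rho> * x)) \<le> a powr a * \<rho> powr (- a)"
proof -
  define y where "y = \<rho> * x / a"
  have y: "0 < y" using assms by (simp add: y_def)
  have "y \<le> exp y"
    using exp_ge_add_one_self[of y] by linarith
  then have "y powr a \<le> exp y powr a"
    using y assms by (intro powr_mono2) auto
  also have "\<dots> = exp (\<rho> * x)"
    using assms by (simp add: exp_powr_real y_def)
  finally have "y powr a \<le> exp (\<rho> * x)" .
  then have "y powr a * exp (- (\<rho> * x)) \<le> 1"
    by (simp add: exp_minus divide_simps)
  moreover have "x powr a = (a powr a * \<rho> powr (- a)) * y powr a"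
    using assms by (simp add: y_def powr_divide powr_mult powr_minus divide_simps)
  ultimately show ?thesis
    using mult_left_mono[of "y powr a * exp (- (\<rho> * x))" 1 "a powr a * \<rho> powr (- a)"]
    by (simp add: mult.assoc)
qed

text \<open>\<open>g\<close> and \<open>e\<close> stand for the coefficients of signal and noise
  along the left singular vectors, so the weights are the squared coefficients of the data.\<close>

locale cg_oracle = cg_weights I x "\<lambda>i. (g i + e i)\<^sup>2"
  for I :: "'i set" and x g e :: "'i \<Rightarrow> real"
begin

abbreviation d :: real where "d \<equiv> real (card (x ` I))"

definition approx :: "real \<Rightarrow> real" where
  "approx t = (\<Sum>i\<in>I. trunc (factors t) (x i) * (g i)\<^sup>2) + B (interp t) (interp t)
     - (\<Sum>i\<in>I. trunc (factors t) (x i) * (g i + e i)\<^sup>2)"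

definition stoch :: "real \<Rightarrow> real" where
  "stoch t = (\<Sum>i\<in>I. (1 - trunc (factors t) (x i)) * (e i)\<^sup>2)"

definition \<tau> :: real where
  "\<tau> = Inf {t \<in> {0..d}. approx t \<le> stoch t}"

lemma trunc_factors_bounds:
  assumes "t \<in> {0..d}" "i \<in> I"
  shows "0 \<le> trunc (factors t) (x i)" "trunc (factors t) (x i) \<le> 1"
    "1 - sum_list (factors t) * x i \<le> trunc (factors t) (x i)"
    "trunc (factors t) (x i) \<le> exp (- (sum_list (factors t) * x i))"
  using trunc_bounds[of "factors t" "x i"] factors[of t] x_pos[OF assms(2)] assms(1) by auto

text \<open>The difference of the two errors is the sum of \<open>(g i)^2\<close> at
  \<open>t = 0\<close> and minus the sum of \<open>(e i)^2\<close> at the end. Its continuity makes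
  the infimum attained and the inequality there an equality.\<close>

lemma oracle_balanced: "\<tau> \<in> {0..d}" "approx \<tau> = stoch \<tau>"
proof -
  define F where "F t = approx t - stoch t" for t
  have cont: "continuous_on {0..d} F"
    unfolding F_def approx_def stoch_def B_def
    using x_pos by (intro continuous_intros continuous_on_trunc continuous_on_poly_interp) (auto simp: less_imp_le)
  have end0: "trunc (factors d) (x i) = 0" if "i \<in> I" for i
    using interp_end[OF that] factors(2)[of d] by (simp add: trunc_def)
  have "B (interp d) (interp d) = 0"
    using interp_end by (simp add: B_def)
  then have Fd: "F d \<le> 0"
    using end0 by (simp add: F_def approx_def stoch_def sum_nonneg)
  let ?Z = "{t \<in> {0..d}. approx t \<le> stoch t}"
  have Z: "?Z = {0..d} \<inter> F -` {..0}"
    by (auto simp: F_def)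
  have "closed ?Z"
    unfolding Z by (intro continuous_closed_preimage cont) auto
  moreover have "d \<in> ?Z"
    using Fd by (simp add: F_def)
  moreover have bdd: "bdd_below ?Z"
    by (intro bdd_belowI[of _ 0]) auto
  ultimately have "\<tau> \<in> ?Z"
    unfolding \<tau>_def by (intro closed_contains_Inf) auto
  then show in_d: "\<tau> \<in> {0..d}"
    by simp
  have le: "approx \<tau> \<le> stoch \<tau>"
    using \<open>\<tau> \<in> ?Z\<close> by simp
  have "B (interp 0) (interp 0) = (\<Sum>i\<in>I. (g i + e i)\<^sup>2)"
    using factors(2)[of 0] factors_0 by (simp add: B_def prod_lin_def)
  then have F0: "0 \<le> F 0"
    by (simp add: F_def approx_def stoch_def factors_0 trunc_def prod_lin_def sum_nonneg)
  \<comment> \<open>A strict inequality at the oracle would force a crossing at an earlier point,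
    which would already belong to the set.\<close>
  have "0 \<le> F \<tau>"
  proof (rule ccontr)
    assume neg: "\<not> 0 \<le> F \<tau>"
    then obtain s where s: "0 \<le> s" "s \<le> \<tau>" "F s = 0"
      using IVT2'[of F \<tau> 0 0] F0 in_d continuous_on_subset[OF cont, of "{0..\<tau>}"] by auto
    then have "s \<in> ?Z"
      using in_d by (auto simp: F_def)
    then have "\<tau> \<le> s"
      unfolding \<tau>_def by (intro cInf_lower bdd)
    with s neg show False by auto
  qed
  with le show "approx \<tau> = stoch \<tau>"
    by (simp add: F_def)
qed

lemma approx_le:
  assumes "t \<in> {0..d}"
  shows "approx t \<le> (\<Sum>i\<in>I. exp (- (sum_list (factors t) * x i)) * (g i)\<^sup>2)"
proof -
  have "approx t \<le> (\<Sum>i\<in>I. trunc (factors t) (x i) * (g i)\<^sup>2)"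
    using residual_le[of t] assms by (simp add: approx_def mult.commute)
  also have "\<dots> \<le> (\<Sum>i\<in>I. exp (- (sum_list (factors t) * x i)) * (g i)\<^sup>2)"
    using trunc_factors_bounds[OF assms] by (intro sum_mono mult_right_mono) auto
  finally show ?thesis .
qed

lemma stoch_le:
  assumes "t \<in> {0..d}"
  shows "stoch t \<le> (\<Sum>i\<in>I. min 1 (sum_list (factors t) * x i) * (e i)\<^sup>2)"
  unfolding stoch_def
proof (intro sum_mono mult_right_mono)
  fix i assume "i \<in> I"
  then show "1 - trunc (factors t) (x i) \<le> min 1 (sum_list (factors t) * x i)"
    using trunc_factors_bounds[OF assms, of i] by simp
qed simp

definition pred_err :: "real \<Rightarrow> real" where
  "pred_err t = (\<Sum>i\<in>I. ((1 - poly (interp t) (x i)) * (g i + e i) - g i)\<^sup>2)"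

definition rec_err :: "real \<Rightarrow> real" where
  "rec_err t = (\<Sum>i\<in>I. ((1 - poly (interp t) (x i)) * (g i + e i) - g i)\<^sup>2 / x i)"

text \<open>Holds summand by summand, the difference being minus a square: of
  \<open>p * g - (1 - p) * e\<close> where the truncation keeps the value \<open>p\<close> of the
  polynomial, and of \<open>p * (g + e) + e\<close> where it cuts it to 0.\<close>

lemma pred_err_le:
  assumes t: "t \<in> {0..d}"
  shows "pred_err t \<le> 2 * (approx t + stoch t)"
proof -
  have "pred_err t - 2 * (approx t + stoch t) =
    (\<Sum>i\<in>I. ((1 - poly (interp t) (x i)) * (g i + e i) - g i)\<^sup>2 -
      2 * (trunc (factors t) (x i) * (g i)\<^sup>2 + (g i + e i)\<^sup>2 * poly (interp t) (x i) * poly (interp t) (x i)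
        - trunc (factors t) (x i) * (g i + e i)\<^sup>2 + (1 - trunc (factors t) (x i)) * (e i)\<^sup>2))"
    unfolding pred_err_def approx_def stoch_def B_def
    by (simp add: sum_subtractf sum.distrib sum_distrib_left algebra_simps)
  also have "\<dots> \<le> 0"
  proof (intro sum_nonpos)
    fix i assume i: "i \<in> I"
    have "trunc (factors t) (x i) = poly (interp t) (x i) \<or> trunc (factors t) (x i) = 0"
      using factors(2)[of t] t by (auto simp: trunc_def)
    then show "((1 - poly (interp t) (x i)) * (g i + e i) - g i)\<^sup>2 -
      2 * (trunc (factors t) (x i) * (g i)\<^sup>2 + (g i + e i)\<^sup>2 * poly (interp t) (x i) * poly (interp t) (x i)
        - trunc (factors t) (x i) * (g i + e i)\<^sup>2 + (1 - trunc (factors t) (x i)) * (e i)\<^sup>2) \<le> 0"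
    proof
      assume eq: "trunc (factors t) (x i) = poly (interp t) (x i)"
      define p where "p = poly (interp t) (x i)"
      have "((1 - p) * (g i + e i) - g i)\<^sup>2 -
        2 * (p * (g i)\<^sup>2 + (g i + e i)\<^sup>2 * p * p - p * (g i + e i)\<^sup>2 + (1 - p) * (e i)\<^sup>2) =
        - (p * g i - (1 - p) * e i)\<^sup>2"
        by (simp add: power2_eq_square algebra_simps)
      then show ?thesis
        unfolding eq p_def[symmetric] by simp
    next
      assume eq: "trunc (factors t) (x i) = 0"
      define p where "p = poly (interp t) (x i)"
      have "((1 - p) * (g i + e i) - g i)\<^sup>2 - 2 * ((g i + e i)\<^sup>2 * p * p + (e i)\<^sup>2) =
        - (p * (g i + e i) + e i)\<^sup>2"
        by (simp add: power2_eq_square algebra_simps)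
      then show ?thesis
        unfolding eq p_def[symmetric] by simp
    qed
  qed
  finally show ?thesis by simp
qed

text \<open>The level \<open>\<sigma>\<close> is left free above \<open>\<rho>\<close> because both
  \<open>\<sigma> = s\<close> and \<open>\<sigma> = \<rho>\<close> are used. The inverse of
  \<open>x i\<close> costs at most \<open>\<sigma>\<close> where
  \<open>\<sigma> * x i \<ge> 1\<close>; elsewhere the polynomial agrees with its
  truncation.\<close>

lemma rec_err_le:
  assumes t: "t \<in> {0..d}" and \<sigma>: "sum_list (factors t) \<le> \<sigma>" "0 < \<sigma>"
  shows "rec_err t \<le> \<sigma> * pred_err t + 2 * \<sigma> * stoch t + 2 * (\<Sum>i\<in>{i\<in>I. \<sigma> * x i < 1}. (g i)\<^sup>2 / x i)"
proof -
  let ?h = "\<lambda>i. (1 - poly (interp t) (x i)) * (g i + e i) - g i"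
  let ?T = "\<lambda>i. trunc (factors t) (x i)"
  have "(?h i)\<^sup>2 / x i \<le> \<sigma> * (?h i)\<^sup>2 + 2 * \<sigma> * ((1 - ?T i) * (e i)\<^sup>2) +
      (if \<sigma> * x i < 1 then 2 * ((g i)\<^sup>2 / x i) else 0)" if i: "i \<in> I" for i
  proof -
    have xi: "0 < x i" using x_pos[OF i] .
    have tb: "0 \<le> ?T i" "?T i \<le> 1" "1 - ?T i \<le> sum_list (factors t) * x i"
      using trunc_factors_bounds[OF t i] by auto
    have nn: "0 \<le> 2 * \<sigma> * ((1 - ?T i) * (e i)\<^sup>2)"
      using tb \<sigma> by simp
    show ?thesis
    proof (cases "\<sigma> * x i < 1")
      case False
      then have "1 / x i \<le> \<sigma>"
        using xi by (simp add: divide_simps)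
      then have "1 / x i * (?h i)\<^sup>2 \<le> \<sigma> * (?h i)\<^sup>2"
        by (intro mult_right_mono) auto
      then have "(?h i)\<^sup>2 / x i \<le> \<sigma> * (?h i)\<^sup>2" by simp
      with nn show ?thesis
        unfolding if_not_P[OF False] by linarith
    next
      case True
      have s: "sum_list (factors t) * x i \<le> \<sigma> * x i"
        using \<sigma> xi by (intro mult_right_mono) auto
      then have "?T i = poly (interp t) (x i)"
        using factors[of t] t xi le_less_trans[OF s True] by (simp add: trunc_eq_poly)
      then have h: "?h i = (1 - ?T i) * e i - ?T i * g i"
        by (simp add: algebra_simps)
      have "(?h i)\<^sup>2 \<le> 2 * ((1 - ?T i) * e i)\<^sup>2 + 2 * (?T i * g i)\<^sup>2"
        unfolding h using sum_squares_bound[of "(1 - ?T i) * e i" "- (?T i * g i)"]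
        by (simp add: power2_diff)
      \<comment> \<open>One factor \<open>1 - ?T i\<close> is at most \<open>\<sigma> * x i\<close>
        and cancels the division by \<open>x i\<close>; the other stays and rebuilds
        \<open>stoch\<close>.\<close>
      also have "((1 - ?T i) * e i)\<^sup>2 = (1 - ?T i) * ((1 - ?T i) * (e i)\<^sup>2)"
        by (simp add: power2_eq_square)
      also have "\<dots> \<le> (\<sigma> * x i) * ((1 - ?T i) * (e i)\<^sup>2)"
        using tb s by (intro mult_right_mono) auto
      also have "(?T i * g i)\<^sup>2 \<le> 1 * (g i)\<^sup>2"
        unfolding power_mult_distrib using tb by (intro mult_right_mono power_le_one) auto
      finally have "(?h i)\<^sup>2 \<le> 2 * (\<sigma> * x i * ((1 - ?T i) * (e i)\<^sup>2)) + 2 * (g i)\<^sup>2"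
        by simp
      then have "(?h i)\<^sup>2 / x i \<le> (2 * (\<sigma> * x i * ((1 - ?T i) * (e i)\<^sup>2)) + 2 * (g i)\<^sup>2) / x i"
        using xi by (intro divide_right_mono) auto
      also have "\<dots> = 2 * \<sigma> * ((1 - ?T i) * (e i)\<^sup>2) + 2 * ((g i)\<^sup>2 / x i)"
        using xi by (simp add: add_divide_distrib)
      finally have "(?h i)\<^sup>2 / x i \<le> 2 * \<sigma> * ((1 - ?T i) * (e i)\<^sup>2) + 2 * ((g i)\<^sup>2 / x i)" .
      moreover have "0 \<le> \<sigma> * (?h i)\<^sup>2"
        using \<sigma> by simp
      ultimately show ?thesis
        unfolding if_P[OF True] by linarith
    qed
  qed
  then have "rec_err t \<le> (\<Sum>i\<in>I. \<sigma> * (?h i)\<^sup>2 + 2 * \<sigma> * ((1 - ?T i) * (e i)\<^sup>2) +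
      (if \<sigma> * x i < 1 then 2 * ((g i)\<^sup>2 / x i) else 0))"
    unfolding rec_err_def by (rule sum_mono)
  also have "\<dots> = \<sigma> * pred_err t + 2 * \<sigma> * stoch t + (\<Sum>i\<in>I. if \<sigma> * x i < 1 then 2 * ((g i)\<^sup>2 / x i) else 0)"
    by (simp add: sum.distrib sum_distrib_left pred_err_def stoch_def)
  also have "(\<Sum>i\<in>I. if \<sigma> * x i < 1 then 2 * ((g i)\<^sup>2 / x i) else 0) =
      2 * (\<Sum>i\<in>{i\<in>I. \<sigma> * x i < 1}. (g i)\<^sup>2 / x i)"
    using finite_I by (simp add: sum.If_cases sum_distrib_left Int_def)
  finally show ?thesis .
qed

text \<open>
  With \<open>\<rho> = |r'(0)|\<close> at the oracle, \<open>stoch = approx\<close> is small through its upper bound increasing in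
  \<open>\<rho>\<close> if \<open>\<rho> \<le> s\<close>, and through its upper bound decreasing in \<open>\<rho>\<close> otherwise. In the second case
  the bound of order \<open>\<rho> powr - (1 + 2 * \<mu>)\<close> even compensates the factor \<open>\<rho>\<close> in \<open>rec_err_le\<close>.
\<close>
lemma oracle_bounds:
  assumes \<mu>: "0 < \<mu>" and s: "0 < s" and src: "(\<Sum>i\<in>I. x i powr (- (1 + 2 * \<mu>)) * (g i)\<^sup>2) \<le> R\<^sup>2"
  defines "V \<equiv> \<Sum>i\<in>I. min 1 (s * x i) * (e i)\<^sup>2"
    and "K \<equiv> (1 + 2 * \<mu>) powr (1 + 2 * \<mu>)"
  shows "pred_err \<tau> \<le> 4 * (V + K * R\<^sup>2 * s powr (- (1 + 2 * \<mu>)))"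
    and "rec_err \<tau> \<le> 6 * s * V + (6 * K + 2) * R\<^sup>2 * s powr (- (2 * \<mu>))"
proof -
  let ?a = "1 + 2 * \<mu>"
  define \<rho> where "\<rho> = sum_list (factors \<tau>)"
  have or: "\<tau> \<in> {0..d}" and bal: "approx \<tau> = stoch \<tau>"
    using oracle_balanced by auto
  have V: "0 \<le> V"
    unfolding V_def using s x_pos by (intro sum_nonneg mult_nonneg_nonneg) (auto simp: less_imp_le)
  have K: "0 < K" using \<mu> by (simp add: K_def)
  have pred: "pred_err \<tau> \<le> 4 * stoch \<tau>"
    using pred_err_le[OF or] bal by simp
  have small: "stoch \<tau> \<le> V" if "\<rho> \<le> s"
  proof -
    have "stoch \<tau> \<le> (\<Sum>i\<in>I. min 1 (\<rho> * x i) * (e i)\<^sup>2)"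
      using stoch_le[OF or] by (simp add: \<rho>_def)
    also have "\<dots> \<le> V"
      unfolding V_def
    proof (intro sum_mono mult_right_mono)
      fix i assume "i \<in> I"
      then have "\<rho> * x i \<le> s * x i"
        using that x_pos[of i] by (intro mult_right_mono) auto
      then show "min 1 (\<rho> * x i) \<le> min 1 (s * x i)" by simp
    qed simp
    finally show ?thesis .
  qed
  have large: "stoch \<tau> \<le> K * R\<^sup>2 * \<rho> powr (- ?a)" if "0 < \<rho>"
  proof -
    have "stoch \<tau> \<le> (\<Sum>i\<in>I. exp (- (\<rho> * x i)) * (g i)\<^sup>2)"
      using approx_le[OF or] bal by (simp add: \<rho>_def)
    \<comment> \<open>The exponential is exchanged for the weight \<open>x i powr (- ?a)\<close> of
      the source condition, at the price of \<open>K * \<rho> powr (- ?a)\<close>.\<close>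
    also have "\<dots> \<le> (\<Sum>i\<in>I. (K * \<rho> powr (- ?a)) * (x i powr (- ?a) * (g i)\<^sup>2))"
    proof (intro sum_mono)
      fix i assume i: "i \<in> I"
      have "x i powr ?a * exp (- (\<rho> * x i)) \<le> K * \<rho> powr (- ?a)"
        unfolding K_def using \<mu> that x_pos[OF i] by (intro powr_mult_exp_le) auto
      then have "x i powr (- ?a) * (x i powr ?a * exp (- (\<rho> * x i))) \<le> x i powr (- ?a) * (K * \<rho> powr (- ?a))"
        by (rule mult_left_mono) simp
      also have "x i powr (- ?a) * (x i powr ?a * exp (- (\<rho> * x i))) = exp (- (\<rho> * x i))"
        using x_pos[OF i] powr_add[of "x i" "- ?a" ?a] by (simp flip: mult.assoc)
      finally have "exp (- (\<rho> * x i)) * (g i)\<^sup>2 \<le> x i powr (- ?a) * (K * \<rho> powr (- ?a)) * (g i)\<^sup>2"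
        by (rule mult_right_mono) simp
      then show "exp (- (\<rho> * x i)) * (g i)\<^sup>2 \<le> (K * \<rho> powr (- ?a)) * (x i powr (- ?a) * (g i)\<^sup>2)"
        by (simp only: mult_ac)
    qed
    also have "\<dots> = (K * \<rho> powr (- ?a)) * (\<Sum>i\<in>I. x i powr (- ?a) * (g i)\<^sup>2)"
      by (rule sum_distrib_left[symmetric])
    also have "\<dots> \<le> (K * \<rho> powr (- ?a)) * R\<^sup>2"
      using K src by (intro mult_left_mono) auto
    finally show ?thesis by (simp add: mult_ac)
  qed
  have tail: "(\<Sum>i\<in>{i\<in>I. \<sigma> * x i < 1}. (g i)\<^sup>2 / x i) \<le> R\<^sup>2 * \<sigma> powr (- (2 * \<mu>))" if \<sigma>: "0 < \<sigma>" for \<sigma>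
  proof -
    have "(\<Sum>i\<in>{i\<in>I. \<sigma> * x i < 1}. (g i)\<^sup>2 / x i) \<le>
        (\<Sum>i\<in>{i\<in>I. \<sigma> * x i < 1}. \<sigma> powr (- (2 * \<mu>)) * (x i powr (- ?a) * (g i)\<^sup>2))"
    proof (intro sum_mono)
      fix i assume "i \<in> {i\<in>I. \<sigma> * x i < 1}"
      then have i: "i \<in> I" "\<sigma> * x i < 1" by auto
      have xi: "0 < x i" using x_pos[OF i(1)] .
      \<comment> \<open>This factor, at least 1 on the tail, supplies the powers of
        \<open>x i\<close> that the source condition controls beyond \<open>1 / x i\<close>.\<close>
      have "1 \<le> (\<sigma> * x i) powr (- (2 * \<mu>))"
        using \<sigma> xi i \<mu> powr_mono2'[of "- (2 * \<mu>)" "\<sigma> * x i" 1] by simp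
      then have "1 * (x i powr (- 1) * (g i)\<^sup>2) \<le> (\<sigma> * x i) powr (- (2 * \<mu>)) * (x i powr (- 1) * (g i)\<^sup>2)"
        by (rule mult_right_mono) simp
      also have "\<dots> = \<sigma> powr (- (2 * \<mu>)) * (x i powr (- (2 * \<mu>)) * x i powr (- 1)) * (g i)\<^sup>2"
        using \<sigma> xi by (simp add: powr_mult)
      also have "x i powr (- (2 * \<mu>)) * x i powr (- 1) = x i powr (- ?a)"
        unfolding powr_add[symmetric] by (intro arg_cong[where f = "\<lambda>a. x i powr a"]) simp
      finally show "(g i)\<^sup>2 / x i \<le> \<sigma> powr (- (2 * \<mu>)) * (x i powr (- ?a) * (g i)\<^sup>2)"
        using xi by (simp add: powr_minus divide_inverse mult_ac)
    qed
    also have "\<dots> \<le> (\<Sum>i\<in>I. \<sigma> powr (- (2 * \<mu>)) * (x i powr (- ?a) * (g i)\<^sup>2))"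
      using finite_I by (intro sum_mono2) auto
    also have "\<dots> \<le> \<sigma> powr (- (2 * \<mu>)) * R\<^sup>2"
      unfolding sum_distrib_left[symmetric] using src by (intro mult_left_mono) auto
    finally show ?thesis by (simp add: mult.commute)
  qed
  \<comment> \<open>The 6 consists of 4 from the prediction error and 2 from the stochastic term of
    \<open>rec_err_le\<close>.\<close>
  have rec: "rec_err \<tau> \<le> 6 * \<sigma> * stoch \<tau> + 2 * (R\<^sup>2 * \<sigma> powr (- (2 * \<mu>)))"
    if "\<rho> \<le> \<sigma>" "0 < \<sigma>" for \<sigma>
  proof -
    have "rec_err \<tau> \<le> \<sigma> * pred_err \<tau> + 2 * \<sigma> * stoch \<tau> + 2 * (\<Sum>i\<in>{i\<in>I. \<sigma> * x i < 1}. (g i)\<^sup>2 / x i)"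
      using rec_err_le[OF or] that by (simp add: \<rho>_def)
    also have "\<sigma> * pred_err \<tau> \<le> \<sigma> * (4 * stoch \<tau>)"
      using pred that by (intro mult_left_mono) auto
    finally show ?thesis
      using tail[OF that(2)] by (simp add: algebra_simps)
  qed
  have split: "s * s powr (- ?a) = s powr (- (2 * \<mu>))" if "0 < s" for s :: real
    using that powr_add[of s 1 "- ?a"] by simp
  consider "\<rho> \<le> s" | "s < \<rho>" by linarith
  then have "pred_err \<tau> \<le> 4 * (V + K * R\<^sup>2 * s powr (- ?a)) \<and>
    rec_err \<tau> \<le> 6 * s * V + (6 * K + 2) * R\<^sup>2 * s powr (- (2 * \<mu>))"
  proof cases
    case 1
    have nn: "0 \<le> K * R\<^sup>2 * s powr (- ?a)" "0 \<le> 6 * K * (R\<^sup>2 * s powr (- (2 * \<mu>)))"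
      using K by simp_all
    have "6 * s * stoch \<tau> \<le> 6 * s * V"
      using small[OF 1] s by (intro mult_left_mono) auto
    then show ?thesis
      using pred small[OF 1] rec[OF 1 s] nn by (simp add: algebra_simps)
  next
    case 2
    then have \<rho>: "0 < \<rho>" using s by simp
    have "K * R\<^sup>2 * \<rho> powr (- ?a) \<le> K * R\<^sup>2 * s powr (- ?a)"
      using K 2 s \<mu> by (intro mult_left_mono powr_mono2') auto
    then have P: "pred_err \<tau> \<le> 4 * (V + K * R\<^sup>2 * s powr (- ?a))"
      using pred large[OF \<rho>] V by simp
    have "\<rho> * stoch \<tau> \<le> \<rho> * (K * R\<^sup>2 * \<rho> powr (- ?a))"
      using large[OF \<rho>] \<rho> by (intro mult_left_mono) auto
    also have "\<dots> = K * R\<^sup>2 * \<rho> powr (- (2 * \<mu>))"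
      using split[OF \<rho>] by (simp add: mult_ac)
    finally have "rec_err \<tau> \<le> (6 * K + 2) * R\<^sup>2 * \<rho> powr (- (2 * \<mu>))"
      using rec[OF order_refl \<rho>] by (simp add: algebra_simps)
    also have "\<dots> \<le> (6 * K + 2) * R\<^sup>2 * s powr (- (2 * \<mu>))"
      using K 2 s \<mu> by (intro mult_left_mono powr_mono2') auto
    also have "\<dots> \<le> 6 * s * V + (6 * K + 2) * R\<^sup>2 * s powr (- (2 * \<mu>))"
      using s V by simp
    finally show ?thesis using P by simp
  qed
  then show "pred_err \<tau> \<le> 4 * (V + K * R\<^sup>2 * s powr (- (1 + 2 * \<mu>)))"
    and "rec_err \<tau> \<le> 6 * s * V + (6 * K + 2) * R\<^sup>2 * s powr (- (2 * \<mu>))"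
    by auto
qed

end

subsection \<open>Gaussian noise\<close>

lemma sets_std_gauss [measurable_cong]: "sets (std_gauss D) = sets (\<Pi>\<^sub>M i\<in>{..<D}. borel)"
  unfolding std_gauss_def by (intro sets_PiM_cong) auto

lemma space_std_gauss: "space (std_gauss D) = {..<D} \<rightarrow>\<^sub>E UNIV"
  unfolding std_gauss_def by (simp add: space_PiM)

lemma prob_space_std_gauss: "prob_space (std_gauss D)"
  unfolding std_gauss_def by (intro prob_space_PiM prob_space_normal_density) simp

lemma distributed_std_gauss:
  assumes "j < D"
  shows "distributed (std_gauss D) lborel (\<lambda>z. z j) std_normal_density"
proof -
  have "distr (std_gauss D) lborel (\<lambda>z. z j) = distr (std_gauss D) std_normal_distribution (\<lambda>z. z j)"
    by (intro distr_cong) auto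
  also have "\<dots> = std_normal_distribution"
    unfolding std_gauss_def using assms by (intro distr_PiM_component prob_space_normal_density) auto
  finally show ?thesis
    using assms by (simp add: distributed_def)
qed

lemma indep_vars_std_gauss:
  assumes "0 < D"
  shows "prob_space.indep_vars (std_gauss D) (\<lambda>_. borel) (\<lambda>j z. z j) {..<D}"
proof -
  interpret prob_space "std_gauss D" by (rule prob_space_std_gauss)
  have "distr (std_gauss D) (\<Pi>\<^sub>M j\<in>{..<D}. borel) (\<lambda>z. \<lambda>j\<in>{..<D}. z j) =
      distr (std_gauss D) (std_gauss D) (\<lambda>z. z)"
    by (intro distr_cong) (auto simp: sets_std_gauss space_std_gauss PiE_restrict)
  also have "\<dots> = std_gauss D"
    by (rule distr_id)
  also have "\<dots> = (\<Pi>\<^sub>M j\<in>{..<D}. distr (std_gauss D) borel (\<lambda>z. z j))"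
    unfolding std_gauss_def[of D]
  proof (intro PiM_cong refl)
    fix j assume "j \<in> {..<D}"
    then have "distr (std_gauss D) lborel (\<lambda>z. z j) = std_normal_distribution"
      using distributed_std_gauss[of j D] by (simp add: distributed_def)
    moreover have "distr (std_gauss D) lborel (\<lambda>z. z j) = distr (std_gauss D) borel (\<lambda>z. z j)"
      by (intro distr_cong) auto
    ultimately show "std_normal_distribution =
        distr (\<Pi>\<^sub>M i\<in>{..<D}. std_normal_distribution) borel (\<lambda>z. z j)"
      by (simp add: std_gauss_def)
  qed
  finally show ?thesis
    using assms by (subst indep_vars_iff_distr_eq_PiM') auto
qed

text \<open>The part of rotation invariance that is needed: the noise has standard normal
  coefficients along every unit vector, in particular along each \<open>u i\<close>.\<close>

lemma distributed_unit_combination: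
  assumes c: "(\<Sum>j<D. (c j)\<^sup>2) = 1"
  shows "distributed (std_gauss D) lborel (\<lambda>z. \<Sum>j<D. c j * z j) std_normal_density"
proof -
  interpret prob_space "std_gauss D" by (rule prob_space_std_gauss)
  \<comment> \<open>Zero coefficients are dropped because the sum rule for independent normal
    variables asks for positive standard deviations.\<close>
  let ?J = "{j \<in> {..<D}. c j \<noteq> 0}"
  have sumJ: "(\<Sum>j\<in>?J. (c j)\<^sup>2) = 1" and sumJ': "(\<Sum>j<D. c j * z j) = (\<Sum>j\<in>?J. c j * z j)" for z :: "nat \<Rightarrow> real"
  proof -
    have "(\<Sum>j\<in>?J. (c j)\<^sup>2) = (\<Sum>j<D. (c j)\<^sup>2)"
      by (intro sum.mono_neutral_left) auto
    then show "(\<Sum>j\<in>?J. (c j)\<^sup>2) = 1" using c by simp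
    show "(\<Sum>j<D. c j * z j) = (\<Sum>j\<in>?J. c j * z j)" for z :: "nat \<Rightarrow> real"
      by (intro sum.mono_neutral_right) auto
  qed
  then have ne: "?J \<noteq> {}" by force
  then have D: "0 < D" by auto
  have "indep_vars (\<lambda>_. borel) (\<lambda>j z. z j) ?J"
    by (rule indep_vars_subset[OF indep_vars_std_gauss[OF D]]) auto
  then have ind: "indep_vars (\<lambda>_. borel) (\<lambda>j z. c j * z j) ?J"
    by (rule indep_vars_compose2) auto
  have "distributed (std_gauss D) lborel (\<lambda>z. c j * z j) (normal_density 0 \<bar>c j\<bar>)" if "j \<in> ?J" for j
    using normal_density_affine[OF distributed_std_gauss[of j D], of "c j" 0] that by simp
  then have "distributed (std_gauss D) lborel (\<lambda>z. \<Sum>j\<in>?J. c j * z j)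
      (normal_density (\<Sum>j\<in>?J. 0) (sqrt (\<Sum>j\<in>?J. \<bar>c j\<bar>\<^sup>2)))"
    using ne ind by (intro sum_indep_normal) auto
  then show ?thesis
    by (simp only: sumJ sumJ' power2_abs sum.neutral_const real_sqrt_one)
qed

lemma nn_integral_std_normal_sq: "(\<integral>\<^sup>+x. ennreal (std_normal_density x) * ennreal (x\<^sup>2) \<partial>lborel) = 1"
proof -
  have "has_bochner_integral lborel (\<lambda>x. std_normal_density x * x ^ 2) 1"
    using std_normal_moment_even[of 1] by simp
  then have "(\<integral>\<^sup>+x. ennreal (std_normal_density x * x ^ 2) \<partial>lborel) = ennreal 1"
    by (subst nn_integral_eq_integral) (auto simp: has_bochner_integral_iff)
  then show ?thesis
    by (simp add: ennreal_mult)
qed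

context
  fixes D :: nat and c :: "nat \<Rightarrow> real"
  assumes c: "(\<Sum>j<D. (c j)\<^sup>2) = 1"
begin

lemma nn_integral_unit_combination_sq: "(\<integral>\<^sup>+z. ennreal ((\<Sum>j<D. c j * z j)\<^sup>2) \<partial>std_gauss D) = 1"
  using distributed_nn_integral[OF distributed_unit_combination[OF c], of "\<lambda>x. ennreal (x\<^sup>2)"]
  by (simp add: nn_integral_std_normal_sq)

lemma AE_unit_combination: "AE z in std_gauss D. (\<Sum>j<D. c j * z j) \<noteq> a"
proof -
  have "AE x in lborel. 0 < ennreal (std_normal_density x) \<longrightarrow> x \<noteq> a"
    using AE_lborel_singleton[of a] by eventually_elim auto
  then have "AE x in distr (std_gauss D) lborel (\<lambda>z. \<Sum>j<D. c j * z j). x \<noteq> a"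
    unfolding distributed_distr_eq_density[OF distributed_unit_combination[OF c]]
    by (subst AE_density) auto
  then show ?thesis
    by (subst (asm) AE_distr_iff) (auto intro!: distributed_measurable[OF distributed_unit_combination[OF c]])
qed

end

lemma nn_integral_std_normal_shift:
  assumes [measurable]: "S \<in> sets borel"
  shows "(\<integral>\<^sup>+x. indicator S (x + h) \<partial>std_normal_distribution) =
    (\<integral>\<^sup>+x. indicator S x * ennreal (exp (h * x - h\<^sup>2 / 2)) \<partial>std_normal_distribution)"
proof -
  have "(\<integral>\<^sup>+x. indicator S (x + h) \<partial>std_normal_distribution) =
      (\<integral>\<^sup>+x. ennreal (std_normal_density x) * indicator S (x + h) \<partial>lborel)"
    by (subst nn_integral_density) auto
  also have "\<dots> = (\<integral>\<^sup>+x. ennreal (std_normal_density (x - h)) * indicator S x \<partial>lborel)"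
    by (subst nn_integral_real_affine[where c = 1 and t = "-h"]) auto
  also have "\<dots> = (\<integral>\<^sup>+x. ennreal (std_normal_density x) * (indicator S x * ennreal (exp (h * x - h\<^sup>2 / 2))) \<partial>lborel)"
  proof (intro nn_integral_cong)
    fix x
    have "std_normal_density (x - h) = std_normal_density x * exp (h * x - h\<^sup>2 / 2)"
      by (simp add: std_normal_density_def power2_eq_square algebra_simps add_divide_distrib diff_divide_distrib
          flip: exp_add)
    then show "ennreal (std_normal_density (x - h)) * indicator S x =
        ennreal (std_normal_density x) * (indicator S x * ennreal (exp (h * x - h\<^sup>2 / 2)))"
      by (simp add: ennreal_mult mult_ac)
  qed
  also have "\<dots> = (\<integral>\<^sup>+x. indicator S x * ennreal (exp (h * x - h\<^sup>2 / 2)) \<partial>std_normal_distribution)"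
    by (subst nn_integral_density) auto
  finally show ?thesis .
qed

text \<open>Boxes determine a measure on the product space, and on a box both sides factor into
  one-dimensional shifts. The shifted point is restricted to \<open>{..<D}\<close> because points of
  the product space are \<open>undefined\<close> outside the index set.\<close>

lemma cameron_martin:
  fixes h :: "nat \<Rightarrow> real"
  shows "distr (std_gauss D) (std_gauss D) (\<lambda>z. \<lambda>j\<in>{..<D}. z j + h j) =
    density (std_gauss D) (\<lambda>z. ennreal (exp ((\<Sum>j<D. h j * z j) - (\<Sum>j<D. (h j)\<^sup>2) / 2)))" (is "?P = ?Q")
proof -
  have pN: "prob_space std_normal_distribution"
    by (intro prob_space_normal_density) simp
  then interpret N: prob_space std_normal_distribution .
  interpret F: product_sigma_finite "\<lambda>_::nat. std_normal_distribution"
    by standard (rule N.sigma_finite_measure_axioms[THEN sigma_finite_measure.sigma_finite_countable])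
  have mT[measurable]: "(\<lambda>z. \<lambda>j\<in>{..<D}. z j + h j) \<in> measurable (std_gauss D) (std_gauss D)"
    unfolding measurable_cong_sets[OF sets_std_gauss sets_std_gauss] by measurable
  interpret G: prob_space "std_gauss D" by (rule prob_space_std_gauss)
  show ?thesis
  proof (rule measure_eqI_PiM_finite[where I = "{..<D}" and M = "\<lambda>_. std_normal_distribution"])
    show "sets ?P = sets (\<Pi>\<^sub>M i\<in>{..<D}. std_normal_distribution)"
      "sets ?Q = sets (\<Pi>\<^sub>M i\<in>{..<D}. std_normal_distribution)"
      by (simp_all add: std_gauss_def)
    fix S assume S: "\<And>j. j \<in> {..<D} \<Longrightarrow> S j \<in> sets std_normal_distribution"
    then have S': "\<And>j. j < D \<Longrightarrow> S j \<in> sets borel" by simp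
    have box: "Pi\<^sub>E {..<D} S \<in> sets (std_gauss D)"
      unfolding std_gauss_def using S by (intro sets_PiM_I_finite) auto
    have "emeasure ?P (Pi\<^sub>E {..<D} S) = (\<integral>\<^sup>+z. indicator (Pi\<^sub>E {..<D} S) (\<lambda>j\<in>{..<D}. z j + h j) \<partial>std_gauss D)"
    proof -
      have "emeasure ?P (Pi\<^sub>E {..<D} S) = (\<integral>\<^sup>+z. indicator (Pi\<^sub>E {..<D} S) z \<partial>?P)"
        using box by simp
      also have "\<dots> = (\<integral>\<^sup>+z. indicator (Pi\<^sub>E {..<D} S) (\<lambda>j\<in>{..<D}. z j + h j) \<partial>std_gauss D)"
        using box by (intro nn_integral_distr) auto
      finally show ?thesis .
    qed
    also have "\<dots> = (\<integral>\<^sup>+z. (\<Prod>j<D. indicator (S j) (z j + h j)) \<partial>std_gauss D)"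
    proof (intro nn_integral_cong)
      fix z :: "nat \<Rightarrow> real"
      show "indicator (Pi\<^sub>E {..<D} S) (\<lambda>j\<in>{..<D}. z j + h j) = (\<Prod>j<D. indicator (S j) (z j + h j) :: ennreal)"
        by (auto simp: indicator_def PiE_iff prod_zero_iff)
    qed
    also have "\<dots> = (\<Prod>j<D. \<integral>\<^sup>+x. indicator (S j) (x + h j) \<partial>std_normal_distribution)"
      unfolding std_gauss_def using S' by (intro F.product_nn_integral_prod) auto
    also have "\<dots> = (\<Prod>j<D. \<integral>\<^sup>+x. indicator (S j) x * ennreal (exp (h j * x - (h j)\<^sup>2 / 2)) \<partial>std_normal_distribution)"
      using S' by (intro prod.cong refl nn_integral_std_normal_shift) auto
    also have "\<dots> = (\<integral>\<^sup>+z. (\<Prod>j<D. indicator (S j) (z j) * ennreal (exp (h j * z j - (h j)\<^sup>2 / 2))) \<partial>std_gauss D)"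
      unfolding std_gauss_def using S' by (intro F.product_nn_integral_prod[symmetric]) auto
    also have "\<dots> = (\<integral>\<^sup>+z. ennreal (exp ((\<Sum>j<D. h j * z j) - (\<Sum>j<D. (h j)\<^sup>2) / 2)) * indicator (Pi\<^sub>E {..<D} S) z \<partial>std_gauss D)"
    proof (intro nn_integral_cong)
      fix z assume "z \<in> space (std_gauss D)"
      then have "indicator (Pi\<^sub>E {..<D} S) z = (\<Prod>j<D. indicator (S j) (z j) :: ennreal)"
        by (auto simp: indicator_def space_std_gauss PiE_iff prod_zero_iff)
      moreover have "(\<Prod>j<D. ennreal (exp (h j * z j - (h j)\<^sup>2 / 2))) =
          ennreal (exp ((\<Sum>j<D. h j * z j) - (\<Sum>j<D. (h j)\<^sup>2) / 2))"
        by (simp add: prod_ennreal exp_sum[symmetric] sum_subtractf sum_divide_distrib)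
      ultimately show "(\<Prod>j<D. indicator (S j) (z j) * ennreal (exp (h j * z j - (h j)\<^sup>2 / 2))) =
          ennreal (exp ((\<Sum>j<D. h j * z j) - (\<Sum>j<D. (h j)\<^sup>2) / 2)) * indicator (Pi\<^sub>E {..<D} S) z"
        by (simp add: prod.distrib mult.commute)
    qed
    also have "\<dots> = emeasure ?Q (Pi\<^sub>E {..<D} S)"
      using box by (intro emeasure_density[symmetric]) auto
    finally show "emeasure ?P (Pi\<^sub>E {..<D} S) = emeasure ?Q (Pi\<^sub>E {..<D} S)" .
  next
    have sp: "space (std_gauss D) = Pi\<^sub>E {..<D} (\<lambda>_. UNIV)"
      by (rule space_std_gauss)
    show "range (\<lambda>_::nat. space (std_gauss D)) \<subseteq> prod_algebra {..<D} (\<lambda>_. std_normal_distribution)"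
      unfolding sp by (auto intro!: prod_algebraI_finite)
    show "(\<Union>i::nat. space (std_gauss D)) = space (\<Pi>\<^sub>M i\<in>{..<D}. std_normal_distribution)"
      by (simp add: std_gauss_def)
    have "prob_space ?P"
      by (rule G.prob_space_distr) fact
    then show "emeasure ?P (space (std_gauss D)) \<noteq> \<infinity>"
      using prob_space.emeasure_space_1[of ?P] by simp
  qed auto
qed

text \<open>Both shifted laws are compared with the centred one, where \<open>exp (- \<bar>x\<bar>) \<ge> (1 - x\<^sup>2) / 2\<close> bounds the overlap.\<close>
lemma two_point_bound:
  fixes G1 G2 :: "(nat \<Rightarrow> real) \<Rightarrow> ennreal"
  assumes c: "(\<Sum>j<D. (c j)\<^sup>2) = 1" and \<kappa>: "\<bar>\<kappa>\<bar> \<le> 1 / 2" and b: "0 \<le> b"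
    and [measurable]: "G1 \<in> borel_measurable (\<Pi>\<^sub>M i\<in>{..<D}. borel)" "G2 \<in> borel_measurable (\<Pi>\<^sub>M i\<in>{..<D}. borel)"
    and ge: "\<And>y. y \<in> space (std_gauss D) \<Longrightarrow> ennreal b \<le> G1 y + G2 y"
  shows "ennreal (b / 4) \<le> (\<integral>\<^sup>+z. G1 (\<lambda>j\<in>{..<D}. z j + \<kappa> * c j) \<partial>std_gauss D) +
    (\<integral>\<^sup>+z. G2 (\<lambda>j\<in>{..<D}. z j - \<kappa> * c j) \<partial>std_gauss D)"
proof -
  interpret prob_space "std_gauss D" by (rule prob_space_std_gauss)
  have mT[measurable]: "(\<lambda>z. \<lambda>j\<in>{..<D}. z j + h j) \<in> measurable (std_gauss D) (std_gauss D)" for h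
    unfolding measurable_cong_sets[OF sets_std_gauss sets_std_gauss] by measurable
  have mG: "G1 \<in> borel_measurable (std_gauss D)" "G2 \<in> borel_measurable (std_gauss D)"
    by measurable
  define X where "X z = (\<Sum>j<D. c j * z j)" for z :: "nat \<Rightarrow> real"
  have [measurable]: "X \<in> borel_measurable (std_gauss D)"
    unfolding X_def by measurable
  have shift: "(\<integral>\<^sup>+z. G (\<lambda>j\<in>{..<D}. z j + s * c j) \<partial>std_gauss D) =
      (\<integral>\<^sup>+z. ennreal (exp (s * X z - s\<^sup>2 / 2)) * G z \<partial>std_gauss D)"
    if G: "G \<in> borel_measurable (std_gauss D)" for G :: "(nat \<Rightarrow> real) \<Rightarrow> ennreal" and s
  proof -
    have "(\<integral>\<^sup>+z. G (\<lambda>j\<in>{..<D}. z j + s * c j) \<partial>std_gauss D) =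
        (\<integral>\<^sup>+z. G z \<partial>distr (std_gauss D) (std_gauss D) (\<lambda>z. \<lambda>j\<in>{..<D}. z j + s * c j))"
      using G by (subst nn_integral_distr) auto
    also have "\<dots> = (\<integral>\<^sup>+z. ennreal (exp ((\<Sum>j<D. s * c j * z j) - (\<Sum>j<D. (s * c j)\<^sup>2) / 2)) * G z \<partial>std_gauss D)"
      unfolding cameron_martin using G by (subst nn_integral_density) auto
    also have "(\<Sum>j<D. (s * c j)\<^sup>2) = s\<^sup>2"
      using c by (simp add: power_mult_distrib flip: sum_distrib_left)
    finally show ?thesis
      by (simp only: X_def sum_distrib_left mult.assoc)
  qed
  have k2: "\<kappa>\<^sup>2 \<le> 1 / 4"
    using power_mono[OF \<kappa>, of 2] by (simp add: power2_eq_square)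
  \<comment> \<open>A common lower bound for the densities of both shifted laws; 7/8 bounds
    \<open>exp (- (\<kappa>\<^sup>2 / 2))\<close> from below, as
    \<open>\<kappa>\<^sup>2 \<le> 1 / 4\<close>.\<close>
  define E where "E z = ennreal (7 / 8 * exp (- \<bar>\<kappa> * X z\<bar>))" for z
  have [measurable]: "E \<in> borel_measurable (std_gauss D)"
    unfolding E_def by measurable
  have E_le: "E z \<le> ennreal (exp (s * X z - s\<^sup>2 / 2))" if "s = \<kappa> \<or> s = - \<kappa>" for s z
  proof -
    have "7 / 8 \<le> 1 + - (\<kappa>\<^sup>2 / 2)" using k2 by simp
    also have "\<dots> \<le> exp (- (\<kappa>\<^sup>2 / 2))" by (rule exp_ge_add_one_self)
    finally have "7 / 8 * exp (- \<bar>\<kappa> * X z\<bar>) \<le> exp (- (\<kappa>\<^sup>2 / 2)) * exp (- \<bar>\<kappa> * X z\<bar>)"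
      by (intro mult_right_mono) auto
    also have "\<dots> \<le> exp (s * X z - s\<^sup>2 / 2)"
      unfolding exp_add[symmetric] using that by auto
    finally show ?thesis unfolding E_def by (rule ennreal_leI)
  qed
  have "(\<integral>\<^sup>+z. ennreal (1 / 2) \<partial>std_gauss D) \<le>
      (\<integral>\<^sup>+z. ennreal (8 / 7) * E z + ennreal (\<kappa>\<^sup>2 / 2) * ennreal ((X z)\<^sup>2) \<partial>std_gauss D)"
  proof (intro nn_integral_mono)
    fix z
    define y where "y = \<bar>\<kappa> * X z\<bar>"
    have "1 - y \<le> exp (- y)"
      using exp_ge_add_one_self[of "- y"] by simp
    moreover have "0 \<le> (1 - y)\<^sup>2" by simp
    ultimately have "1 / 2 \<le> exp (- y) + y\<^sup>2 / 2"
      by (simp add: power2_diff)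
    also have "y\<^sup>2 = \<kappa>\<^sup>2 * (X z)\<^sup>2"
      by (simp add: y_def power_mult_distrib)
    finally have "ennreal (1 / 2) \<le> ennreal (8 / 7 * (7 / 8 * exp (- y)) + \<kappa>\<^sup>2 / 2 * (X z)\<^sup>2)"
      by (intro ennreal_leI) simp
    also have "\<dots> = ennreal (8 / 7) * E z + ennreal (\<kappa>\<^sup>2 / 2) * ennreal ((X z)\<^sup>2)"
      unfolding E_def y_def[symmetric] by (simp only: ennreal_plus ennreal_mult' zero_le_mult_iff zero_le_power2, simp add: ennreal_mult'[symmetric] ennreal_plus[symmetric] del: ennreal_plus)
    finally show "ennreal (1 / 2) \<le> ennreal (8 / 7) * E z + ennreal (\<kappa>\<^sup>2 / 2) * ennreal ((X z)\<^sup>2)" .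
  qed
  also have "\<dots> = ennreal (8 / 7) * (\<integral>\<^sup>+z. E z \<partial>std_gauss D) + ennreal (\<kappa>\<^sup>2 / 2)"
    using nn_integral_unit_combination_sq[OF c]
    by (simp add: nn_integral_add nn_integral_cmult X_def[symmetric])
  also have "\<dots> \<le> ennreal (8 / 7) * (\<integral>\<^sup>+z. E z \<partial>std_gauss D) + ennreal (1 / 8)"
    using k2 by (intro add_left_mono ennreal_leI) simp
  finally have half: "ennreal (1 / 2) \<le> ennreal (8 / 7) * (\<integral>\<^sup>+z. E z \<partial>std_gauss D) + ennreal (1 / 8)"
    by (simp add: emeasure_space_1)
  \<comment> \<open>\<open>X\<close> has second moment 1, so \<open>half\<close> leaves 7/8 times
    3/8, that is 21/64, for the integral of \<open>E\<close>.\<close>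
  have "ennreal (1 / 4) \<le> (\<integral>\<^sup>+z. E z \<partial>std_gauss D)"
  proof (cases "\<integral>\<^sup>+z. E z \<partial>std_gauss D")
    case (real r)
    have "ennreal (8 / 7 * r + 1 / 8) = ennreal (8 / 7) * ennreal r + ennreal (1 / 8)"
      using real(1) by (subst ennreal_plus) (auto simp: ennreal_mult[symmetric])
    then have "ennreal (1 / 2) \<le> ennreal (8 / 7 * r + 1 / 8)"
      using half by (simp only: real(2))
    then have "1 / 2 \<le> 8 / 7 * r + 1 / 8"
      using real(1) by (subst (asm) ennreal_le_iff) auto
    then show ?thesis
      unfolding real(2) by (intro ennreal_leI) simp
  qed simp
  then have "ennreal b * ennreal (1 / 4) \<le> ennreal b * (\<integral>\<^sup>+z. E z \<partial>std_gauss D)"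
    by (rule mult_left_mono) simp
  also have "\<dots> = (\<integral>\<^sup>+z. ennreal b * E z \<partial>std_gauss D)"
    by (subst nn_integral_cmult) auto
  also have "\<dots> \<le> (\<integral>\<^sup>+z. E z * G1 z + E z * G2 z \<partial>std_gauss D)"
    using ge by (intro nn_integral_mono) (simp add: distrib_left[symmetric] mult.commute mult_left_mono)
  also have "\<dots> = (\<integral>\<^sup>+z. E z * G1 z \<partial>std_gauss D) + (\<integral>\<^sup>+z. E z * G2 z \<partial>std_gauss D)"
    by (rule nn_integral_add) measurable
  also have "\<dots> \<le> (\<integral>\<^sup>+z. ennreal (exp (\<kappa> * X z - \<kappa>\<^sup>2 / 2)) * G1 z \<partial>std_gauss D) +
      (\<integral>\<^sup>+z. ennreal (exp ((- \<kappa>) * X z - (- \<kappa>)\<^sup>2 / 2)) * G2 z \<partial>std_gauss D)"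
    by (intro add_mono nn_integral_mono mult_right_mono E_le) auto
  also have "\<dots> = (\<integral>\<^sup>+z. G1 (\<lambda>j\<in>{..<D}. z j + \<kappa> * c j) \<partial>std_gauss D) +
      (\<integral>\<^sup>+z. G2 (\<lambda>j\<in>{..<D}. z j + (- \<kappa>) * c j) \<partial>std_gauss D)"
    unfolding shift[OF mG(1)] shift[OF mG(2)] ..
  finally show ?thesis
    using b by (simp add: ennreal_mult'[symmetric])
qed

subsection \<open>From coordinates to the model\<close>

text \<open>One realisation of the model. \<open>nonzero\<close> makes the weights positive; it asks
  for every single coefficient of the data, which is stronger than the standing assumption on
  eigenspaces but still holds almost surely. Multiple singular values appear as repeated
  nodes.\<close>

locale cg_model = svd +
  fixes f \<xi> :: "real vec"
  assumes f: "f \<in> carrier_vec P" and \<xi>: "\<xi> \<in> carrier_vec D"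
    and nonzero: "i \<in> {1..D} \<Longrightarrow> l i * (f \<bullet> v i) + \<xi> \<bullet> u i \<noteq> 0"
begin

sublocale cg_oracle "{1..D}" "\<lambda>i. (l i)\<^sup>2" "\<lambda>i. l i * (f \<bullet> v i)" "\<lambda>i. \<xi> \<bullet> u i"
proof
  show "0 < (l i)\<^sup>2" if "i \<in> {1..D}" for i
    using l_pos[OF that] by simp
  show "0 < (l i * (f \<bullet> v i) + \<xi> \<bullet> u i)\<^sup>2" if "i \<in> {1..D}" for i
    using nonzero[OF that] by simp
qed simp

definition Y :: "real vec" where
  "Y = A *\<^sub>v f + \<xi>"

lemma Y: "Y \<in> carrier_vec D"
  using A f \<xi> by (simp add: Y_def)

lemma Y_coord:
  assumes i: "i \<in> {1..D}"
  shows "Y \<bullet> u i = l i * (f \<bullet> v i) + \<xi> \<bullet> u i"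
proof -
  have "Y \<bullet> u i = (A *\<^sub>v f) \<bullet> u i + \<xi> \<bullet> u i"
    unfolding Y_def using A f \<xi> u_carrier[OF i] by (intro add_scalar_prod_distrib) auto
  then show ?thesis
    by (simp only: A_coord[OF f i])
qed

lemma num_distinct_eq: "num_distinct A l = card ((\<lambda>i. (l i)\<^sup>2) ` {1..D})"
proof -
  have "card ((\<lambda>y. y\<^sup>2) ` (l ` {1..D})) = card (l ` {1..D})"
  proof (rule card_image, rule inj_onI)
    fix y z assume yz: "y \<in> l ` {1..D}" "z \<in> l ` {1..D}" "y\<^sup>2 = z\<^sup>2"
    then have "0 < y" "0 < z"
      using l_pos by auto
    with yz(3) show "y = z"
      by (simp add: power2_eq_iff_nonneg)
  qed
  then show ?thesis
    unfolding num_distinct_def dims image_image by (rule sym)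
qed

lemma residual_B: "(vnorm (apply_AAT A l u (poly p) Y))\<^sup>2 = B p p"
  unfolding vnorm_apply_AAT B_def
  by (intro sum.cong refl) (simp only: Y_coord, simp add: power2_eq_square)

lemma cg_poly_eq:
  assumes "k \<le> num_distinct A l"
  shows "cg_poly A l u Y k = cg k"
  unfolding cg_poly_def residual_B
    is_arg_min_cg[OF is_cg_cg assms[unfolded num_distinct_eq]] by simp

lemma cg_interp_eq:
  assumes "t \<in> {0..real (num_distinct A l)}"
  shows "cg_interp A l u Y t = interp t"
proof (cases "t \<le> 0")
  case True
  then show ?thesis
    by (simp add: cg_interp_def interp_def cg_poly_eq del: One_nat_def)
next
  case False
  then have "Suc (nat (\<lceil>t\<rceil> - 1)) \<le> num_distinct A l"
    using assms by auto linarith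
  with False show ?thesis
    by (simp add: cg_interp_def interp_def cg_poly_eq Let_def del: One_nat_def)
qed

text \<open>The largest \<open>b\<close> belongs to the smallest zero \<open>1 / b\<close>, and for
  \<open>y \<ge> 0\<close> it alone decides whether \<open>y\<close> lies before all zeros. At
  \<open>t = 0\<close> both sides are 1 by convention.\<close>

lemma cg_trunc_eq:
  assumes t: "t \<in> {0..real (num_distinct A l)}" and y: "0 \<le> y"
  shows "cg_trunc A l u Y t y = trunc (factors t) y"
proof (cases "t = 0")
  case True
  then show ?thesis
    by (simp add: cg_trunc_def factors_0 trunc_def prod_lin_def del: One_nat_def)
next
  case False
  define bs where "bs = factors t"
  have bs: "\<forall>b\<in>set bs. 0 < b" "interp t = prod_lin bs" "bs \<noteq> []"
    using factors[of t] factors_nonempty[of t] t False by (auto simp: bs_def num_distinct_eq)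
  define b where "b = Max (set bs)"
  have b: "b \<in> set bs" "\<And>c. c \<in> set bs \<Longrightarrow> c \<le> b"
    using bs(3) by (auto simp: b_def)
  have b0: "0 < b" using b(1) bs(1) by simp
  have root: "poly (prod_lin bs) z = 0 \<longleftrightarrow> (\<exists>c\<in>set bs. c * z = 1)" for z
    by (auto simp: poly_prod_lin prod_list_zero_iff)
  have "first_zero A l u Y t = 1 / b"
    unfolding first_zero_def cg_interp_eq[OF t] bs(2)
  proof (rule Least_equality)
    show "0 \<le> 1 / b \<and> poly (prod_lin bs) (1 / b) = 0"
      unfolding root using b(1) b0 by auto
    fix z assume z: "0 \<le> z \<and> poly (prod_lin bs) z = 0"
    then obtain c where c: "c \<in> set bs" "c * z = 1"
      using root by blast
    then have "1 \<le> b * z"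
      using mult_right_mono[OF b(2)[OF c(1)], of z] z by simp
    then show "1 / b \<le> z"
      using b0 by (simp add: divide_simps mult.commute)
  qed
  moreover have "y < 1 / b \<longleftrightarrow> (\<forall>c\<in>set bs. c * y < 1)"
  proof
    assume "y < 1 / b"
    then have "b * y < 1"
      using b0 by (simp add: field_simps)
    then show "\<forall>c\<in>set bs. c * y < 1"
      using mult_right_mono[OF b(2) y] by force
  next
    assume "\<forall>c\<in>set bs. c * y < 1"
    then show "y < 1 / b"
      using b(1) b0 by (simp add: field_simps)
  qed
  ultimately show ?thesis
    using False t unfolding cg_trunc_def trunc_def bs_def[symmetric] cg_interp_eq[OF t] bs(2)
    by (simp del: One_nat_def)
qed

lemma cg_trunc_sq:
  assumes "t \<in> {0..real (num_distinct A l)}" "i \<in> {1..D}"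
  shows "cg_trunc A l u Y t ((l i)\<^sup>2) = trunc (factors t) ((l i)\<^sup>2)"
  by (rule cg_trunc_eq[OF assms(1)]) simp

lemma cg_est_eq: "cg_est A l u Y t = pinv A *\<^sub>v (Y - apply_AAT A l u (poly (cg_interp A l u Y t)) Y)"
  by (simp add: cg_est_def)

lemma residual_carrier: "Y - apply_AAT A l u h Y \<in> carrier_vec D"
  using Y by simp

lemma residual_sq_eq:
  assumes t: "t \<in> {0..real (num_distinct A l)}"
  shows "residual_sq A l u Y t = B (interp t) (interp t)"
proof -
  let ?r = "apply_AAT A l u (poly (interp t)) Y"
  have "A *\<^sub>v cg_est A l u Y t - Y = (Y - ?r) - Y"
    unfolding cg_est_eq cg_interp_eq[OF t] A_pinv[OF residual_carrier] ..
  also have "(Y - r) - Y = - r" if "r \<in> carrier_vec D" for r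
    using Y that by (intro eq_vecI) auto
  note this[OF apply_AAT_carrier]
  finally show ?thesis
    unfolding residual_sq_def residual_B[symmetric] by (simp add: vnorm_uminus[OF apply_AAT_carrier])
qed

lemma stoch_err_eq:
  assumes t: "t \<in> {0..real (num_distinct A l)}"
  shows "stoch_err A l u f \<xi> t = stoch t"
proof -
  have td: "t \<in> {0..d}"
    using t by (simp add: num_distinct_eq)
  show ?thesis
    unfolding stoch_err_def Let_def Y_def[symmetric] vnorm_apply_AAT stoch_def
  proof (intro sum.cong refl)
    fix i assume i: "i \<in> {1..D}"
    \<comment> \<open>The square undoes the root only because the truncation is at most 1:
      \<open>sqrt\<close> of a negative number is negative here, and its square would have the wrong
      sign.\<close>
    show "(sqrt (1 - cg_trunc A l u Y t ((l i)\<^sup>2)))\<^sup>2 * (\<xi> \<bullet> u i)\<^sup>2 =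
        (1 - trunc (factors t) ((l i)\<^sup>2)) * (\<xi> \<bullet> u i)\<^sup>2"
      unfolding cg_trunc_sq[OF t i] using trunc_factors_bounds(2)[OF td i] by simp
  qed
qed

lemma approx_err_eq:
  assumes t: "t \<in> {0..real (num_distinct A l)}"
  shows "approx_err A l u f \<xi> t = approx t"
proof -
  have td: "t \<in> {0..d}"
    using t by (simp add: num_distinct_eq)
  have "(vnorm (apply_AAT A l u (\<lambda>y. sqrt (cg_trunc A l u Y t y)) w))\<^sup>2 =
      (\<Sum>i=1..D. trunc (factors t) ((l i)\<^sup>2) * (w \<bullet> u i)\<^sup>2)" for w
    unfolding vnorm_apply_AAT
  proof (intro sum.cong refl)
    fix i assume i: "i \<in> {1..D}"
    show "(sqrt (cg_trunc A l u Y t ((l i)\<^sup>2)))\<^sup>2 * (w \<bullet> u i)\<^sup>2 = trunc (factors t) ((l i)\<^sup>2) * (w \<bullet> u i)\<^sup>2"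
      unfolding cg_trunc_sq[OF t i] using trunc_factors_bounds(1)[OF td i] by simp
  qed
  moreover have "(\<Sum>i=1..D. trunc (factors t) ((l i)\<^sup>2) * (Y \<bullet> u i)\<^sup>2) =
      (\<Sum>i=1..D. trunc (factors t) ((l i)\<^sup>2) * (l i * (f \<bullet> v i) + \<xi> \<bullet> u i)\<^sup>2)"
    by (intro sum.cong refl) (simp only: Y_coord)
  moreover have "(\<Sum>i=1..D. trunc (factors t) ((l i)\<^sup>2) * ((A *\<^sub>v f) \<bullet> u i)\<^sup>2) =
      (\<Sum>i=1..D. trunc (factors t) ((l i)\<^sup>2) * (l i * (f \<bullet> v i))\<^sup>2)"
    by (intro sum.cong refl) (simp only: A_coord[OF f])
  ultimately show ?thesis
    unfolding approx_err_def Let_def Y_def[symmetric] residual_sq_eq[OF t] approx_def by simp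
qed

lemma balanced_oracle_eq: "balanced_oracle A l u f \<xi> = \<tau>"
proof -
  have "{t \<in> {0..real (num_distinct A l)}. approx_err A l u f \<xi> t \<le> stoch_err A l u f \<xi> t} =
      {t \<in> {0..d}. approx t \<le> stoch t}"
    by (intro Collect_cong conj_cong) (simp_all only: num_distinct_eq approx_err_eq stoch_err_eq)
  then show ?thesis
    by (simp only: balanced_oracle_def \<tau>_def)
qed

lemma losses_eq:
  shows "prediction_loss A f (cg_est A l u Y \<tau>) = pred_err \<tau>"
    and "reconstruction_loss A f (cg_est A l u Y \<tau>) = rec_err \<tau>"
proof -
  have t: "\<tau> \<in> {0..real (num_distinct A l)}"
    using oracle_balanced by (simp add: num_distinct_eq)
  have coord: "(Y - apply_AAT A l u (poly (interp \<tau>)) Y) \<bullet> u i =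
      (1 - poly (interp \<tau>) ((l i)\<^sup>2)) * (l i * (f \<bullet> v i) + \<xi> \<bullet> u i)" if i: "i \<in> {1..D}" for i
  proof -
    have "(Y - apply_AAT A l u (poly (interp \<tau>)) Y) \<bullet> u i = Y \<bullet> u i - apply_AAT A l u (poly (interp \<tau>)) Y \<bullet> u i"
      using Y u_carrier[OF i] by (intro minus_scalar_prod_distrib) auto
    then show ?thesis
      by (simp only: apply_AAT_coord[OF i] Y_coord[OF i]) (simp add: left_diff_distrib)
  qed
  show "prediction_loss A f (cg_est A l u Y \<tau>) = pred_err \<tau>"
    unfolding cg_est_eq cg_interp_eq[OF t] prediction_loss_pinv[OF f residual_carrier] pred_err_def
    by (intro sum.cong refl) (simp only: coord)
  show "reconstruction_loss A f (cg_est A l u Y \<tau>) = rec_err \<tau>"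
    unfolding cg_est_eq cg_interp_eq[OF t] reconstruction_loss_pinv[OF f residual_carrier] rec_err_def
    by (intro sum.cong refl) (simp only: coord)
qed

end

section \<open>Averaging the pathwise bounds over the noise\<close>

context svd
begin

text \<open>In terms of the nodes \<open>(l i)\<^sup>2\<close> and the coefficients of
  \<open>A *\<^sub>v f\<close> the exponent becomes \<open>- (1 + 2 * \<mu>)\<close>, the extra 1
  compensating the factor \<open>l i\<close> that \<open>A\<close> introduces.\<close>

lemma source_sum:
  assumes f: "f \<in> carrier_vec P" and "0 \<le> R" "source_norm A l v \<mu> f \<le> R"
  shows "(\<Sum>i=1..D. (l i)\<^sup>2 powr (- (1 + 2 * \<mu>)) * (l i * (f \<bullet> v i))\<^sup>2) \<le> R\<^sup>2"
proof -
  have "(\<Sum>i=1..D. (l i)\<^sup>2 powr (- (1 + 2 * \<mu>)) * (l i * (f \<bullet> v i))\<^sup>2) =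
      (\<Sum>i=1..D. (l i) powr (-4 * \<mu>) * (f \<bullet> v i)\<^sup>2)"
  proof (intro sum.cong refl)
    fix i assume i: "i \<in> {1..D}"
    have "(l i)\<^sup>2 powr (- (1 + 2 * \<mu>)) * (l i)\<^sup>2 = l i powr (2 * - (1 + 2 * \<mu>)) * l i powr 2"
      using l_pos[OF i] by (simp add: powr_powr flip: powr_numeral)
    also have "\<dots> = l i powr (2 * - (1 + 2 * \<mu>) + 2)"
      by (rule powr_add[symmetric])
    also have "2 * - (1 + 2 * \<mu>) + 2 = -4 * \<mu>"
      by simp
    finally show "(l i)\<^sup>2 powr (- (1 + 2 * \<mu>)) * (l i * (f \<bullet> v i))\<^sup>2 = (l i) powr (-4 * \<mu>) * (f \<bullet> v i)\<^sup>2"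
      by (simp only: power_mult_distrib mult.assoc[symmetric])
  qed
  also have "\<dots> = (source_norm A l v \<mu> f)\<^sup>2"
    unfolding source_norm_def dims by (simp add: sum_nonneg)
  also have "\<dots> \<le> R\<^sup>2"
    using assms by (intro power_mono) (auto simp: source_norm_def sum_nonneg)
  finally show ?thesis .
qed

lemma noise_coord:
  assumes "i \<in> {1..D}"
  shows "noise D \<delta> z \<bullet> u i = \<delta> * (\<Sum>j<D. u i $ j * z j)"
  using carrier_vecD[OF u_carrier[OF assms]]
  by (simp add: noise_def scalar_prod_def lessThan_atLeast0 sum_distrib_left mult_ac)

lemma u_unit: "i \<in> {1..D} \<Longrightarrow> (\<Sum>j<D. (u i $ j)\<^sup>2) = 1"
  using u_orth[of i i] carrier_vecD[OF u_carrier[of i]]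
  by (simp add: scalar_prod_def lessThan_atLeast0 power2_eq_square)

lemma noise_carrier: "noise D \<delta> z \<in> carrier_vec D"
  by (simp add: noise_def)

lemma nn_integral_noise_sq:
  assumes "\<And>i. i \<in> {1..D} \<Longrightarrow> 0 \<le> a i" and "0 \<le> b"
  shows "(\<integral>\<^sup>+z. ennreal ((\<Sum>i=1..D. a i * (noise D \<delta> z \<bullet> u i)\<^sup>2) + b) \<partial>std_gauss D) =
    ennreal (\<delta>\<^sup>2 * (\<Sum>i=1..D. a i) + b)"
proof -
  interpret prob_space "std_gauss D" by (rule prob_space_std_gauss)
  have "(\<integral>\<^sup>+z. ennreal ((\<Sum>i=1..D. a i * (noise D \<delta> z \<bullet> u i)\<^sup>2) + b) \<partial>std_gauss D) =
      (\<integral>\<^sup>+z. (\<Sum>i=1..D. ennreal (a i * \<delta>\<^sup>2) * ennreal ((\<Sum>j<D. u i $ j * z j)\<^sup>2)) + ennreal b \<partial>std_gauss D)"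
  proof (intro nn_integral_cong)
    fix z
    have "(\<Sum>i=1..D. a i * (noise D \<delta> z \<bullet> u i)\<^sup>2) = (\<Sum>i=1..D. (a i * \<delta>\<^sup>2) * (\<Sum>j<D. u i $ j * z j)\<^sup>2)"
      by (intro sum.cong refl) (simp only: noise_coord power_mult_distrib mult.assoc)
    moreover have "ennreal (\<Sum>i=1..D. (a i * \<delta>\<^sup>2) * (\<Sum>j<D. u i $ j * z j)\<^sup>2) =
        (\<Sum>i=1..D. ennreal (a i * \<delta>\<^sup>2) * ennreal ((\<Sum>j<D. u i $ j * z j)\<^sup>2))"
      using assms(1) by (subst sum_ennreal[symmetric]) (auto simp: ennreal_mult)
    ultimately show "ennreal ((\<Sum>i=1..D. a i * (noise D \<delta> z \<bullet> u i)\<^sup>2) + b) =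
        (\<Sum>i=1..D. ennreal (a i * \<delta>\<^sup>2) * ennreal ((\<Sum>j<D. u i $ j * z j)\<^sup>2)) + ennreal b"
      using assms by (subst ennreal_plus) (auto intro!: sum_nonneg)
  qed
  also have "\<dots> = (\<Sum>i=1..D. ennreal (a i * \<delta>\<^sup>2) * (\<integral>\<^sup>+z. ennreal ((\<Sum>j<D. u i $ j * z j)\<^sup>2) \<partial>std_gauss D)) + ennreal b"
    by (simp add: nn_integral_add nn_integral_sum nn_integral_cmult emeasure_space_1)
  also have "\<dots> = (\<Sum>i=1..D. ennreal (a i * \<delta>\<^sup>2)) + ennreal b"
    by (intro arg_cong2[where f = "(+)"] sum.cong refl)
      (simp only: nn_integral_unit_combination_sq[OF u_unit] mult_1_right)
  also have "(\<Sum>i=1..D. ennreal (a i * \<delta>\<^sup>2)) = ennreal (\<Sum>i=1..D. a i * \<delta>\<^sup>2)"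
    using assms(1) by (intro sum_ennreal) auto
  also have "\<dots> + ennreal b = ennreal ((\<Sum>i=1..D. a i * \<delta>\<^sup>2) + b)"
    using assms by (intro ennreal_plus[symmetric] sum_nonneg) auto
  also have "(\<Sum>i=1..D. a i * \<delta>\<^sup>2) = \<delta>\<^sup>2 * (\<Sum>i=1..D. a i)"
    by (simp only: sum_distrib_right[symmetric] mult.commute)
  finally show ?thesis .
qed

lemma AE_noise_nonzero:
  assumes "0 < \<delta>"
  shows "AE z in std_gauss D. \<forall>i\<in>{1..D}. c i + noise D \<delta> z \<bullet> u i \<noteq> 0"
proof (subst AE_ball_countable)
  show "\<forall>i\<in>{1..D}. AE z in std_gauss D. c i + noise D \<delta> z \<bullet> u i \<noteq> 0"
  proof
    fix i assume i: "i \<in> {1..D}"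
    show "AE z in std_gauss D. c i + noise D \<delta> z \<bullet> u i \<noteq> 0"
      using AE_unit_combination[OF u_unit[OF i], of "- c i / \<delta>"]
    proof eventually_elim
      fix z :: "nat \<Rightarrow> real" assume ne: "(\<Sum>j<D. u i $ j * z j) \<noteq> - c i / \<delta>"
      have "\<delta> * (\<Sum>j<D. u i $ j * z j) \<noteq> - c i"
      proof
        assume eq: "\<delta> * (\<Sum>j<D. u i $ j * z j) = - c i"
        have "(\<Sum>j<D. u i $ j * z j) = - c i / \<delta>"
          unfolding eq[symmetric] using assms by simp
        with ne show False by simp
      qed
      then show "c i + noise D \<delta> z \<bullet> u i \<noteq> 0"
        unfolding noise_coord[OF i] by linarith
    qed
  qed
qed simp

text \<open>\<open>s\<close> is fixed before the noise is drawn, so the bound is linear in the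
  squared noise coefficients, each of mean \<open>\<delta>\<^sup>2\<close>, although the oracle is
  random. \<open>nn_integral_mono_AE\<close> compares the integrals without measurability of the
  loss at the oracle.\<close>

lemma oracle_risk_le:
  assumes f: "f \<in> carrier_vec P" and R: "0 \<le> R" "source_norm A l v \<mu> f \<le> R"
    and \<mu>: "0 < \<mu>" and \<delta>: "0 < \<delta>" and s: "0 < s"
  defines "K \<equiv> (1 + 2 * \<mu>) powr (1 + 2 * \<mu>)" and "M \<equiv> \<Sum>i=1..D. min 1 (s * (l i)\<^sup>2)"
  shows "oracle_risk prediction_loss A l u \<delta> f \<le> ennreal (4 * (\<delta>\<^sup>2 * M) + 4 * K * R\<^sup>2 * s powr (- (1 + 2 * \<mu>)))"
    and "oracle_risk reconstruction_loss A l u \<delta> f \<le> ennreal (6 * s * (\<delta>\<^sup>2 * M) + (6 * K + 2) * R\<^sup>2 * s powr (- (2 * \<mu>)))"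
proof -
  let ?V = "\<lambda>z. \<Sum>i=1..D. min 1 (s * (l i)\<^sup>2) * (noise D \<delta> z \<bullet> u i)\<^sup>2"
  let ?est = "\<lambda>z. cg_est A l u (A *\<^sub>v f + noise D \<delta> z) (balanced_oracle A l u f (noise D \<delta> z))"
  have K: "0 \<le> K" by (simp add: K_def)
  have AE: "AE z in std_gauss D.
      prediction_loss A f (?est z) \<le> 4 * (?V z + K * R\<^sup>2 * s powr (- (1 + 2 * \<mu>))) \<and>
      reconstruction_loss A f (?est z) \<le> 6 * s * ?V z + (6 * K + 2) * R\<^sup>2 * s powr (- (2 * \<mu>))"
    using AE_noise_nonzero[OF \<delta>, of "\<lambda>i. l i * (f \<bullet> v i)"]
  proof eventually_elim
    fix z assume nz: "\<forall>i\<in>{1..D}. l i * (f \<bullet> v i) + noise D \<delta> z \<bullet> u i \<noteq> 0"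
    \<comment> \<open>The pathwise theory is instantiated at one fixed \<open>z\<close> outside the
      null set.\<close>
    interpret cg_model D P A l u v f "noise D \<delta> z"
      using f noise_carrier nz by unfold_locales auto
    show "prediction_loss A f (?est z) \<le> 4 * (?V z + K * R\<^sup>2 * s powr (- (1 + 2 * \<mu>))) \<and>
      reconstruction_loss A f (?est z) \<le> 6 * s * ?V z + (6 * K + 2) * R\<^sup>2 * s powr (- (2 * \<mu>))"
      unfolding Y_def[symmetric] balanced_oracle_eq losses_eq K_def
      using oracle_bounds[OF \<mu> s source_sum[OF f R]] by blast
  qed
  have "oracle_risk prediction_loss A l u \<delta> f \<le>
      (\<integral>\<^sup>+z. ennreal ((\<Sum>i=1..D. (4 * min 1 (s * (l i)\<^sup>2)) * (noise D \<delta> z \<bullet> u i)\<^sup>2) + 4 * K * R\<^sup>2 * s powr (- (1 + 2 * \<mu>))) \<partial>std_gauss D)"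
    unfolding oracle_risk_def Let_def dims
  proof (intro nn_integral_mono_AE, use AE in eventually_elim)
    case (elim z)
    then show ?case
      by (intro ennreal_leI) (simp add: sum_distrib_left[of 4] mult.assoc)
  qed
  also have "\<dots> = ennreal (\<delta>\<^sup>2 * (\<Sum>i=1..D. 4 * min 1 (s * (l i)\<^sup>2)) + 4 * K * R\<^sup>2 * s powr (- (1 + 2 * \<mu>)))"
    using s K by (intro nn_integral_noise_sq) auto
  finally show "oracle_risk prediction_loss A l u \<delta> f \<le> ennreal (4 * (\<delta>\<^sup>2 * M) + 4 * K * R\<^sup>2 * s powr (- (1 + 2 * \<mu>)))"
    by (simp add: M_def sum_distrib_left[symmetric] mult_ac)
  have "oracle_risk reconstruction_loss A l u \<delta> f \<le>
      (\<integral>\<^sup>+z. ennreal ((\<Sum>i=1..D. (6 * s * min 1 (s * (l i)\<^sup>2)) * (noise D \<delta> z \<bullet> u i)\<^sup>2) + (6 * K + 2) * R\<^sup>2 * s powr (- (2 * \<mu>))) \<partial>std_gauss D)"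
    unfolding oracle_risk_def Let_def dims
  proof (intro nn_integral_mono_AE, use AE in eventually_elim)
    case (elim z)
    then show ?case
      by (intro ennreal_leI) (simp add: sum_distrib_left mult.assoc)
  qed
  also have "\<dots> = ennreal (\<delta>\<^sup>2 * (\<Sum>i=1..D. 6 * s * min 1 (s * (l i)\<^sup>2)) + (6 * K + 2) * R\<^sup>2 * s powr (- (2 * \<mu>)))"
    using s K by (intro nn_integral_noise_sq) auto
  finally show "oracle_risk reconstruction_loss A l u \<delta> f \<le> ennreal (6 * s * (\<delta>\<^sup>2 * M) + (6 * K + 2) * R\<^sup>2 * s powr (- (2 * \<mu>)))"
    by (simp add: M_def sum_distrib_left[symmetric] mult_ac)
qed

end

subsection \<open>Minimax bounds\<close>

text \<open>A kept coefficient has error \<open>e\<close> and a dropped one has error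
  \<open>g\<close>, and in the second case \<open>(s * x) powr (- a)\<close> is at least 1.\<close>

lemma cutoff_error:
  fixes x g e s :: real
  assumes "0 < x" "0 < s" "0 \<le> a"
  defines "h \<equiv> if 1 \<le> s * x then 1 else 0"
  shows "(h * (g + e) - g)\<^sup>2 \<le> min 1 (s * x) * e\<^sup>2 + s powr (- a) * (x powr (- a) * g\<^sup>2)"
proof (cases "1 \<le> s * x")
  case True
  then show ?thesis by (simp add: h_def)
next
  case False
  have "1 \<le> (s * x) powr (- a)"
    using assms False powr_mono2'[of "- a" "s * x" 1] by simp
  then have "1 * g\<^sup>2 \<le> (s * x) powr (- a) * g\<^sup>2"
    by (rule mult_right_mono) simp
  also have "\<dots> = s powr (- a) * (x powr (- a) * g\<^sup>2)"
    using assms by (simp add: powr_mult)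
  finally have "g\<^sup>2 \<le> s powr (- a) * (x powr (- a) * g\<^sup>2)"
    by simp
  moreover have "0 \<le> min 1 (s * x) * e\<^sup>2"
    using assms by simp
  ultimately show ?thesis
    using False by (simp add: h_def)
qed

context svd
begin

lemma dim_apply_AAT [simp]: "dim_vec (apply_AAT A l u h w) = D"
  by (simp add: apply_AAT_def)

definition cutoff_est :: "real \<Rightarrow> real vec \<Rightarrow> real vec" where
  "cutoff_est s y = pinv A *\<^sub>v apply_AAT A l u (\<lambda>x. if 1 \<le> s * x then 1 else 0) y"

text \<open>The estimator is linear in the data; written out as a finite sum of coordinates, its
  measurability is immediate.\<close>

lemma cutoff_est_measurable: "cutoff_est s \<in> estimators D P"
proof -
  have "cutoff_est s y \<in> carrier_vec P" for y
    by (simp add: cutoff_est_def pinv_vec)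
  moreover have "(\<lambda>y. cutoff_est s (vec D y) $ j) \<in> borel_measurable (\<Pi>\<^sub>M i\<in>{..<D}. borel)" if j: "j < P" for j
  proof -
    let ?h = "\<lambda>x. if 1 \<le> s * x then 1 else 0 :: real"
    have "cutoff_est s (vec D y) $ j =
        (\<Sum>k<D. pinv A $$ (j, k) * (\<Sum>i=1..D. ?h ((l i)\<^sup>2) * (\<Sum>m<D. y m * u i $ m) * u i $ k))" for y
    proof -
      have "cutoff_est s (vec D y) $ j = row (pinv A) j \<bullet> apply_AAT A l u ?h (vec D y)"
        unfolding cutoff_est_def using pinv_carrier j by (intro index_mult_mat_vec) auto
      also have "\<dots> = (\<Sum>k<D. pinv A $$ (j, k) * (apply_AAT A l u ?h (vec D y) $ k))"
        using pinv_carrier j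
        by (simp add: scalar_prod_def lessThan_atLeast0)
      also have "\<dots> = (\<Sum>k<D. pinv A $$ (j, k) * (\<Sum>i=1..D. ?h ((l i)\<^sup>2) * (vec D y \<bullet> u i) * u i $ k))"
        by (intro sum.cong refl) (simp add: apply_AAT_def)
      also have "\<dots> = (\<Sum>k<D. pinv A $$ (j, k) * (\<Sum>i=1..D. ?h ((l i)\<^sup>2) * (\<Sum>m<D. y m * u i $ m) * u i $ k))"
      proof (intro sum.cong refl arg_cong2[where f = "(*)"])
        fix i assume "i \<in> {1..D}"
        then show "vec D y \<bullet> u i = (\<Sum>m<D. y m * u i $ m)"
          using carrier_vecD[OF u_carrier[of i]] by (simp add: scalar_prod_def lessThan_atLeast0)
      qed
      finally show ?thesis .
    qed
    then show ?thesis by simp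
  qed
  ultimately show ?thesis
    by (simp add: estimators_def)
qed

lemma minimax_risk_le:
  assumes R: "0 \<le> R" and \<mu>: "0 < \<mu>" and s: "0 < s"
  defines "M \<equiv> \<Sum>i=1..D. min 1 (s * (l i)\<^sup>2)"
  shows "minimax_risk prediction_loss A \<delta> (source_ball A l v \<mu> R) \<le>
      ennreal (\<delta>\<^sup>2 * M + R\<^sup>2 * s powr (- (1 + 2 * \<mu>)))"
    and "minimax_risk reconstruction_loss A \<delta> (source_ball A l v \<mu> R) \<le>
      ennreal (s * (\<delta>\<^sup>2 * M) + R\<^sup>2 * s powr (- (2 * \<mu>)))"
proof -
  let ?h = "\<lambda>x. if 1 \<le> s * x then 1 else 0 :: real"
  let ?w = "\<lambda>f z. apply_AAT A l u ?h (A *\<^sub>v f + noise D \<delta> z)"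
  let ?V = "\<lambda>z. \<Sum>i=1..D. min 1 (s * (l i)\<^sup>2) * (noise D \<delta> z \<bullet> u i)\<^sup>2"
  have coord: "?w f z \<bullet> u i = ?h ((l i)\<^sup>2) * (l i * (f \<bullet> v i) + noise D \<delta> z \<bullet> u i)"
    if "f \<in> carrier_vec P" "i \<in> {1..D}" for f z i
  proof -
    have "(A *\<^sub>v f + noise D \<delta> z) \<bullet> u i = (A *\<^sub>v f) \<bullet> u i + noise D \<delta> z \<bullet> u i"
      using that A u_carrier[of i] noise_carrier by (intro add_scalar_prod_distrib) auto
    then show ?thesis
      using that by (simp only: apply_AAT_coord A_coord)
  qed
  have split: "s powr (- (1 + 2 * \<mu>)) * s = s powr (- (2 * \<mu>))"
    using s powr_add[of s "- (1 + 2 * \<mu>)" 1] by simp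
  have pred: "prediction_loss A f (cutoff_est s (A *\<^sub>v f + noise D \<delta> z)) \<le> ?V z + R\<^sup>2 * s powr (- (1 + 2 * \<mu>))"
    and rec: "reconstruction_loss A f (cutoff_est s (A *\<^sub>v f + noise D \<delta> z)) \<le>
        (\<Sum>i=1..D. (s * min 1 (s * (l i)\<^sup>2)) * (noise D \<delta> z \<bullet> u i)\<^sup>2) + R\<^sup>2 * s powr (- (2 * \<mu>))"
    if f: "f \<in> carrier_vec P" "source_norm A l v \<mu> f \<le> R" for f z
  proof -
    let ?g = "\<lambda>i. l i * (f \<bullet> v i)" and ?e = "\<lambda>i. noise D \<delta> z \<bullet> u i"
    note src = source_sum[OF f(1) R f(2)]
    have "prediction_loss A f (cutoff_est s (A *\<^sub>v f + noise D \<delta> z)) =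
        (\<Sum>i=1..D. (?h ((l i)\<^sup>2) * (?g i + ?e i) - ?g i)\<^sup>2)"
      unfolding cutoff_est_def prediction_loss_pinv[OF f(1) apply_AAT_carrier]
      by (intro sum.cong refl) (simp only: coord[OF f(1)])
    also have "\<dots> \<le> (\<Sum>i=1..D. min 1 (s * (l i)\<^sup>2) * (?e i)\<^sup>2 +
        s powr (- (1 + 2 * \<mu>)) * ((l i)\<^sup>2 powr (- (1 + 2 * \<mu>)) * (?g i)\<^sup>2))"
      using s \<mu> by (intro sum_mono cutoff_error zero_less_power l_pos) auto
    also have "\<dots> = ?V z + s powr (- (1 + 2 * \<mu>)) * (\<Sum>i=1..D. (l i)\<^sup>2 powr (- (1 + 2 * \<mu>)) * (?g i)\<^sup>2)"
      by (simp only: sum.distrib sum_distrib_left)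
    also have "\<dots> \<le> ?V z + s powr (- (1 + 2 * \<mu>)) * R\<^sup>2"
      using src by (intro add_left_mono mult_left_mono) auto
    finally show "prediction_loss A f (cutoff_est s (A *\<^sub>v f + noise D \<delta> z)) \<le> ?V z + R\<^sup>2 * s powr (- (1 + 2 * \<mu>))"
      by (simp only: mult.commute)
    have "reconstruction_loss A f (cutoff_est s (A *\<^sub>v f + noise D \<delta> z)) =
        (\<Sum>i=1..D. (?h ((l i)\<^sup>2) * (?g i + ?e i) - ?g i)\<^sup>2 / (l i)\<^sup>2)"
      unfolding cutoff_est_def reconstruction_loss_pinv[OF f(1) apply_AAT_carrier]
      by (intro sum.cong refl) (simp only: coord[OF f(1)])
    also have "\<dots> \<le> (\<Sum>i=1..D. (s * min 1 (s * (l i)\<^sup>2)) * (?e i)\<^sup>2 +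
        s powr (- (2 * \<mu>)) * ((l i)\<^sup>2 powr (- (1 + 2 * \<mu>)) * (?g i)\<^sup>2))"
    proof (intro sum_mono)
      fix i assume i: "i \<in> {1..D}"
      define x where "x = (l i)\<^sup>2"
      have x: "0 < x" using l_pos[OF i] by (simp add: x_def)
      show "(?h ((l i)\<^sup>2) * (?g i + ?e i) - ?g i)\<^sup>2 / (l i)\<^sup>2 \<le> (s * min 1 (s * (l i)\<^sup>2)) * (?e i)\<^sup>2 +
        s powr (- (2 * \<mu>)) * ((l i)\<^sup>2 powr (- (1 + 2 * \<mu>)) * (?g i)\<^sup>2)"
        unfolding x_def[symmetric]
      proof (cases "1 \<le> s * x")
        case True
        then have "1 / x \<le> s"
          using x by (simp add: divide_simps)
        then have "1 / x * (?e i)\<^sup>2 \<le> s * (?e i)\<^sup>2"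
          by (rule mult_right_mono) simp
        then have "(?e i)\<^sup>2 / x \<le> s * (?e i)\<^sup>2"
          by simp
        moreover have "0 \<le> s powr (- (2 * \<mu>)) * (x powr (- (1 + 2 * \<mu>)) * (?g i)\<^sup>2)"
          by simp
        ultimately have "(?e i)\<^sup>2 / x \<le> s * (?e i)\<^sup>2 + s powr (- (2 * \<mu>)) * (x powr (- (1 + 2 * \<mu>)) * (?g i)\<^sup>2)"
          by linarith
        then show "(?h x * (?g i + ?e i) - ?g i)\<^sup>2 / x \<le> (s * min 1 (s * x)) * (?e i)\<^sup>2 +
            s powr (- (2 * \<mu>)) * (x powr (- (1 + 2 * \<mu>)) * (?g i)\<^sup>2)"
          using True by simp
      next
        case False
        \<comment> \<open>A dropped coefficient does not involve the noise, so
          \<open>cutoff_error\<close> is applied with noise 0. The exponent \<open>2 * \<mu>\<close>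
          leaves room for the division by \<open>x\<close>, which completes it to
          \<open>1 + 2 * \<mu>\<close>.\<close>
        have "(?h x * (?g i + ?e i) - ?g i)\<^sup>2 \<le> min 1 (s * x) * 0\<^sup>2 + s powr (- (2 * \<mu>)) * (x powr (- (2 * \<mu>)) * (?g i)\<^sup>2)"
          using cutoff_error[OF x s, of "2 * \<mu>" "?g i" 0] False \<mu> by simp
        then have "(?h x * (?g i + ?e i) - ?g i)\<^sup>2 / x \<le> s powr (- (2 * \<mu>)) * (x powr (- (2 * \<mu>)) * (?g i)\<^sup>2) / x"
          using x by (intro divide_right_mono) auto
        also have "\<dots> = s powr (- (2 * \<mu>)) * ((x powr (- (2 * \<mu>)) / x) * (?g i)\<^sup>2)"
          by simp
        also have "x powr (- (2 * \<mu>)) / x = x powr (- (2 * \<mu>) - 1)"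
          using x by (simp add: powr_diff)
        also have "- (2 * \<mu>) - 1 = - (1 + 2 * \<mu>)"
          by simp
        finally have "(?h x * (?g i + ?e i) - ?g i)\<^sup>2 / x \<le> s powr (- (2 * \<mu>)) * (x powr (- (1 + 2 * \<mu>)) * (?g i)\<^sup>2)" .
        moreover have "0 \<le> (s * min 1 (s * x)) * (?e i)\<^sup>2"
          using s x by simp
        ultimately show "(?h x * (?g i + ?e i) - ?g i)\<^sup>2 / x \<le> (s * min 1 (s * x)) * (?e i)\<^sup>2 +
            s powr (- (2 * \<mu>)) * (x powr (- (1 + 2 * \<mu>)) * (?g i)\<^sup>2)"
          by linarith
      qed
    qed
    also have "\<dots> = (\<Sum>i=1..D. (s * min 1 (s * (l i)\<^sup>2)) * (?e i)\<^sup>2) +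
        s powr (- (2 * \<mu>)) * (\<Sum>i=1..D. (l i)\<^sup>2 powr (- (1 + 2 * \<mu>)) * (?g i)\<^sup>2)"
      by (simp only: sum.distrib sum_distrib_left)
    also have "\<dots> \<le> (\<Sum>i=1..D. (s * min 1 (s * (l i)\<^sup>2)) * (?e i)\<^sup>2) + s powr (- (2 * \<mu>)) * R\<^sup>2"
      using src by (intro add_left_mono mult_left_mono) auto
    finally show "reconstruction_loss A f (cutoff_est s (A *\<^sub>v f + noise D \<delta> z)) \<le>
        (\<Sum>i=1..D. (s * min 1 (s * (l i)\<^sup>2)) * (noise D \<delta> z \<bullet> u i)\<^sup>2) + R\<^sup>2 * s powr (- (2 * \<mu>))"
      by (simp only: mult.commute[of "R\<^sup>2"])
  qed
  show "minimax_risk prediction_loss A \<delta> (source_ball A l v \<mu> R) \<le>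
      ennreal (\<delta>\<^sup>2 * M + R\<^sup>2 * s powr (- (1 + 2 * \<mu>)))"
    unfolding minimax_risk_def dims
  proof (rule INF_lower2[OF cutoff_est_measurable[of s]], rule SUP_least)
    fix f assume "f \<in> source_ball A l v \<mu> R"
    then have f: "f \<in> carrier_vec P" "source_norm A l v \<mu> f \<le> R"
      by (auto simp: source_ball_def)
    have "(\<integral>\<^sup>+z. ennreal (prediction_loss A f (cutoff_est s (A *\<^sub>v f + noise D \<delta> z))) \<partial>std_gauss D) \<le>
        (\<integral>\<^sup>+z. ennreal (?V z + R\<^sup>2 * s powr (- (1 + 2 * \<mu>))) \<partial>std_gauss D)"
      using pred[OF f] by (intro nn_integral_mono ennreal_leI)
    also have "\<dots> = ennreal (\<delta>\<^sup>2 * M + R\<^sup>2 * s powr (- (1 + 2 * \<mu>)))"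
      unfolding M_def using s by (intro nn_integral_noise_sq) auto
    finally show "(\<integral>\<^sup>+z. ennreal (prediction_loss A f (cutoff_est s (A *\<^sub>v f + noise D \<delta> z))) \<partial>std_gauss D) \<le>
        ennreal (\<delta>\<^sup>2 * M + R\<^sup>2 * s powr (- (1 + 2 * \<mu>)))" .
  qed
  show "minimax_risk reconstruction_loss A \<delta> (source_ball A l v \<mu> R) \<le>
      ennreal (s * (\<delta>\<^sup>2 * M) + R\<^sup>2 * s powr (- (2 * \<mu>)))"
    unfolding minimax_risk_def dims
  proof (rule INF_lower2[OF cutoff_est_measurable[of s]], rule SUP_least)
    fix f assume "f \<in> source_ball A l v \<mu> R"
    then have f: "f \<in> carrier_vec P" "source_norm A l v \<mu> f \<le> R"
      by (auto simp: source_ball_def)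
    have "(\<integral>\<^sup>+z. ennreal (reconstruction_loss A f (cutoff_est s (A *\<^sub>v f + noise D \<delta> z))) \<partial>std_gauss D) \<le>
        (\<integral>\<^sup>+z. ennreal ((\<Sum>i=1..D. (s * min 1 (s * (l i)\<^sup>2)) * (noise D \<delta> z \<bullet> u i)\<^sup>2) + R\<^sup>2 * s powr (- (2 * \<mu>))) \<partial>std_gauss D)"
      using rec[OF f] by (intro nn_integral_mono ennreal_leI)
    also have "\<dots> = ennreal (\<delta>\<^sup>2 * (\<Sum>i=1..D. s * min 1 (s * (l i)\<^sup>2)) + R\<^sup>2 * s powr (- (2 * \<mu>)))"
      using s by (intro nn_integral_noise_sq) auto
    also have "\<delta>\<^sup>2 * (\<Sum>i=1..D. s * min 1 (s * (l i)\<^sup>2)) = s * (\<delta>\<^sup>2 * M)"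
      by (simp only: M_def sum_distrib_left[symmetric] mult.left_commute)
    finally show "(\<integral>\<^sup>+z. ennreal (reconstruction_loss A f (cutoff_est s (A *\<^sub>v f + noise D \<delta> z))) \<partial>std_gauss D) \<le>
        ennreal (s * (\<delta>\<^sup>2 * M) + R\<^sup>2 * s powr (- (2 * \<mu>)))" .
  qed
qed

end

section \<open>Assouad's lower bound on a hypercube\<close>

lemma sum_Pow_pairs:
  fixes F :: "'a set \<Rightarrow> ennreal"
  assumes J: "finite J" and i: "i \<in> J"
    and pair: "\<And>S. S \<subseteq> J - {i} \<Longrightarrow> b \<le> F (insert i S) + F S"
  shows "of_nat (2 ^ (card J - 1)) * b \<le> (\<Sum>S\<in>Pow J. F S)"
proof -
  \<comment> \<open>Subsets of \<open>J\<close> are the vertices of a cube. Each subset of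
    \<open>?K\<close> starts one edge in direction \<open>i\<close>, and there are
    \<open>2 ^ (card J - 1)\<close> such edges.\<close>
  let ?K = "J - {i}"
  have inj: "inj_on (insert i) (Pow ?K)"
    by (rule inj_onI) blast
  have "Pow J = Pow ?K \<union> insert i ` Pow ?K"
    using Pow_insert[of i ?K] i by (simp add: insert_absorb)
  then have "(\<Sum>S\<in>Pow J. F S) = (\<Sum>S\<in>Pow ?K. F S) + (\<Sum>S\<in>insert i ` Pow ?K. F S)"
    using J by (simp only:) (intro sum.union_disjoint, auto)
  also have "\<dots> = (\<Sum>S\<in>Pow ?K. F (insert i S) + F S)"
    by (simp add: sum.reindex[OF inj] sum.distrib add.commute)
  also have "\<dots> \<ge> (\<Sum>S\<in>Pow ?K. b)"
    by (intro sum_mono) (auto intro: pair)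
  also have "(\<Sum>S\<in>Pow ?K. b) = of_nat (2 ^ (card J - 1)) * b"
    using J i by (simp add: card_Pow)
  finally show ?thesis by simp
qed

context svd
begin

lemma A_lincomb: "A *\<^sub>v lincomb_fam P {1..D} c v = lincomb_fam D {1..D} (\<lambda>i. l i * c i) u"
proof -
  let ?w = "A *\<^sub>v lincomb_fam P {1..D} c v" and ?w' = "lincomb_fam D {1..D} (\<lambda>i. l i * c i) u"
  have w: "?w \<in> carrier_vec D"
    using A by (rule mult_mat_vec_carrier) simp
  have 0: "?w - ?w' = 0\<^sub>v D"
  proof (rule eq_0_of_coords)
    fix i assume i: "i \<in> {1..D}"
    have "(?w - ?w') \<bullet> u i = ?w \<bullet> u i - ?w' \<bullet> u i"
      using w u_carrier[OF i] by (intro minus_scalar_prod_distrib) auto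
    also have "?w \<bullet> u i = l i * (lincomb_fam P {1..D} c v \<bullet> v i)"
      by (rule A_coord[OF _ i]) simp
    also have "lincomb_fam P {1..D} c v \<bullet> v i = c i"
      using i by (intro scalar_prod_lincomb_fam_orthonormal) (auto simp: v_carrier v_orth)
    also have "?w' \<bullet> u i = l i * c i"
      using i by (intro scalar_prod_lincomb_fam_orthonormal) (auto simp: u_carrier u_orth)
    finally show "(?w - ?w') \<bullet> u i = 0" by simp
  qed (use w in simp)
  show ?thesis
  proof (rule eq_vecI)
    fix j assume "j < dim_vec ?w'"
    then have "j < D" by (simp add: lincomb_fam_def)
    then have "(?w - ?w') $ j = 0"
      by (simp only: 0 index_zero_vec)
    then show "?w $ j = ?w' $ j"
      using \<open>j < D\<close> by (simp add: lincomb_fam_def)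
  qed (simp add: lincomb_fam_def)
qed

definition cube :: "nat \<Rightarrow> (nat \<Rightarrow> real) \<Rightarrow> nat set \<Rightarrow> real vec" where
  "cube m a S = lincomb_fam P {1..D} (\<lambda>i. if i \<le> m then (if i \<in> S then a i else - a i) else 0) v"

lemma cube_carrier [simp]: "cube m a S \<in> carrier_vec P"
  by (simp add: cube_def)

lemma cube_coord:
  assumes "i \<in> {1..D}"
  shows "cube m a S \<bullet> v i = (if i \<le> m then (if i \<in> S then a i else - a i) else 0)"
  unfolding cube_def using assms by (intro scalar_prod_lincomb_fam_orthonormal) (auto simp: v_carrier v_orth)

text \<open>The part of the mean of the data without direction \<open>i\<close>. It is common to the
  two ends of an edge in direction \<open>i\<close> and serves as the centre between their
  laws.\<close>

definition cube_mean :: "nat \<Rightarrow> (nat \<Rightarrow> real) \<Rightarrow> nat \<Rightarrow> nat set \<Rightarrow> nat \<Rightarrow> real" where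
  "cube_mean m a i S k =
    (\<Sum>j\<in>{1..D} - {i}. l j * (if j \<le> m then (if j \<in> S then a j else - a j) else 0) * u j $ k)"

lemma A_cube:
  assumes i: "i \<in> {1..D}" "i \<le> m" and k: "k < D"
  shows "(A *\<^sub>v cube m a S) $ k = cube_mean m a i S k + (if i \<in> S then a i else - a i) * l i * u i $ k"
proof -
  let ?c = "\<lambda>j. l j * (if j \<le> m then (if j \<in> S then a j else - a j) else 0) * u j $ k"
  have "(A *\<^sub>v cube m a S) $ k = (\<Sum>j\<in>{1..D}. ?c j)"
    unfolding cube_def A_lincomb using k by (simp add: lincomb_fam_def)
  also have "\<dots> = ?c i + (\<Sum>j\<in>{1..D} - {i}. ?c j)"
    using i by (intro sum.remove) auto
  finally show ?thesis
    using i by (simp add: cube_mean_def mult_ac)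
qed

lemma cube_mean_insert: "cube_mean m a i (insert i S) k = cube_mean m a i S k"
  unfolding cube_mean_def by (intro sum.cong refl) auto

text \<open>After subtracting \<open>cube_mean\<close> and dividing by \<open>\<delta>\<close>, the
  data at the two ends are standard noise shifted by \<open>\<kappa>\<close> and
  \<open>- \<kappa>\<close> along \<open>u i\<close>. The two losses add up to at least
  \<open>2 * \<omega> * (a i)\<^sup>2\<close>, of which \<open>two_point_bound\<close> retains a
  quarter.\<close>

lemma cube_two_point:
  assumes T: "T \<in> estimators D P" and i: "i \<in> {1..D}" "i \<le> m" "i \<notin> S"
    and \<kappa>: "\<bar>\<kappa>\<bar> \<le> 1 / 2" "a i * l i = \<kappa> * \<delta>" and \<omega>: "0 \<le> \<omega>"
  defines "G \<equiv> \<lambda>S. \<integral>\<^sup>+z. ennreal (\<omega> * (T (A *\<^sub>v cube m a S + noise D \<delta> z) \<bullet> v i - cube m a S \<bullet> v i)\<^sup>2) \<partial>std_gauss D"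
  shows "ennreal (\<omega> * (a i)\<^sup>2 / 2) \<le> G (insert i S) + G S"
proof -
  \<comment> \<open>The estimated coefficient as one function of the standardised data; the same
    function serves both ends of the edge.\<close>
  define t where "t y = T (vec D (\<lambda>k. cube_mean m a i S k + \<delta> * y k)) \<bullet> v i" for y :: "nat \<Rightarrow> real"
  have shift: "T (A *\<^sub>v cube m a S' + noise D \<delta> z) \<bullet> v i = t (\<lambda>k\<in>{..<D}. z k + (if i \<in> S' then \<kappa> else - \<kappa>) * u i $ k)"
    if "S' = insert i S \<or> S' = S" for S' z
  proof -
    have "A *\<^sub>v cube m a S' + noise D \<delta> z =
        vec D (\<lambda>k. cube_mean m a i S k + \<delta> * (\<lambda>k\<in>{..<D}. z k + (if i \<in> S' then \<kappa> else - \<kappa>) * u i $ k) k)"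
    proof (rule eq_vecI)
      fix k assume "k < dim_vec (vec D (\<lambda>k. cube_mean m a i S k + \<delta> * (\<lambda>k\<in>{..<D}. z k + (if i \<in> S' then \<kappa> else - \<kappa>) * u i $ k) k))"
      then have k: "k < D" by simp
      have "(A *\<^sub>v cube m a S' + noise D \<delta> z) $ k = (A *\<^sub>v cube m a S') $ k + \<delta> * z k"
        using k by (simp add: noise_def)
      also have "\<dots> = cube_mean m a i S k + (if i \<in> S' then a i * l i else - (a i * l i)) * u i $ k + \<delta> * z k"
        unfolding A_cube[OF i(1,2) k] using that by (auto simp: cube_mean_insert)
      also have "\<dots> = cube_mean m a i S k + \<delta> * (z k + (if i \<in> S' then \<kappa> else - \<kappa>) * u i $ k)"
        unfolding \<kappa>(2) by (simp add: distrib_left)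
      finally show "(A *\<^sub>v cube m a S' + noise D \<delta> z) $ k =
          vec D (\<lambda>k. cube_mean m a i S k + \<delta> * (\<lambda>k\<in>{..<D}. z k + (if i \<in> S' then \<kappa> else - \<kappa>) * u i $ k) k) $ k"
        using k by simp
    qed (simp add: noise_def)
    then show ?thesis
      by (simp only: t_def)
  qed
  have Tm: "(\<lambda>y. T (vec D y) $ j) \<in> borel_measurable (\<Pi>\<^sub>M i\<in>{..<D}. borel)" if "j < P" for j
    using T that by (simp add: estimators_def)
  have "t \<in> borel_measurable (\<Pi>\<^sub>M i\<in>{..<D}. borel)"
  proof -
    \<comment> \<open>The restriction changes nothing in \<open>vec D\<close> but puts the argument
      into the product space on which \<open>T\<close> is known to be measurable.\<close>
    have "t = (\<lambda>y. \<Sum>j<P. T (vec D (\<lambda>k\<in>{..<D}. cube_mean m a i S k + \<delta> * y k)) $ j * v i $ j)"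
    proof
      fix y
      have "vec D (\<lambda>k. cube_mean m a i S k + \<delta> * y k) = vec D (\<lambda>k\<in>{..<D}. cube_mean m a i S k + \<delta> * y k)"
        by (intro eq_vecI) auto
      then show "t y = (\<Sum>j<P. T (vec D (\<lambda>k\<in>{..<D}. cube_mean m a i S k + \<delta> * y k)) $ j * v i $ j)"
        unfolding t_def using carrier_vecD[OF v_carrier[OF i(1)]] by (simp add: scalar_prod_def lessThan_atLeast0)
    qed
    moreover have "(\<lambda>y. T (vec D (\<lambda>k\<in>{..<D}. cube_mean m a i S k + \<delta> * y k)) $ j) \<in> borel_measurable (\<Pi>\<^sub>M i\<in>{..<D}. borel)"
      if "j < P" for j
      by (rule measurable_compose[OF _ Tm[OF that]]) measurable
    ultimately show ?thesis
      by (simp only:) (intro borel_measurable_sum borel_measurable_times, auto)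
  qed
  note [measurable] = this
  let ?G1 = "\<lambda>y. ennreal (\<omega> * (t y - a i)\<^sup>2)" and ?G2 = "\<lambda>y. ennreal (\<omega> * (t y + a i)\<^sup>2)"
  have "ennreal (2 * \<omega> * (a i)\<^sup>2 / 4) \<le> (\<integral>\<^sup>+z. ?G1 (\<lambda>k\<in>{..<D}. z k + \<kappa> * u i $ k) \<partial>std_gauss D) +
      (\<integral>\<^sup>+z. ?G2 (\<lambda>k\<in>{..<D}. z k - \<kappa> * u i $ k) \<partial>std_gauss D)"
  proof (rule two_point_bound[OF u_unit[OF i(1)] \<kappa>(1)])
    fix y
    have "2 * \<omega> * (a i)\<^sup>2 \<le> \<omega> * (2 * (a i)\<^sup>2 + 2 * (t y)\<^sup>2)"
      using \<omega> by (simp add: distrib_left)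
    also have "\<dots> = \<omega> * (t y - a i)\<^sup>2 + \<omega> * (t y + a i)\<^sup>2"
      by (simp add: power2_eq_square algebra_simps)
    finally have "ennreal (2 * \<omega> * (a i)\<^sup>2) \<le> ennreal (\<omega> * (t y - a i)\<^sup>2 + \<omega> * (t y + a i)\<^sup>2)"
      by (rule ennreal_leI)
    also have "\<dots> = ?G1 y + ?G2 y"
      using \<omega> by (intro ennreal_plus) auto
    finally show "ennreal (2 * \<omega> * (a i)\<^sup>2) \<le> ?G1 y + ?G2 y" .
  qed (use \<omega> in auto)
  also have "(\<integral>\<^sup>+z. ?G1 (\<lambda>k\<in>{..<D}. z k + \<kappa> * u i $ k) \<partial>std_gauss D) = G (insert i S)"
    unfolding G_def using shift[of "insert i S"] cube_coord[OF i(1), of m a "insert i S"] i by simp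
  also have "(\<integral>\<^sup>+z. ?G2 (\<lambda>k\<in>{..<D}. z k - \<kappa> * u i $ k) \<partial>std_gauss D) = G S"
    unfolding G_def using shift[of S] cube_coord[OF i(1), of m a S] i by simp
  finally show ?thesis by simp
qed

text \<open>The supremum over the ball dominates the average over the \<open>2 ^ m\<close> vertices.
  A loss bounded below by a weighted sum over directions splits into edges:
  \<open>2 ^ (m - 1)\<close> of them in direction \<open>i\<close>, each worth
  \<open>\<omega> i * (a i)\<^sup>2 / 2\<close>. The weights \<open>\<omega>\<close> allow both
  losses to be treated at once.\<close>

lemma assouad:
  assumes m: "m \<le> D" and \<kappa>: "\<bar>\<kappa>\<bar> \<le> 1 / 2" and a: "\<And>i. i \<in> {1..m} \<Longrightarrow> a i * l i = \<kappa> * \<delta>"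
    and \<omega>: "\<And>i. 0 \<le> \<omega> i"
    and loss: "\<And>f h. f \<in> carrier_vec P \<Longrightarrow> h \<in> carrier_vec P \<Longrightarrow>
        (\<Sum>i=1..D. \<omega> i * (h \<bullet> v i - f \<bullet> v i)\<^sup>2) \<le> loss A f h"
    and F: "\<And>S. cube m a S \<in> F"
  shows "ennreal (\<Sum>i=1..m. \<omega> i * (a i)\<^sup>2 / 4) \<le> minimax_risk loss A \<delta> F"
  unfolding minimax_risk_def dims
proof (rule INF_greatest)
  fix T assume T: "T \<in> estimators D P"
  let ?J = "{1..m}"
  let ?risk = "\<lambda>f. \<integral>\<^sup>+z. ennreal (loss A f (T (A *\<^sub>v f + noise D \<delta> z))) \<partial>std_gauss D"
  let ?G = "\<lambda>i S. \<integral>\<^sup>+z. ennreal (\<omega> i * (T (A *\<^sub>v cube m a S + noise D \<delta> z) \<bullet> v i - cube m a S \<bullet> v i)\<^sup>2) \<partial>std_gauss D"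
  have Tc: "T y \<in> carrier_vec P" if "y \<in> carrier_vec D" for y
    using T that by (simp add: estimators_def)
  have Tm: "(\<lambda>y. T (vec D y) $ j) \<in> borel_measurable (\<Pi>\<^sub>M i\<in>{..<D}. borel)" if "j < P" for j
    using T that by (simp add: estimators_def)
  have meas: "(\<lambda>z. ennreal (\<omega> i * (T (A *\<^sub>v cube m a S + noise D \<delta> z) \<bullet> v i - cube m a S \<bullet> v i)\<^sup>2)) \<in> borel_measurable (std_gauss D)"
    if i: "i \<in> {1..D}" for i S
  proof -
    have eq: "A *\<^sub>v cube m a S + noise D \<delta> z = vec D (\<lambda>k\<in>{..<D}. (A *\<^sub>v cube m a S) $ k + \<delta> * z k)" for z
      by (intro eq_vecI) (auto simp: noise_def)
    have eq2: "T (A *\<^sub>v cube m a S + noise D \<delta> z) \<bullet> v i =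
        (\<Sum>j<P. T (vec D (\<lambda>k\<in>{..<D}. (A *\<^sub>v cube m a S) $ k + \<delta> * z k)) $ j * v i $ j)" for z
      unfolding eq using carrier_vecD[OF v_carrier[OF i]] by (simp add: scalar_prod_def lessThan_atLeast0)
    have [measurable]: "(\<lambda>z. T (vec D (\<lambda>k\<in>{..<D}. (A *\<^sub>v cube m a S) $ k + \<delta> * z k)) $ j) \<in> borel_measurable (\<Pi>\<^sub>M i\<in>{..<D}. borel)"
      if "j < P" for j
      by (rule measurable_compose[OF _ Tm[OF that]]) measurable
    show ?thesis
      unfolding eq2 by measurable
  qed
  have "(\<Sum>i\<in>?J. of_nat (2 ^ (m - 1)) * ennreal (\<omega> i * (a i)\<^sup>2 / 2)) \<le> (\<Sum>i\<in>?J. \<Sum>S\<in>Pow ?J. ?G i S)"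
  proof (intro sum_mono)
    fix i assume i: "i \<in> ?J"
    then have iD: "i \<in> {1..D}" "i \<le> m"
      using m by auto
    have "of_nat (2 ^ (card ?J - 1)) * ennreal (\<omega> i * (a i)\<^sup>2 / 2) \<le> (\<Sum>S\<in>Pow ?J. ?G i S)"
    proof (rule sum_Pow_pairs)
      fix S assume "S \<subseteq> ?J - {i}"
      then have "i \<notin> S" by blast
      then show "ennreal (\<omega> i * (a i)\<^sup>2 / 2) \<le> ?G i (insert i S) + ?G i S"
        by (rule cube_two_point[where a = a and \<kappa> = \<kappa>, OF T iD _ \<kappa> a[OF i] \<omega>])
    qed (use i in auto)
    then show "of_nat (2 ^ (m - 1)) * ennreal (\<omega> i * (a i)\<^sup>2 / 2) \<le> (\<Sum>S\<in>Pow ?J. ?G i S)"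
      by simp
  qed
  also have "\<dots> = (\<Sum>S\<in>Pow ?J. \<Sum>i\<in>?J. ?G i S)"
    by (rule sum.swap)
  also have "\<dots> \<le> (\<Sum>S\<in>Pow ?J. SUP f\<in>F. ?risk f)"
  proof (intro sum_mono)
    fix S assume "S \<in> Pow ?J"
    have "(\<Sum>i\<in>?J. ?G i S) \<le> (\<Sum>i\<in>{1..D}. ?G i S)"
      using m by (intro sum_mono2) auto
    also have "\<dots> = (\<integral>\<^sup>+z. (\<Sum>i=1..D. ennreal (\<omega> i * (T (A *\<^sub>v cube m a S + noise D \<delta> z) \<bullet> v i - cube m a S \<bullet> v i)\<^sup>2)) \<partial>std_gauss D)"
      by (intro nn_integral_sum[symmetric] meas)
    also have "\<dots> \<le> ?risk (cube m a S)"
    proof (intro nn_integral_mono)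
      fix z
      have "A *\<^sub>v cube m a S + noise D \<delta> z \<in> carrier_vec D"
        using A noise_carrier by simp
      then have "(\<Sum>i=1..D. \<omega> i * (T (A *\<^sub>v cube m a S + noise D \<delta> z) \<bullet> v i - cube m a S \<bullet> v i)\<^sup>2) \<le>
          loss A (cube m a S) (T (A *\<^sub>v cube m a S + noise D \<delta> z))"
        by (intro loss Tc) auto
      then show "(\<Sum>i=1..D. ennreal (\<omega> i * (T (A *\<^sub>v cube m a S + noise D \<delta> z) \<bullet> v i - cube m a S \<bullet> v i)\<^sup>2)) \<le>
          ennreal (loss A (cube m a S) (T (A *\<^sub>v cube m a S + noise D \<delta> z)))"
        using \<omega> by (subst sum_ennreal) (auto intro: ennreal_leI)
    qed
    also have "\<dots> \<le> (SUP f\<in>F. ?risk f)"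
      by (rule SUP_upper[OF F])
    finally show "(\<Sum>i\<in>?J. ?G i S) \<le> (SUP f\<in>F. ?risk f)" .
  qed
  also have "\<dots> = ennreal (2 ^ m) * (SUP f\<in>F. ?risk f)"
    by (simp add: card_Pow ennreal_power[symmetric])
  also have "(\<Sum>i\<in>?J. of_nat (2 ^ (m - 1)) * ennreal (\<omega> i * (a i)\<^sup>2 / 2)) =
      ennreal (2 ^ m) * ennreal (\<Sum>i=1..m. \<omega> i * (a i)\<^sup>2 / 4)"
  proof -
    have "(\<Sum>i\<in>?J. of_nat (2 ^ (m - 1)) * ennreal (\<omega> i * (a i)\<^sup>2 / 2)) = (\<Sum>i\<in>?J. ennreal (2 ^ m * (\<omega> i * (a i)\<^sup>2 / 4)))"
    proof (intro sum.cong refl)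
      fix i assume "i \<in> ?J"
      then have "(2::real) ^ m = 2 * 2 ^ (m - 1)"
        by (cases m) auto
      then have eq: "2 ^ (m - 1) * (\<omega> i * (a i)\<^sup>2 / 2) = 2 ^ m * (\<omega> i * (a i)\<^sup>2 / 4)"
        by simp
      have "of_nat (2 ^ (m - 1)) * ennreal (\<omega> i * (a i)\<^sup>2 / 2) = ennreal (2 ^ (m - 1) * (\<omega> i * (a i)\<^sup>2 / 2))"
        unfolding ennreal_of_nat_eq_real_of_nat using \<omega>[of i] by (subst ennreal_mult[symmetric]) auto
      then show "of_nat (2 ^ (m - 1)) * ennreal (\<omega> i * (a i)\<^sup>2 / 2) = ennreal (2 ^ m * (\<omega> i * (a i)\<^sup>2 / 4))"
        by (simp only: eq)
    qed
    also have "\<dots> = ennreal (2 ^ m * (\<Sum>i=1..m. \<omega> i * (a i)\<^sup>2 / 4))"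
      unfolding sum_distrib_left using \<omega> by (intro sum_ennreal) auto
    also have "\<dots> = ennreal (2 ^ m) * ennreal (\<Sum>i=1..m. \<omega> i * (a i)\<^sup>2 / 4)"
      using \<omega> by (intro ennreal_mult sum_nonneg) auto
    finally show ?thesis .
  qed
  finally show "ennreal (\<Sum>i=1..m. \<omega> i * (a i)\<^sup>2 / 4) \<le> (SUP f\<in>F. ?risk f)"
    by (subst (asm) ennreal_mult_le_mult_iff) auto
qed

end

subsection \<open>Rates\<close>

text \<open>Comparison with the integral of \<open>x powr (- q)\<close> in telescoping form. The
  increment bound follows from \<open>1 + t \<le> exp t\<close> and
  \<open>ln (1 - 1 / y) \<le> - (1 / y)\<close>.\<close>

lemma sum_powr_tail_le:
  fixes q :: real
  assumes q: "1 < q" and m: "0 < m" "m \<le> n"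
  shows "(\<Sum>i=Suc m..n. real i powr (- q)) \<le> (real m powr (1 - q) - real n powr (1 - q)) / (q - 1)"
  using m(2)
proof (induction n rule: dec_induct)
  case base
  then show ?case by simp
next
  case (step n)
  define y where "y = real (Suc n)"
  have y: "1 < y" "real n = y - 1"
    using m(1) step by (auto simp: y_def)
  have "1 + (q - 1) * (1 / y) \<le> exp ((q - 1) * (1 / y))"
    by (rule exp_ge_add_one_self)
  also have "\<dots> \<le> exp ((1 - q) * ln (1 - 1 / y))"
  proof -
    have "ln (1 - 1 / y) \<le> - (1 / y)"
      using y by (intro ln_one_minus_pos_upper_bound) auto
    then have "(q - 1) * ln (1 - 1 / y) \<le> (q - 1) * - (1 / y)"
      using q by (intro mult_left_mono) auto
    then show ?thesis
      by (simp add: left_diff_distrib)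
  qed
  also have "\<dots> = (1 - 1 / y) powr (1 - q)"
    using y by (simp add: powr_def)
  finally have "y powr (1 - q) * (1 + (q - 1) * (1 / y)) \<le> y powr (1 - q) * (1 - 1 / y) powr (1 - q)"
    by (rule mult_left_mono) simp
  also have "\<dots> = real n powr (1 - q)"
    using y by (simp add: powr_mult[symmetric] right_diff_distrib)
  finally have "y powr (1 - q) + (q - 1) * (y powr (1 - q) / y) \<le> real n powr (1 - q)"
    by (simp add: distrib_left mult_ac)
  moreover have "y powr (1 - q) / y = y powr (- q)"
    using y powr_diff[of y "1 - q" 1] by simp
  ultimately have "(q - 1) * y powr (- q) \<le> real n powr (1 - q) - y powr (1 - q)"
    by simp
  then have "y powr (- q) \<le> (real n powr (1 - q) - y powr (1 - q)) / (q - 1)"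
    using q by (simp add: pos_le_divide_eq mult.commute)
  then have "(\<Sum>i=Suc m..Suc n. real i powr (- q)) \<le>
      (real m powr (1 - q) - real n powr (1 - q)) / (q - 1) + (real n powr (1 - q) - y powr (1 - q)) / (q - 1)"
    using step by (simp add: y_def)
  then show ?case
    by (simp add: y_def flip: add_divide_distrib)
qed

lemma nat_floor_bounds:
  fixes N :: real
  assumes "1 \<le> N"
  shows "0 < nat \<lfloor>N\<rfloor>" "real (nat \<lfloor>N\<rfloor>) \<le> N" "N / 2 \<le> real (nat \<lfloor>N\<rfloor>)"
proof -
  have 1: "1 \<le> \<lfloor>N\<rfloor>"
    using assms by linarith
  then have "real (nat \<lfloor>N\<rfloor>) = of_int \<lfloor>N\<rfloor>" "(1 :: real) \<le> of_int \<lfloor>N\<rfloor>"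
    by auto
  with 1 floor_correct[of N] show "0 < nat \<lfloor>N\<rfloor>" "real (nat \<lfloor>N\<rfloor>) \<le> N" "N / 2 \<le> real (nat \<lfloor>N\<rfloor>)"
    by linarith+
qed

text \<open>Up to \<open>N\<close> the terms are bounded by 1; beyond it the tail is of order
  \<open>N powr (1 - q)\<close> and the prefactor \<open>N powr q\<close> brings it back to order
  \<open>N\<close>. The power of 2 comes from replacing the integer part of \<open>N\<close> by
  \<open>N / 2\<close>.\<close>

lemma sum_min_powr_le:
  fixes q c N :: real
  assumes q: "1 < q" and c: "0 < c" and N: "1 \<le> N"
  shows "(\<Sum>i=1..D. min 1 (N powr q * (c * real i powr (- q)))) \<le> (1 + c * 2 powr (q - 1) / (q - 1)) * N"
proof -
  define m where "m = nat \<lfloor>N\<rfloor>"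
  have m: "0 < m" "real m \<le> N" "N / 2 \<le> real m"
    using nat_floor_bounds[OF N] by (auto simp: m_def)
  \<comment> \<open>Extending the sum covers the case of a \<open>D\<close> below the splitting
    point.\<close>
  define n where "n = max D m"
  let ?f = "\<lambda>i. min 1 (N powr q * (c * real i powr (- q)))"
  have "(\<Sum>i=1..D. ?f i) \<le> (\<Sum>i=1..n. ?f i)"
    using c by (intro sum_mono2) (auto simp: n_def)
  also have "\<dots> = (\<Sum>i=1..m. ?f i) + (\<Sum>i=Suc m..n. ?f i)"
  proof -
    have "{1..n} = {1..m} \<union> {Suc m..n}" by (auto simp: n_def)
    then show ?thesis by (simp only:) (intro sum.union_disjoint, auto)
  qed
  also have "(\<Sum>i=1..m. ?f i) \<le> (\<Sum>i=1..m. 1)"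
    by (intro sum_mono) simp
  also have "(\<Sum>i=1..m. 1) = real m" by simp
  also have "real m \<le> N" by fact
  also have "(\<Sum>i=Suc m..n. ?f i) \<le> (\<Sum>i=Suc m..n. N powr q * c * real i powr (- q))"
    by (intro sum_mono) simp
  also have "\<dots> = N powr q * c * (\<Sum>i=Suc m..n. real i powr (- q))"
    by (rule sum_distrib_left[symmetric])
  also have "\<dots> \<le> N powr q * c * ((N / 2) powr (1 - q) / (q - 1))"
  proof (intro mult_left_mono)
    have "(\<Sum>i=Suc m..n. real i powr (- q)) \<le> (real m powr (1 - q) - real n powr (1 - q)) / (q - 1)"
      using q m by (intro sum_powr_tail_le) (auto simp: n_def)
    also have "\<dots> \<le> real m powr (1 - q) / (q - 1)"
      using q by (intro divide_right_mono) auto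
    also have "\<dots> \<le> (N / 2) powr (1 - q) / (q - 1)"
      using q m N by (intro divide_right_mono powr_mono2') auto
    finally show "(\<Sum>i=Suc m..n. real i powr (- q)) \<le> (N / 2) powr (1 - q) / (q - 1)" .
  qed (use c in auto)
  also have "\<dots> = c * 2 powr (q - 1) / (q - 1) * N"
  proof -
    have "(N / 2) powr (1 - q) = N powr (1 - q) * 2 powr (q - 1)"
    proof -
      have "(N / 2) powr (1 - q) = N powr (1 - q) / 2 powr (1 - q)"
        by (rule powr_divide)
      moreover have "2 powr (q - 1) = 1 / 2 powr (1 - q)"
        using powr_minus_divide[of 2 "1 - q"] by simp
      ultimately show ?thesis by simp
    qed
    moreover have "N powr q * N powr (1 - q) = N"
      using N powr_add[of N q "1 - q"] by simp
    moreover have "N powr q * c * (N powr (1 - q) * 2 powr (q - 1) / (q - 1)) =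
        c * 2 powr (q - 1) / (q - 1) * (N powr q * N powr (1 - q))"
      by simp
    ultimately show ?thesis
      by simp
  qed
  finally show ?thesis
    by (simp add: distrib_right)
qed

text \<open>The upper half of the range already suffices: at least \<open>m / 2\<close> indices,
  each at least \<open>m / 2\<close>.\<close>

lemma sum_powr_ge:
  fixes q :: real
  assumes q: "0 \<le> q"
  shows "(real m / 2) powr (q + 1) \<le> (\<Sum>i=1..m. real i powr q)"
proof (cases "m = 0")
  case False
  define k where "k = (m + 1) div 2"
  have k: "0 < k" "k \<le> m" "real m / 2 \<le> real k" "real m / 2 \<le> real (Suc m - k)"
    using False unfolding k_def by linarith+
  have "(real m / 2) powr (q + 1) = (real m / 2) * (real m / 2) powr q"
    using False by (simp add: powr_add)
  also have "\<dots> \<le> real (Suc m - k) * (real m / 2) powr q"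
    using k by (intro mult_right_mono) auto
  also have "\<dots> = (\<Sum>i=k..m. (real m / 2) powr q)"
    by simp
  also have "\<dots> \<le> (\<Sum>i=k..m. real i powr q)"
    using k q by (intro sum_mono powr_mono2) auto
  also have "\<dots> \<le> (\<Sum>i=1..m. real i powr q)"
    using k by (intro sum_mono2) auto
  finally show ?thesis .
qed simp

text \<open>\<open>N\<close> is the effective dimension: the bias and variance bounds balance at \<open>\<rho> = N powr (2 * p)\<close>.\<close>
locale rates =
  fixes \<mu> p R \<delta> :: real
  assumes \<mu>: "0 < \<mu>" and p: "1 / 2 < p" and R: "1 \<le> R" and \<delta>: "0 < \<delta>" "\<delta> < 1"
begin

definition q :: real where "q = 4 * \<mu> * p + 2 * p + 1"

text \<open>The solution of \<open>\<delta>\<^sup>2 * N powr q = R\<^sup>2\<close>. As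
  \<open>q = 1 + 2 * p * (1 + 2 * \<mu>)\<close>, this is the equality of the variance
  \<open>\<delta>\<^sup>2 * N\<close> and the squared bias at \<open>s\<close>.\<close>

definition N :: real where "N = (R\<^sup>2 * \<delta> powr (- 2)) powr (1 / q)"

lemma q_pos: "0 < q"
  using \<mu> p by (simp add: q_def add_pos_pos)

lemma base_ge_1: "1 \<le> R\<^sup>2 * \<delta> powr (- 2)"
proof -
  have "1 \<le> R\<^sup>2" using R by simp
  moreover have "1 \<le> \<delta> powr (- 2)"
    using \<delta> powr_mono2'[of "-2" \<delta> 1] by simp
  ultimately show ?thesis
    using mult_mono[of 1 "R\<^sup>2" 1 "\<delta> powr (- 2)"] by simp
qed

lemma N_ge_1: "1 \<le> N"
  unfolding N_def using base_ge_1 q_pos by (intro ge_one_powr_ge_zero) auto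

lemma N_powr_q: "\<delta>\<^sup>2 * N powr q = R\<^sup>2"
proof -
  have "N powr q = R\<^sup>2 * \<delta> powr (- 2)"
    unfolding N_def powr_powr using base_ge_1 q_pos by simp
  then show ?thesis
    using \<delta> by (simp add: powr_minus powr_numeral)
qed

lemma N_eq: "N = R powr (2 / q) * \<delta> powr (- 2 / q)"
proof -
  have "R\<^sup>2 = R powr 2"
    using R by (simp add: powr_numeral)
  then have "R\<^sup>2 powr (1 / q) = R powr (2 / q)"
    by (simp only: powr_powr) simp
  then show ?thesis
    unfolding N_def using R \<delta> by (simp add: powr_mult powr_powr)
qed

lemma prediction_rate_eq: "prediction_rate \<mu> p R \<delta> = \<delta>\<^sup>2 * N"
proof -
  have "(8 * \<mu> * p + 4 * p) / q = 2 + - 2 / q"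
    using q_pos by (simp add: divide_simps) (simp add: q_def)
  then have "\<delta> powr ((8 * \<mu> * p + 4 * p) / q) = \<delta>\<^sup>2 * \<delta> powr (- 2 / q)"
    using \<delta> by (simp add: powr_add powr_numeral del: minus_divide_left[symmetric])
  then show ?thesis
    unfolding prediction_rate_def N_eq q_def[symmetric] by simp
qed

lemma reconstruction_rate_eq: "reconstruction_rate \<mu> p R \<delta> = \<delta>\<^sup>2 * N powr (2 * p + 1)"
proof -
  have 1: "8 * \<mu> * p / q = 2 + - 2 / q * (2 * p + 1)"
    using q_pos by (simp add: divide_simps) (simp add: q_def algebra_simps)
  have 2: "(4 * p + 2) / q = 2 / q * (2 * p + 1)"
    by simp
  have "\<delta> powr (8 * \<mu> * p / q) = \<delta>\<^sup>2 * \<delta> powr (- 2 / q * (2 * p + 1))"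
    unfolding 1 powr_add using \<delta> by (simp add: powr_numeral)
  moreover have "N powr (2 * p + 1) = R powr (2 / q * (2 * p + 1)) * \<delta> powr (- 2 / q * (2 * p + 1))"
    unfolding N_eq using R \<delta> by (simp only: powr_mult powr_ge_zero powr_powr)
  ultimately show ?thesis
    unfolding reconstruction_rate_def q_def[symmetric] 2 by simp
qed

definition s :: real where "s = N powr (2 * p)"

lemma s_pos: "0 < s"
  using N_ge_1 by (simp add: s_def)

lemma s_variance: "s * (\<delta>\<^sup>2 * N) = \<delta>\<^sup>2 * N powr (2 * p + 1)"
  using N_ge_1 by (simp add: s_def powr_add)

lemma s_bias: "R\<^sup>2 * s powr (- (1 + 2 * \<mu>)) = \<delta>\<^sup>2 * N"
proof -
  have "N powr q * s powr (- (1 + 2 * \<mu>)) = N powr (q + 2 * p * - (1 + 2 * \<mu>))"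
    unfolding s_def powr_powr powr_add[symmetric] ..
  also have "q + 2 * p * - (1 + 2 * \<mu>) = 1"
    by (simp add: q_def algebra_simps)
  finally show ?thesis
    using N_ge_1 unfolding N_powr_q[symmetric] by simp
qed

lemma s_bias': "R\<^sup>2 * s powr (- (2 * \<mu>)) = \<delta>\<^sup>2 * N powr (2 * p + 1)"
proof -
  have "s powr (- (2 * \<mu>)) = s powr (- (1 + 2 * \<mu>)) * s"
    using s_pos powr_add[of s "- (1 + 2 * \<mu>)" 1] by simp
  then have "R\<^sup>2 * s powr (- (2 * \<mu>)) = (R\<^sup>2 * s powr (- (1 + 2 * \<mu>))) * s"
    by (simp only: mult.assoc)
  also have "\<dots> = s * (\<delta>\<^sup>2 * N)"
    unfolding s_bias by (rule mult.commute)
  finally show ?thesis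
    unfolding s_variance .
qed

end

section \<open>Explicit constants and the two sides of the rates\<close>

definition variance_const :: "real \<Rightarrow> real \<Rightarrow> real" where
  "variance_const p C = 1 + C\<^sup>2 * 2 powr (2 * p - 1) / (2 * p - 1)"

text \<open>The constant of \<open>powr_mult_exp_le\<close> for the exponent
  \<open>1 + 2 * \<mu>\<close>, just as \<open>variance_const\<close> is that of
  \<open>sum_min_powr_le\<close> for \<open>q = 2 * p\<close> and the factor
  \<open>C\<^sup>2\<close>.\<close>

definition bias_const :: "real \<Rightarrow> real" where
  "bias_const \<mu> = (1 + 2 * \<mu>) powr (1 + 2 * \<mu>)"

text \<open>The constant of the oracle's reconstruction bound. It dominates those of the prediction
  bound and of the spectral cut-off, so one value serves all upper bounds.\<close>

definition upper_const :: "real \<Rightarrow> real \<Rightarrow> real \<Rightarrow> real" where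
  "upper_const \<mu> p C = 6 * variance_const p C + 6 * bias_const \<mu> + 2"

lemma const_pos:
  assumes "0 < \<mu>" "1 / 2 < p"
  shows "0 < variance_const p C" "0 < bias_const \<mu>" "0 < upper_const \<mu> p C"
proof -
  show 1: "0 < variance_const p C"
    using assms by (auto simp: variance_const_def intro!: add_pos_nonneg)
  show 2: "0 < bias_const \<mu>"
    using assms by (simp add: bias_const_def)
  show "0 < upper_const \<mu> p C"
    unfolding upper_const_def using 1 2 by simp
qed

text \<open>The value 1/2 is the largest shift that \<open>two_point_bound\<close> admits; the power
  of \<open>c\<close> keeps the cube inside the source ball.\<close>

definition amp_const :: "real \<Rightarrow> real \<Rightarrow> real" where
  "amp_const \<mu> c = min (1 / 2) (c powr (2 * \<mu> + 1))"

text \<open>The guaranteed ratio of the cube's dimension to \<open>N\<close>: 1/2 is lost by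
  rounding \<open>N\<close> down, \<open>1 / K\<close> by the limit \<open>D\<close> on the
  dimension.\<close>

definition dim_const :: "real \<Rightarrow> real" where
  "dim_const K = min (1 / 2) (1 / K)"

definition lower_const :: "real \<Rightarrow> real \<Rightarrow> real \<Rightarrow> real \<Rightarrow> real \<Rightarrow> real" where
  "lower_const \<mu> p c C K = min ((amp_const \<mu> c)\<^sup>2 * dim_const K / 4)
     ((amp_const \<mu> c)\<^sup>2 / (4 * C\<^sup>2) * (dim_const K / 2) powr (2 * p + 1))"

lemma amp_const_pos: "0 < c \<Longrightarrow> 0 < amp_const \<mu> c"
  and dim_const_pos: "0 < K \<Longrightarrow> 0 < dim_const K"
  by (simp_all add: amp_const_def dim_const_def)

lemma lower_const_pos:
  assumes "0 < c" "0 < C" "0 < K"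
  shows "0 < lower_const \<mu> p c C K"
proof -
  have "0 < amp_const \<mu> c" "0 < dim_const K"
    using assms by (auto intro: amp_const_pos dim_const_pos)
  with assms show ?thesis
    by (simp add: lower_const_def)
qed

locale svd_rates = svd D P A l u v + rates \<mu> p R \<delta>
  for D P :: nat and A :: "real mat" and l :: "nat \<Rightarrow> real" and u v :: "nat \<Rightarrow> real vec"
    and \<mu> p R \<delta> :: real +
  fixes C :: real
  assumes C: "0 < C" and l_le: "i \<in> {1..D} \<Longrightarrow> l i \<le> C * real i powr (- p)"
begin

abbreviation C0 :: real where "C0 \<equiv> variance_const p C"

abbreviation K0 :: real where "K0 \<equiv> bias_const \<mu>"

abbreviation C_up :: real where "C_up \<equiv> upper_const \<mu> p C"

lemma C_pos: "0 < C0" "0 < K0" "0 < C_up"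
  using const_pos[OF \<mu> p] by auto

lemma variance_le: "(\<Sum>i=1..D. min 1 (s * (l i)\<^sup>2)) \<le> C0 * N"
proof -
  have "(\<Sum>i=1..D. min 1 (s * (l i)\<^sup>2)) \<le> (\<Sum>i=1..D. min 1 (N powr (2 * p) * (C\<^sup>2 * real i powr (- (2 * p)))))"
  proof (intro sum_mono)
    fix i assume i: "i \<in> {1..D}"
    have "(l i)\<^sup>2 \<le> (C * real i powr (- p))\<^sup>2"
      using l_le[OF i] l_pos[OF i] by (intro power_mono) auto
    also have "\<dots> = C\<^sup>2 * real i powr (- (2 * p))"
      by (simp add: power_mult_distrib power2_eq_square flip: powr_add)
    finally have "s * (l i)\<^sup>2 \<le> N powr (2 * p) * (C\<^sup>2 * real i powr (- (2 * p)))"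
      unfolding s_def by (rule mult_left_mono) simp
    then show "min 1 (s * (l i)\<^sup>2) \<le> min 1 (N powr (2 * p) * (C\<^sup>2 * real i powr (- (2 * p))))"
      by simp
  qed
  also have "\<dots> \<le> C0 * N"
    unfolding variance_const_def using p C N_ge_1 by (intro sum_min_powr_le) auto
  finally show ?thesis .
qed

lemma pred_variance_le: "\<delta>\<^sup>2 * (\<Sum>i=1..D. min 1 (s * (l i)\<^sup>2)) \<le> C0 * (\<delta>\<^sup>2 * N)"
  using mult_left_mono[OF variance_le, of "\<delta>\<^sup>2"] by (simp add: mult_ac)

lemma rec_variance_le:
  "s * (\<delta>\<^sup>2 * (\<Sum>i=1..D. min 1 (s * (l i)\<^sup>2))) \<le> C0 * (\<delta>\<^sup>2 * N powr (2 * p + 1))"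
  using mult_left_mono[OF pred_variance_le less_imp_le[OF s_pos]] unfolding s_variance[symmetric]
  by (simp add: mult_ac)

lemma rate_pos: "0 < \<delta>\<^sup>2 * N" "0 < \<delta>\<^sup>2 * N powr (2 * p + 1)"
  using N_ge_1 \<delta> by auto

lemma oracle_risk_rate:
  assumes f: "f \<in> carrier_vec P" "source_norm A l v \<mu> f \<le> R"
  shows "oracle_risk prediction_loss A l u \<delta> f \<le> ennreal (C_up * prediction_rate \<mu> p R \<delta>)"
    and "oracle_risk reconstruction_loss A l u \<delta> f \<le> ennreal (C_up * reconstruction_rate \<mu> p R \<delta>)"
proof -
  let ?M = "\<Sum>i=1..D. min 1 (s * (l i)\<^sup>2)"
  have R0: "0 \<le> R" using R by simp
  note risk = oracle_risk_le[OF f(1) R0 f(2) \<mu> \<delta>(1) s_pos, folded bias_const_def]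
  note risk(1)
  also have "4 * (\<delta>\<^sup>2 * ?M) + 4 * K0 * R\<^sup>2 * s powr (- (1 + 2 * \<mu>)) \<le> 4 * (C0 * (\<delta>\<^sup>2 * N)) + 4 * K0 * (\<delta>\<^sup>2 * N)"
    using pred_variance_le s_bias by (simp add: mult.assoc)
  also have "\<dots> = (4 * C0 + 4 * K0) * (\<delta>\<^sup>2 * N)"
    by (simp only: distrib_right mult.assoc)
  also have "\<dots> \<le> C_up * (\<delta>\<^sup>2 * N)"
    using C_pos rate_pos by (intro mult_right_mono) (auto simp: upper_const_def)
  finally show "oracle_risk prediction_loss A l u \<delta> f \<le> ennreal (C_up * prediction_rate \<mu> p R \<delta>)"
    unfolding prediction_rate_eq by (simp add: ennreal_leI)
  note risk(2)
  also have "6 * s * (\<delta>\<^sup>2 * ?M) + (6 * K0 + 2) * R\<^sup>2 * s powr (- (2 * \<mu>)) \<le>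
      6 * (C0 * (\<delta>\<^sup>2 * N powr (2 * p + 1))) + (6 * K0 + 2) * (\<delta>\<^sup>2 * N powr (2 * p + 1))"
    using rec_variance_le s_bias' by (simp add: mult.assoc)
  also have "\<dots> = C_up * (\<delta>\<^sup>2 * N powr (2 * p + 1))"
    by (simp only: upper_const_def distrib_right mult.assoc add.assoc)
  finally show "oracle_risk reconstruction_loss A l u \<delta> f \<le> ennreal (C_up * reconstruction_rate \<mu> p R \<delta>)"
    unfolding reconstruction_rate_eq by (simp add: ennreal_leI)
qed

lemma minimax_risk_rate:
  "minimax_risk prediction_loss A \<delta> (source_ball A l v \<mu> R) \<le> ennreal (C_up * prediction_rate \<mu> p R \<delta>)"
  "minimax_risk reconstruction_loss A \<delta> (source_ball A l v \<mu> R) \<le> ennreal (C_up * reconstruction_rate \<mu> p R \<delta>)"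
proof -
  let ?M = "\<Sum>i=1..D. min 1 (s * (l i)\<^sup>2)"
  have R0: "0 \<le> R" using R by simp
  note risk = minimax_risk_le[OF R0 \<mu> s_pos, of \<delta>]
  have le: "C0 + 1 \<le> C_up"
    using C_pos by (simp add: upper_const_def)
  note risk(1)
  also have "\<delta>\<^sup>2 * ?M + R\<^sup>2 * s powr (- (1 + 2 * \<mu>)) \<le> C0 * (\<delta>\<^sup>2 * N) + \<delta>\<^sup>2 * N"
    using pred_variance_le s_bias by simp
  also have "\<dots> = (C0 + 1) * (\<delta>\<^sup>2 * N)"
    by (simp add: distrib_right)
  also have "\<dots> \<le> C_up * (\<delta>\<^sup>2 * N)"
    using rate_pos by (intro mult_right_mono le) simp
  finally show "minimax_risk prediction_loss A \<delta> (source_ball A l v \<mu> R) \<le> ennreal (C_up * prediction_rate \<mu> p R \<delta>)"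
    unfolding prediction_rate_eq by (simp add: ennreal_leI)
  note risk(2)
  also have "s * (\<delta>\<^sup>2 * ?M) + R\<^sup>2 * s powr (- (2 * \<mu>)) \<le>
      C0 * (\<delta>\<^sup>2 * N powr (2 * p + 1)) + \<delta>\<^sup>2 * N powr (2 * p + 1)"
    using rec_variance_le s_bias' by simp
  also have "\<dots> = (C0 + 1) * (\<delta>\<^sup>2 * N powr (2 * p + 1))"
    by (simp add: distrib_right)
  also have "\<dots> \<le> C_up * (\<delta>\<^sup>2 * N powr (2 * p + 1))"
    using rate_pos by (intro mult_right_mono le) simp
  finally show "minimax_risk reconstruction_loss A \<delta> (source_ball A l v \<mu> R) \<le> ennreal (C_up * reconstruction_rate \<mu> p R \<delta>)"
    unfolding reconstruction_rate_eq by (simp add: ennreal_leI)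
qed

end

text \<open>\<open>K\<close> makes the constant in the dimension condition explicit. It ensures that
  a number of order \<open>N\<close> of singular directions exists at all, without which a cube of
  that dimension could not be built.\<close>

locale svd_minimax = svd_rates +
  fixes c K :: real
  assumes c: "0 < c" and K: "0 < K" and l_ge: "i \<in> {1..D} \<Longrightarrow> c * real i powr (- p) \<le> l i"
    and N_le': "(R\<^sup>2 * \<delta> powr (-2)) powr (1 / (4 * \<mu> * p + 2 * p + 1)) \<le> K * real D"
begin

lemma N_le: "N \<le> K * real D"
  using N_le' by (simp only: N_def q_def)

abbreviation \<beta> :: real where "\<beta> \<equiv> dim_const K"

abbreviation \<kappa> :: real where "\<kappa> \<equiv> amp_const \<mu> c"

abbreviation c_low :: real where "c_low \<equiv> lower_const \<mu> p c C K"

definition m :: nat where "m = min D (nat \<lfloor>N\<rfloor>)"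

text \<open>Half the side of the cube. After applying \<open>A\<close>, every direction has the same
  half side \<open>\<kappa> * \<delta>\<close>, proportional to the noise level, so that neighbours
  remain hard to distinguish.\<close>

definition amp :: "nat \<Rightarrow> real" where "amp i = \<kappa> * \<delta> / l i"

lemma pos: "0 < \<beta>" "0 < \<kappa>"
  using c K by (auto intro: amp_const_pos dim_const_pos)

lemma m_bounds: "m \<le> D" "real m \<le> N" "\<beta> * N \<le> real m"
proof -
  show "m \<le> D" by (simp add: m_def)
  show "real m \<le> N"
    using nat_floor_bounds(2)[OF N_ge_1] by (simp add: m_def min_def)
  have "\<beta> * N \<le> 1 / 2 * N"
    using N_ge_1 by (intro mult_right_mono) (auto simp: dim_const_def)
  moreover have "\<beta> * N \<le> 1 / K * N"
    using N_ge_1 by (intro mult_right_mono) (auto simp: dim_const_def)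
  moreover have "1 / K * N \<le> real D"
    using N_le K by (simp add: pos_divide_le_eq mult.commute)
  ultimately show "\<beta> * N \<le> real m"
    using nat_floor_bounds(3)[OF N_ge_1] by (auto simp: m_def min_def)
qed

lemma amp: "i \<in> {1..D} \<Longrightarrow> amp i * l i = \<kappa> * \<delta>"
  using l_pos[of i] by (simp add: amp_def)

text \<open>The squared source norm is \<open>(\<kappa> * \<delta>)\<^sup>2\<close> times the sum of
  \<open>l i powr (- (4 * \<mu> + 2))\<close>. The lower bound on \<open>l i\<close> turns each term
  into at most \<open>N powr (q - 1)\<close>, since \<open>p * (4 * \<mu> + 2) = q - 1\<close>, with
  a constant absorbed by \<open>\<kappa>\<close>; at most \<open>N\<close> terms then give
  \<open>\<delta>\<^sup>2 * N powr q = R\<^sup>2\<close>.\<close>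

lemma cube_in_ball: "cube m amp S \<in> source_ball A l v \<mu> R"
proof -
  have "(\<Sum>i=1..D. l i powr (-4 * \<mu>) * (cube m amp S \<bullet> v i)\<^sup>2) =
      (\<Sum>i=1..D. if i \<le> m then l i powr (-4 * \<mu>) * (amp i)\<^sup>2 else 0)"
    by (intro sum.cong refl) (simp only: cube_coord, simp)
  also have "\<dots> = (\<Sum>i=1..m. l i powr (-4 * \<mu>) * (amp i)\<^sup>2)"
    using m_bounds(1) by (simp add: sum.If_cases Int_def) (intro sum.cong, auto)
  also have "\<dots> \<le> (\<Sum>i=1..m. \<delta>\<^sup>2 * N powr (q - 1))"
  proof (intro sum_mono)
    fix i assume "i \<in> {1..m}"
    then have i: "i \<in> {1..D}" "1 \<le> real i" "real i \<le> N"
      using m_bounds by auto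
    let ?b = "4 * \<mu> + 2"
    have "l i powr (- ?b) \<le> (c * real i powr (- p)) powr (- ?b)"
      using l_ge[OF i(1)] c i \<mu> by (intro powr_mono2') auto
    also have "\<dots> = c powr (- ?b) * real i powr (p * ?b)"
      by (simp only: powr_mult powr_powr minus_mult_minus)
    finally have l_powr: "l i powr (- ?b) \<le> c powr (- ?b) * real i powr (p * ?b)" .
    have "l i powr (-4 * \<mu>) * (amp i)\<^sup>2 = \<kappa>\<^sup>2 * \<delta>\<^sup>2 * (l i powr (-4 * \<mu>) * l i powr (- 2))"
      using l_pos[OF i(1)]
      by (simp add: amp_def power_divide power_mult_distrib powr_minus divide_inverse power_inverse)
    also have "l i powr (-4 * \<mu>) * l i powr (- 2) = l i powr (- ?b)"
      unfolding powr_add[symmetric] by simp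
    also have "\<kappa>\<^sup>2 * \<delta>\<^sup>2 * l i powr (- ?b) \<le> \<kappa>\<^sup>2 * \<delta>\<^sup>2 * (c powr (- ?b) * real i powr (p * ?b))"
      by (rule mult_left_mono[OF l_powr]) simp
    also have "\<kappa>\<^sup>2 * \<delta>\<^sup>2 * (c powr (- ?b) * real i powr (p * ?b)) =
        (\<kappa>\<^sup>2 * c powr (- ?b)) * (\<delta>\<^sup>2 * real i powr (p * ?b))"
      by simp
    also have "\<dots> \<le> 1 * (\<delta>\<^sup>2 * real i powr (p * ?b))"
    proof (rule mult_right_mono)
      have "\<kappa>\<^sup>2 \<le> (c powr (2 * \<mu> + 1))\<^sup>2"
        using pos by (intro power_mono) (auto simp: amp_const_def)
      also have "\<dots> = c powr ?b"
        by (simp add: power2_eq_square flip: powr_add)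
      finally have "\<kappa>\<^sup>2 * c powr (- ?b) \<le> c powr ?b * c powr (- ?b)"
        by (rule mult_right_mono) simp
      also have "\<dots> = 1"
        unfolding powr_add[symmetric] using c by simp
      finally show "\<kappa>\<^sup>2 * c powr (- ?b) \<le> 1" .
    qed simp
    also have "\<dots> \<le> \<delta>\<^sup>2 * N powr (p * ?b)"
      using i \<mu> p by (simp add: mult_left_mono powr_mono2)
    also have "p * ?b = q - 1"
      by (simp add: q_def algebra_simps)
    finally show "l i powr (-4 * \<mu>) * (amp i)\<^sup>2 \<le> \<delta>\<^sup>2 * N powr (q - 1)"
      by simp
  qed
  also have "\<dots> = real m * (\<delta>\<^sup>2 * N powr (q - 1))"
    by simp
  also have "\<dots> \<le> N * (\<delta>\<^sup>2 * N powr (q - 1))"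
    using m_bounds by (intro mult_right_mono) auto
  also have "\<dots> = \<delta>\<^sup>2 * (N powr 1 * N powr (q - 1))"
    using N_ge_1 by simp
  also have "\<dots> = R\<^sup>2"
    unfolding powr_add[symmetric] using N_powr_q by simp
  finally have "source_norm A l v \<mu> (cube m amp S) \<le> sqrt (R\<^sup>2)"
    unfolding source_norm_def dims by (rule real_sqrt_le_mono)
  then show ?thesis
    using R by (simp add: source_ball_def)
qed

lemma \<kappa>_le: "\<bar>\<kappa>\<bar> \<le> 1 / 2"
  using pos by (simp add: amp_const_def)

lemma amp_m: "i \<in> {1..m} \<Longrightarrow> amp i * l i = \<kappa> * \<delta>"
  using amp m_bounds(1) by auto

text \<open>With weights \<open>(l i)\<^sup>2\<close> every direction contributes the same amount,
  so Assouad's sum merely counts the \<open>m\<close> directions.\<close>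

lemma minimax_prediction_ge:
  "ennreal (c_low * prediction_rate \<mu> p R \<delta>) \<le> minimax_risk prediction_loss A \<delta> (source_ball A l v \<mu> R)"
proof -
  have "c_low * (\<delta>\<^sup>2 * N) \<le> \<kappa>\<^sup>2 * \<beta> / 4 * (\<delta>\<^sup>2 * N)"
    using rate_pos by (intro mult_right_mono) (auto simp: lower_const_def)
  also have "\<dots> = \<kappa>\<^sup>2 * \<delta>\<^sup>2 / 4 * (\<beta> * N)"
    by simp
  also have "\<dots> \<le> \<kappa>\<^sup>2 * \<delta>\<^sup>2 / 4 * real m"
    using m_bounds by (intro mult_left_mono) auto
  also have "\<dots> = (\<Sum>i=1..m. (\<kappa> * \<delta>)\<^sup>2 / 4)"
    by (simp add: power_mult_distrib)
  also have "\<dots> = (\<Sum>i=1..m. (l i)\<^sup>2 * (amp i)\<^sup>2 / 4)"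
    unfolding power_mult_distrib[symmetric]
    by (intro sum.cong refl) (simp only: mult.commute[of "l _"] amp_m)
  finally have "ennreal (c_low * prediction_rate \<mu> p R \<delta>) \<le> ennreal (\<Sum>i=1..m. (l i)\<^sup>2 * (amp i)\<^sup>2 / 4)"
    unfolding prediction_rate_eq by (rule ennreal_leI)
  also have "\<dots> \<le> minimax_risk prediction_loss A \<delta> (source_ball A l v \<mu> R)"
    by (rule assouad[where \<omega> = "\<lambda>i. (l i)\<^sup>2", OF m_bounds(1) \<kappa>_le amp_m _ _ cube_in_ball])
      (simp_all add: prediction_loss_eq)
  finally show ?thesis .
qed

text \<open>Here the weights are 1 and the contributions grow with \<open>i\<close>: the upper bound
  on \<open>l i\<close> makes \<open>(amp i)\<^sup>2\<close> at least of order
  \<open>\<delta>\<^sup>2 * real i powr (2 * p)\<close>, and the sum gains the power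
  \<open>2 * p + 1\<close>.\<close>

lemma minimax_reconstruction_ge:
  "ennreal (c_low * reconstruction_rate \<mu> p R \<delta>) \<le> minimax_risk reconstruction_loss A \<delta> (source_ball A l v \<mu> R)"
proof -
  have "c_low * (\<delta>\<^sup>2 * N powr (2 * p + 1)) \<le>
      \<kappa>\<^sup>2 / (4 * C\<^sup>2) * (\<beta> / 2) powr (2 * p + 1) * (\<delta>\<^sup>2 * N powr (2 * p + 1))"
    using rate_pos by (intro mult_right_mono) (auto simp: lower_const_def)
  also have "\<dots> = \<kappa>\<^sup>2 * \<delta>\<^sup>2 / (4 * C\<^sup>2) * ((\<beta> / 2) powr (2 * p + 1) * N powr (2 * p + 1))"
    by simp
  also have "(\<beta> / 2) powr (2 * p + 1) * N powr (2 * p + 1) = (\<beta> * N / 2) powr (2 * p + 1)"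
    by (simp flip: powr_mult)
  also have "\<kappa>\<^sup>2 * \<delta>\<^sup>2 / (4 * C\<^sup>2) * (\<beta> * N / 2) powr (2 * p + 1) \<le>
      \<kappa>\<^sup>2 * \<delta>\<^sup>2 / (4 * C\<^sup>2) * (\<Sum>i=1..m. real i powr (2 * p))"
  proof (rule mult_left_mono)
    have "(\<beta> * N / 2) powr (2 * p + 1) \<le> (real m / 2) powr (2 * p + 1)"
      using m_bounds pos N_ge_1 p by (intro powr_mono2) auto
    also have "\<dots> \<le> (\<Sum>i=1..m. real i powr (2 * p))"
      using p by (intro sum_powr_ge) simp
    finally show "(\<beta> * N / 2) powr (2 * p + 1) \<le> (\<Sum>i=1..m. real i powr (2 * p))" .
  qed simp
  also have "\<dots> \<le> (\<Sum>i=1..m. 1 * (amp i)\<^sup>2 / 4)"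
    unfolding sum_distrib_left
  proof (intro sum_mono)
    fix i assume "i \<in> {1..m}"
    then have i: "i \<in> {1..D}" "0 < real i"
      using m_bounds by auto
    have "(l i)\<^sup>2 \<le> (C * real i powr (- p))\<^sup>2"
      using l_le[OF i(1)] l_pos[OF i(1)] by (intro power_mono) auto
    also have "\<dots> = C\<^sup>2 * real i powr (- (2 * p))"
      by (simp add: power_mult_distrib power2_eq_square flip: powr_add)
    finally have "real i powr (2 * p) * (l i)\<^sup>2 \<le> real i powr (2 * p) * (C\<^sup>2 * real i powr (- (2 * p)))"
      by (rule mult_left_mono) simp
    also have "\<dots> = C\<^sup>2"
      using i by (simp add: powr_minus)
    finally have "real i powr (2 * p) / C\<^sup>2 \<le> 1 / (l i)\<^sup>2"
      using C l_pos[OF i(1)] by (simp add: divide_simps mult.commute)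
    then have "\<kappa>\<^sup>2 * \<delta>\<^sup>2 / 4 * (real i powr (2 * p) / C\<^sup>2) \<le> \<kappa>\<^sup>2 * \<delta>\<^sup>2 / 4 * (1 / (l i)\<^sup>2)"
      by (rule mult_left_mono) simp
    then show "\<kappa>\<^sup>2 * \<delta>\<^sup>2 / (4 * C\<^sup>2) * real i powr (2 * p) \<le> 1 * (amp i)\<^sup>2 / 4"
      by (simp add: amp_def power_divide power_mult_distrib mult.commute)
  qed
  finally have "ennreal (c_low * reconstruction_rate \<mu> p R \<delta>) \<le> ennreal (\<Sum>i=1..m. 1 * (amp i)\<^sup>2 / 4)"
    unfolding reconstruction_rate_eq by (rule ennreal_leI)
  also have "\<dots> \<le> minimax_risk reconstruction_loss A \<delta> (source_ball A l v \<mu> R)"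
    by (rule assouad[where \<omega> = "\<lambda>_. 1", OF m_bounds(1) \<kappa>_le amp_m _ _ cube_in_ball])
      (simp_all only: reconstruction_loss_ge mult_1 zero_le_one)
  finally show ?thesis .
qed

lemma oracle_attains:
  "oracle_attains_minimax_rate c_low C_up prediction_loss A l u v \<mu> R \<delta> (prediction_rate \<mu> p R \<delta>)"
  "oracle_attains_minimax_rate c_low C_up reconstruction_loss A l u v \<mu> R \<delta> (reconstruction_rate \<mu> p R \<delta>)"
proof -
  have "f \<in> carrier_vec P" "source_norm A l v \<mu> f \<le> R" if "f \<in> source_ball A l v \<mu> R" for f
    using that by (auto simp: source_ball_def)
  then have "(SUP f\<in>source_ball A l v \<mu> R. oracle_risk prediction_loss A l u \<delta> f) \<le> ennreal (C_up * prediction_rate \<mu> p R \<delta>)"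
    "(SUP f\<in>source_ball A l v \<mu> R. oracle_risk reconstruction_loss A l u \<delta> f) \<le> ennreal (C_up * reconstruction_rate \<mu> p R \<delta>)"
    by (auto intro!: SUP_least oracle_risk_rate)
  then show "oracle_attains_minimax_rate c_low C_up prediction_loss A l u v \<mu> R \<delta> (prediction_rate \<mu> p R \<delta>)"
    "oracle_attains_minimax_rate c_low C_up reconstruction_loss A l u v \<mu> R \<delta> (reconstruction_rate \<mu> p R \<delta>)"
    unfolding oracle_attains_minimax_rate_def
    using minimax_prediction_ge minimax_reconstruction_ge minimax_risk_rate by auto
qed

end

lemma svd_ratesI:
  assumes "model D P A" "singular_system A l u v" "\<forall>i\<in>{1..D}. l i \<le> C * real i powr (-p)"
    "0 < \<mu>" "1 / 2 < p" "0 < C" "1 \<le> R" "0 < \<delta>" "\<delta> < 1"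
  shows "svd_rates D P A l u v \<mu> p R \<delta> C"
  using assms by unfold_locales (auto simp: model_def)

theorem theorem7p6:
  fixes \<mu> p C\<^sub>A :: real
  assumes "0 < \<mu>" and "1 / 2 < p" and "0 < C\<^sub>A"
  shows
    "(\<exists>C>0. \<forall>D P A l u v R \<delta> f.
        model D P A \<longrightarrow> singular_system A l u v \<longrightarrow>
        (\<forall>i\<in>{1..D}. l i \<le> C\<^sub>A * real i powr (-p)) \<longrightarrow>
        1 \<le> R \<longrightarrow> 0 < \<delta> \<longrightarrow> \<delta> < 1 \<longrightarrow>
        f \<in> carrier_vec P \<longrightarrow> source_norm A l v \<mu> f \<le> R \<longrightarrow>
        oracle_risk reconstruction_loss A l u \<delta> f
          \<le> ennreal (C * reconstruction_rate \<mu> p R \<delta>))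
     \<and>
     (\<forall>c\<^sub>A>0. \<forall>K>0. \<exists>c>0. \<exists>C>0. \<forall>D P A l u v R \<delta>.
        model D P A \<longrightarrow> singular_system A l u v \<longrightarrow>
        (\<forall>i\<in>{1..D}. c\<^sub>A * real i powr (-p) \<le> l i \<and> l i \<le> C\<^sub>A * real i powr (-p)) \<longrightarrow>
        1 \<le> R \<longrightarrow> 0 < \<delta> \<longrightarrow> \<delta> < 1 \<longrightarrow>
        (R\<^sup>2 * \<delta> powr (-2)) powr (1 / (4 * \<mu> * p + 2 * p + 1)) \<le> K * real D \<longrightarrow>
        oracle_attains_minimax_rate c C prediction_loss A l u v \<mu> R \<delta>
          (prediction_rate \<mu> p R \<delta>) \<and>
        oracle_attains_minimax_rate c C reconstruction_loss A l u v \<mu> R \<delta>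
          (reconstruction_rate \<mu> p R \<delta>))"
proof (intro conjI allI impI)
  show "\<exists>C>0. \<forall>D P A l u v R \<delta> f.
        model D P A \<longrightarrow> singular_system A l u v \<longrightarrow>
        (\<forall>i\<in>{1..D}. l i \<le> C\<^sub>A * real i powr (-p)) \<longrightarrow>
        1 \<le> R \<longrightarrow> 0 < \<delta> \<longrightarrow> \<delta> < 1 \<longrightarrow>
        f \<in> carrier_vec P \<longrightarrow> source_norm A l v \<mu> f \<le> R \<longrightarrow>
        oracle_risk reconstruction_loss A l u \<delta> f
          \<le> ennreal (C * reconstruction_rate \<mu> p R \<delta>)"
    using svd_rates.oracle_risk_rate(2)[OF svd_ratesI[OF _ _ _ assms]] const_pos(3)[OF assms(1,2)]
    by (intro exI[of _ "upper_const \<mu> p C\<^sub>A"] conjI allI impI) blast+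
next
  fix c\<^sub>A K :: real assume cK: "0 < c\<^sub>A" "0 < K"
  \<comment> \<open>Both witnesses are closed terms in \<open>\<mu>\<close>, \<open>p\<close>,
    \<open>K\<close> and the constants of the singular value bounds, so they can be chosen before
    the dimensions, the matrix, \<open>R\<close> and \<open>\<delta>\<close>.\<close>
  let ?c = "lower_const \<mu> p c\<^sub>A C\<^sub>A K" and ?C = "upper_const \<mu> p C\<^sub>A"
  have "oracle_attains_minimax_rate ?c ?C prediction_loss A l u v \<mu> R \<delta> (prediction_rate \<mu> p R \<delta>) \<and>
      oracle_attains_minimax_rate ?c ?C reconstruction_loss A l u v \<mu> R \<delta> (reconstruction_rate \<mu> p R \<delta>)"
    if "model D P A" "singular_system A l u v"
      "\<forall>i\<in>{1..D}. c\<^sub>A * real i powr (-p) \<le> l i \<and> l i \<le> C\<^sub>A * real i powr (-p)"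
      "1 \<le> R" "0 < \<delta>" "\<delta> < 1"
      "(R\<^sup>2 * \<delta> powr (-2)) powr (1 / (4 * \<mu> * p + 2 * p + 1)) \<le> K * real D" for D P A l u v R \<delta>
  proof -
    interpret svd_rates D P A l u v \<mu> p R \<delta> C\<^sub>A
      using that assms by (intro svd_ratesI) auto
    interpret svd_minimax D P A l u v \<mu> p R \<delta> C\<^sub>A c\<^sub>A K
      using that cK by unfold_locales auto
    show ?thesis
      using oracle_attains by blast
  qed
  moreover have "0 < ?c" "0 < ?C"
    using lower_const_pos const_pos(3) assms cK by auto
  ultimately show "\<exists>c>0. \<exists>C>0. \<forall>D P A l u v R \<delta>.
        model D P A \<longrightarrow> singular_system A l u v \<longrightarrow>
        (\<forall>i\<in>{1..D}. c\<^sub>A * real i powr (-p) \<le> l i \<and> l i \<le> C\<^sub>A * real i powr (-p)) \<longrightarrow>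
        1 \<le> R \<longrightarrow> 0 < \<delta> \<longrightarrow> \<delta> < 1 \<longrightarrow>
        (R\<^sup>2 * \<delta> powr (-2)) powr (1 / (4 * \<mu> * p + 2 * p + 1)) \<le> K * real D \<longrightarrow>
        oracle_attains_minimax_rate c C prediction_loss A l u v \<mu> R \<delta>
          (prediction_rate \<mu> p R \<delta>) \<and>
        oracle_attains_minimax_rate c C reconstruction_loss A l u v \<mu> R \<delta>
          (reconstruction_rate \<mu> p R \<delta>)"
    by (intro exI[of _ ?c] exI[of _ ?C] conjI allI impI) blast+
qed

end
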